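(* The functor $F_1={}^\bullet(-)$ from based $G$-spaces to $\mathscr F$-$G$-spaces is strong symmetric monoidal.
   Context: $G$ is a finite group; spaces are compactly generated weak Hausdorff, and $G\mathscr T$ is the category of nondegenerately based $G$-spaces and based $G$-maps, symmetric monoidal under $\wedge$ with unit $S^0$. $\mathscr F$ is the category of based sets $\mathbf n=\{0,1,\dots,n\}$ (basepoint $0$) and based functions, permutative under $\wedge$ with $\mathbf m\wedge\mathbf n=\mathbf{mn}$ via lexicographic ordering. An $\mathscr F$-$G$-space is a functor $X\colon\mathscr F\to G\mathscr T$ with $X(\mathbf 0)=*$. $\mathscr F$-$G$-spaces are symmetric monoidal under Day convolution: $X\wedge Y$ is the left Kan extension (enriched in based spaces) along $\wedge\colon\mathscr F\times\mathscr F\to\mathscr F$ of $(\mathbf m,\mathbf n)\mapsto X(\mathbf m)\wedge Y(\mathbf n)$, with unit $\mathbf I(\mathbf n)=\mathbf n\cong\mathscr F(\mathbf 1,\mathbf n)$. For $X\in G\mathscr T$, $F_1X={}^\bullet X$ is the $\mathscr F$-$G$-space $\mathbf n\mapsto{}^nX=\mathbf n\wedge X=\mathscr F(\mathbf 1,\mathbf n)\wedge X$, the $n$-fold wedge of copies of $X$. *)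

theory Defs
  imports "HOL-Analysis.Analysis" "HOL-Algebra.Group_Action"
begin

section \<open>Categories, functors, strong symmetric monoidal functors\<close>

text \<open>Arrows carry their source and target, so that composition needs no object arguments.\<close>

record ('o, 'f) arrow =
  src :: 'o
  tgt :: 'o
  mor :: 'f

record ('o, 'm) cat =
  Obj :: "'o set"
  Hom :: "'o \<Rightarrow> 'o \<Rightarrow> 'm set"
  Ident :: "'o \<Rightarrow> 'm"
  Comp :: "'m \<Rightarrow> 'm \<Rightarrow> 'm"  (infixr "\<cdot>\<index>" 70)

record ('o, 'm) moncat = "('o, 'm) cat" +
  Ten :: "'o \<Rightarrow> 'o \<Rightarrow> 'o"
  TenA :: "'m \<Rightarrow> 'm \<Rightarrow> 'm"
  Unit :: 'o
  Assoc :: "'o \<Rightarrow> 'o \<Rightarrow> 'o \<Rightarrow> 'm"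
  LUnit :: "'o \<Rightarrow> 'm"
  RUnit :: "'o \<Rightarrow> 'm"
  Braid :: "'o \<Rightarrow> 'o \<Rightarrow> 'm"

record ('o1, 'm1, 'o2, 'm2) fdata =
  fo :: "'o1 \<Rightarrow> 'o2"
  fa :: "'m1 \<Rightarrow> 'm2"

definition category :: "('o, 'm, 'z) cat_scheme \<Rightarrow> bool" where
  "category C \<longleftrightarrow>
     (\<forall>a\<in>Obj C. Ident C a \<in> Hom C a a) \<and>
     (\<forall>a\<in>Obj C. \<forall>b\<in>Obj C. \<forall>c\<in>Obj C. \<forall>f\<in>Hom C a b. \<forall>g\<in>Hom C b c. g \<cdot>\<^bsub>C\<^esub> f \<in> Hom C a c) \<and>
     (\<forall>a\<in>Obj C. \<forall>b\<in>Obj C. \<forall>f\<in>Hom C a b. f \<cdot>\<^bsub>C\<^esub> Ident C a = f \<and> Ident C b \<cdot>\<^bsub>C\<^esub> f = f) \<and>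
     (\<forall>a\<in>Obj C. \<forall>b\<in>Obj C. \<forall>c\<in>Obj C. \<forall>d\<in>Obj C. \<forall>f\<in>Hom C a b. \<forall>g\<in>Hom C b c. \<forall>h\<in>Hom C c d.
        h \<cdot>\<^bsub>C\<^esub> (g \<cdot>\<^bsub>C\<^esub> f) = (h \<cdot>\<^bsub>C\<^esub> g) \<cdot>\<^bsub>C\<^esub> f)"

definition is_functor ::
  "('o1, 'm1, 'y) cat_scheme \<Rightarrow> ('o2, 'm2, 'z) cat_scheme \<Rightarrow> ('o1, 'm1, 'o2, 'm2) fdata \<Rightarrow> bool" where
  "is_functor C D F \<longleftrightarrow>
     (\<forall>a\<in>Obj C. fo F a \<in> Obj D) \<and>
     (\<forall>a\<in>Obj C. \<forall>b\<in>Obj C. \<forall>f\<in>Hom C a b. fa F f \<in> Hom D (fo F a) (fo F b)) \<and>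
     (\<forall>a\<in>Obj C. fa F (Ident C a) = Ident D (fo F a)) \<and>
     (\<forall>a\<in>Obj C. \<forall>b\<in>Obj C. \<forall>c\<in>Obj C. \<forall>f\<in>Hom C a b. \<forall>g\<in>Hom C b c.
        fa F (g \<cdot>\<^bsub>C\<^esub> f) = fa F g \<cdot>\<^bsub>D\<^esub> fa F f)"

definition is_iso :: "('o, 'm, 'z) cat_scheme \<Rightarrow> 'o \<Rightarrow> 'o \<Rightarrow> 'm \<Rightarrow> bool" where
  "is_iso C a b f \<longleftrightarrow>
     f \<in> Hom C a b \<and> (\<exists>g\<in>Hom C b a. g \<cdot>\<^bsub>C\<^esub> f = Ident C a \<and> f \<cdot>\<^bsub>C\<^esub> g = Ident C b)"

text \<open>
  The monoidal axioms for the two structures themselves are not part of this predicate: it says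
  that \<open>F\<close> is a functor between categories which is strong symmetric monoidal with respect to the
  tensor products, units and constraint isomorphisms recorded in \<open>C\<close> and \<open>D\<close>.
\<close>

definition strong_symmetric_monoidal ::
  "('o1, 'm1, 'y) moncat_scheme \<Rightarrow> ('o2, 'm2, 'z) moncat_scheme \<Rightarrow> ('o1, 'm1, 'o2, 'm2) fdata \<Rightarrow> bool"
where
  "strong_symmetric_monoidal C D F \<longleftrightarrow>
     category C \<and> category D \<and> is_functor C D F \<and>
     (\<exists>\<epsilon> \<phi>.
        is_iso D (Unit D) (fo F (Unit C)) \<epsilon> \<and>
        (\<forall>X\<in>Obj C. \<forall>Y\<in>Obj C. is_iso D (Ten D (fo F X) (fo F Y)) (fo F (Ten C X Y)) (\<phi> X Y)) \<and>
        (\<forall>X\<in>Obj C. \<forall>X'\<in>Obj C. \<forall>Y\<in>Obj C. \<forall>Y'\<in>Obj C. \<forall>f\<in>Hom C X X'. \<forall>g\<in>Hom C Y Y'.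
           \<phi> X' Y' \<cdot>\<^bsub>D\<^esub> TenA D (fa F f) (fa F g) = fa F (TenA C f g) \<cdot>\<^bsub>D\<^esub> \<phi> X Y) \<and>
        (\<forall>X\<in>Obj C. \<forall>Y\<in>Obj C. \<forall>Z\<in>Obj C.
           fa F (Assoc C X Y Z) \<cdot>\<^bsub>D\<^esub> \<phi> (Ten C X Y) Z \<cdot>\<^bsub>D\<^esub> TenA D (\<phi> X Y) (Ident D (fo F Z)) =
           \<phi> X (Ten C Y Z) \<cdot>\<^bsub>D\<^esub> TenA D (Ident D (fo F X)) (\<phi> Y Z)
             \<cdot>\<^bsub>D\<^esub> Assoc D (fo F X) (fo F Y) (fo F Z)) \<and>
        (\<forall>X\<in>Obj C.
           fa F (LUnit C X) \<cdot>\<^bsub>D\<^esub> \<phi> (Unit C) X \<cdot>\<^bsub>D\<^esub> TenA D \<epsilon> (Ident D (fo F X)) = LUnit D (fo F X)) \<and>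
        (\<forall>X\<in>Obj C.
           fa F (RUnit C X) \<cdot>\<^bsub>D\<^esub> \<phi> X (Unit C) \<cdot>\<^bsub>D\<^esub> TenA D (Ident D (fo F X)) \<epsilon> = RUnit D (fo F X)) \<and>
        (\<forall>X\<in>Obj C. \<forall>Y\<in>Obj C.
           fa F (Braid C X Y) \<cdot>\<^bsub>D\<^esub> \<phi> X Y = \<phi> Y X \<cdot>\<^bsub>D\<^esub> Braid D (fo F X) (fo F Y)))"


section \<open>Compactly generated weak Hausdorff spaces\<close>

text \<open>
  A test space is a compact Hausdorff space \<open>K\<close> with a continuous map \<open>u\<close> to \<open>X\<close>.  It is enough to
  let \<open>K\<close> range over topologies on \<open>'a set set\<close>: if \<open>D\<close> is a set of representatives of the fibres
  of \<open>u\<close>, then the closure of \<open>D\<close> in \<open>K\<close> is compact Hausdorff, has the same image as \<open>K\<close>, and has at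
  most $2^{2^{|D|}}$ points.  So the definition of weak Hausdorff below is the usual one.
  In a weak Hausdorff space the image of a test map is itself a compact Hausdorff subspace, so
  these tests also detect the compactly closed sets of weak Hausdorff spaces (and of products of
  such), which are the only ones for which that notion is used.
\<close>

definition test_map :: "'a topology \<Rightarrow> 'a set set topology \<Rightarrow> ('a set set \<Rightarrow> 'a) \<Rightarrow> bool" where
  "test_map X K u \<longleftrightarrow> compact_space K \<and> Hausdorff_space K \<and> continuous_map K X u"

definition weak_Hausdorff :: "'a topology \<Rightarrow> bool" where
  "weak_Hausdorff X \<longleftrightarrow> (\<forall>K u. test_map X K u \<longrightarrow> closedin X (u ` topspace K))"

definition compactly_closed :: "'a topology \<Rightarrow> 'a set \<Rightarrow> bool" where
  "compactly_closed X C \<longleftrightarrow>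
     C \<subseteq> topspace X \<and> (\<forall>K u. test_map X K u \<longrightarrow> closedin K {k \<in> topspace K. u k \<in> C})"

definition CGWH :: "'a topology \<Rightarrow> bool" where
  "CGWH X \<longleftrightarrow> weak_Hausdorff X \<and> (\<forall>C. compactly_closed X C \<longrightarrow> closedin X C)"

definition kify :: "'a topology \<Rightarrow> 'a topology" where
  "kify X = topology (\<lambda>U. U \<subseteq> topspace X \<and> compactly_closed X (topspace X - U))"

definition kprod :: "'a topology \<Rightarrow> 'b topology \<Rightarrow> ('a \<times> 'b) topology" where
  "kprod X Y = kify (prod_topology X Y)"

definition quot_topology :: "'a topology \<Rightarrow> ('a \<Rightarrow> 'b) \<Rightarrow> 'b topology" where
  "quot_topology X q =
     topology (\<lambda>U. U \<subseteq> q ` topspace X \<and> openin X {x \<in> topspace X. q x \<in> U})"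


section \<open>Based \<open>G\<close>-spaces\<close>

text \<open>
  The points of all spaces are taken from one arbitrary infinite type \<open>'u\<close>, which plays the role
  of a universe closed under all constructions used.  Pairs and natural numbers are coded in \<open>'u\<close> by fixed injections.
\<close>

definition upair :: "'u \<Rightarrow> 'u \<Rightarrow> 'u" where
  "upair = curry (SOME f. inj f)"

definition ufst :: "'u \<Rightarrow> 'u" where
  "ufst z = fst (inv_into UNIV (case_prod upair) z)"

definition usnd :: "'u \<Rightarrow> 'u" where
  "usnd z = snd (inv_into UNIV (case_prod upair) z)"

definition unat :: "nat \<Rightarrow> 'u" where
  "unat = (SOME f. inj f)"

definition g_space :: "('g, 'r) monoid_scheme \<Rightarrow> 'a topology \<Rightarrow> ('g \<Rightarrow> 'a \<Rightarrow> 'a) \<Rightarrow> bool" where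
  "g_space G X a \<longleftrightarrow>
     CGWH X \<and> group_action G (topspace X) a \<and> (\<forall>g\<in>carrier G. continuous_map X X (a g))"

record ('g, 'u) bspace =
  spc :: "'u topology"
  pt :: 'u
  act :: "'g \<Rightarrow> 'u \<Rightarrow> 'u"

abbreviation pts :: "('g, 'u) bspace \<Rightarrow> 'u set" where
  "pts X \<equiv> topspace (spc X)"

definition based_g_space :: "('g, 'r) monoid_scheme \<Rightarrow> ('g, 'u) bspace \<Rightarrow> bool" where
  "based_g_space G X \<longleftrightarrow>
     g_space G (spc X) (act X) \<and> pt X \<in> pts X \<and> (\<forall>g\<in>carrier G. act X g (pt X) = pt X)"

text \<open>
  Nondegenerately based: the inclusion of the base point is a \<open>G\<close>-cofibration, i.e. has the
  homotopy extension property for \<open>G\<close>-maps to arbitrary \<open>G\<close>-spaces \<open>Y\<close>.  The universal such \<open>Y\<close>,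
  the mapping cylinder of the inclusion of the base point, fits into the type \<open>'u \<times> real\<close>.
\<close>

definition nondegenerate :: "('g, 'r) monoid_scheme \<Rightarrow> ('g, 'u) bspace \<Rightarrow> bool" where
  "nondegenerate G X \<longleftrightarrow>
     (\<forall>(Y :: ('u \<times> real) topology) b f h.
        g_space G Y b \<and>
        continuous_map (spc X) Y f \<and> (\<forall>g\<in>carrier G. \<forall>x\<in>pts X. f (act X g x) = b g (f x)) \<and>
        continuous_map (top_of_set {0..1::real}) Y h \<and> (\<forall>g\<in>carrier G. \<forall>t\<in>{0..1}. b g (h t) = h t) \<and>
        h 0 = f (pt X)
        \<longrightarrow> (\<exists>H. continuous_map (kprod (spc X) (top_of_set {0..1::real})) Y H \<and>
               (\<forall>g\<in>carrier G. \<forall>x\<in>pts X. \<forall>t\<in>{0..1}. H (act X g x, t) = b g (H (x, t))) \<and>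
               (\<forall>x\<in>pts X. H (x, 0) = f x) \<and> (\<forall>t\<in>{0..1}. H (pt X, t) = h t)))"

type_synonym ('g, 'u) bmap = "(('g, 'u) bspace, 'u \<Rightarrow> 'u) arrow"

definition based_g_maps ::
  "('g, 'r) monoid_scheme \<Rightarrow> ('g, 'u) bspace \<Rightarrow> ('g, 'u) bspace \<Rightarrow> ('g, 'u) bmap set" where
  "based_g_maps G X Y =
     {f. src f = X \<and> tgt f = Y \<and> based_g_space G X \<and> based_g_space G Y \<and>
         mor f \<in> extensional (pts X) \<and> continuous_map (spc X) (spc Y) (mor f) \<and>
         mor f (pt X) = pt Y \<and>
         (\<forall>g\<in>carrier G. \<forall>x\<in>pts X. mor f (act X g x) = act Y g (mor f x))}"

definition bmap :: "('g, 'u) bspace \<Rightarrow> ('g, 'u) bspace \<Rightarrow> ('u \<Rightarrow> 'u) \<Rightarrow> ('g, 'u) bmap" where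
  "bmap X Y f = \<lparr>src = X, tgt = Y, mor = restrict f (pts X)\<rparr>"

text \<open>
  The smash product: the quotient of the product of CGWH spaces which collapses the wedge to
  the base point.  The class of \<open>(x, y)\<close> is represented by (the code of) the pair itself if it is
  not in the wedge, and by the pair of base points otherwise.
\<close>

definition smash_cls :: "('g, 'u) bspace \<Rightarrow> ('g, 'u) bspace \<Rightarrow> 'u \<Rightarrow> 'u \<Rightarrow> 'u" where
  "smash_cls X Y x y = (if x = pt X \<or> y = pt Y then upair (pt X) (pt Y) else upair x y)"

definition smash :: "('g, 'u) bspace \<Rightarrow> ('g, 'u) bspace \<Rightarrow> ('g, 'u) bspace" where
  "smash X Y =
     (let T = quot_topology (kprod (spc X) (spc Y)) (\<lambda>(x, y). smash_cls X Y x y)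
      in \<lparr>spc = T,
          pt = smash_cls X Y (pt X) (pt Y),
          act = (\<lambda>g. \<lambda>z\<in>topspace T. smash_cls X Y (act X g (ufst z)) (act Y g (usnd z)))\<rparr>)"

definition smash_map :: "('g, 'u) bmap \<Rightarrow> ('g, 'u) bmap \<Rightarrow> ('g, 'u) bmap" where
  "smash_map f g =
     bmap (smash (src f) (src g)) (smash (tgt f) (tgt g))
       (\<lambda>z. smash_cls (tgt f) (tgt g) (mor f (ufst z)) (mor g (usnd z)))"

text \<open>The based set \<open>{0, \<dots>, n}\<close> as a discrete space with trivial action; \<open>dspace 1\<close> is \<open>S\<^sup>0\<close>.\<close>

definition dspace :: "nat \<Rightarrow> ('g, 'u) bspace" where
  "dspace n = \<lparr>spc = discrete_topology (unat ` {..n}), pt = unat 0,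
               act = (\<lambda>g. \<lambda>z\<in>unat ` {..n}. z)\<rparr>"

text \<open>\<open>GTop\<close> consists of all based CGWH \<open>G\<close>-spaces, \<open>GT\<close> is its full subcategory of
  nondegenerately based ones.\<close>

definition GTop :: "('g, 'r) monoid_scheme \<Rightarrow> (('g, 'u) bspace, ('g, 'u) bmap) moncat" where
  "GTop G =
     \<lparr>Obj = {X. based_g_space G X},
      Hom = based_g_maps G,
      Ident = (\<lambda>X. bmap X X (\<lambda>x. x)),
      Comp = (\<lambda>g f. bmap (src f) (tgt g) (mor g \<circ> mor f)),
      Ten = smash,
      TenA = smash_map,
      Unit = dspace 1,
      Assoc = (\<lambda>X Y Z. bmap (smash (smash X Y) Z) (smash X (smash Y Z))
                 (\<lambda>z. smash_cls X (smash Y Z) (ufst (ufst z))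
                        (smash_cls Y Z (usnd (ufst z)) (usnd z)))),
      LUnit = (\<lambda>X. bmap (smash (dspace 1) X) X usnd),
      RUnit = (\<lambda>X. bmap (smash X (dspace 1)) X ufst),
      Braid = (\<lambda>X Y. bmap (smash X Y) (smash Y X) (\<lambda>z. smash_cls Y X (usnd z) (ufst z)))\<rparr>"

definition GT :: "('g, 'r) monoid_scheme \<Rightarrow> (('g, 'u) bspace, ('g, 'u) bmap) moncat" where
  "GT G = (GTop G)\<lparr>Obj := {X. based_g_space G X \<and> nondegenerate G X}\<rparr>"


section \<open>The category of finite based sets\<close>

text \<open>
  The object \<open>{0, \<dots>, n}\<close> is represented by \<open>n\<close>; based functions are extended by \<open>0\<close>.
  For \<open>1 \<le> i \<le> m\<close>, \<open>1 \<le> j \<le> n\<close> the pair \<open>(i, j)\<close> has position \<open>lexpos n i j\<close> in the lexicographic order.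
  For \<open>1 \<le> k \<le> m * n\<close> the inverse is \<open>k \<mapsto> (lexl n k, lexr n k)\<close>.
\<close>

type_synonym fmap = "(nat, nat \<Rightarrow> nat) arrow"

definition lexpos :: "nat \<Rightarrow> nat \<Rightarrow> nat \<Rightarrow> nat" where
  "lexpos n i j = (if i = 0 \<or> j = 0 then 0 else (i - 1) * n + j)"

definition lexl :: "nat \<Rightarrow> nat \<Rightarrow> nat" where
  "lexl n k = (k - 1) div n + 1"

definition lexr :: "nat \<Rightarrow> nat \<Rightarrow> nat" where
  "lexr n k = (k - 1) mod n + 1"

definition fmap :: "nat \<Rightarrow> nat \<Rightarrow> (nat \<Rightarrow> nat) \<Rightarrow> fmap" where
  "fmap m n f = \<lparr>src = m, tgt = n, mor = (\<lambda>k. if 1 \<le> k \<and> k \<le> m then f k else 0)\<rparr>"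

definition Fcat :: "(nat, fmap) moncat" where
  "Fcat =
     \<lparr>Obj = UNIV,
      Hom = (\<lambda>m n. {f. src f = m \<and> tgt f = n \<and> mor f 0 = 0 \<and>
                       (\<forall>k\<le>m. mor f k \<le> n) \<and> (\<forall>k>m. mor f k = 0)}),
      Ident = (\<lambda>n. fmap n n (\<lambda>k. k)),
      Comp = (\<lambda>g f. fmap (src f) (tgt g) (mor g \<circ> mor f)),
      Ten = (*),
      TenA = (\<lambda>f g. fmap (src f * src g) (tgt f * tgt g)
                (\<lambda>k. lexpos (tgt g) (mor f (lexl (src g) k)) (mor g (lexr (src g) k)))),
      Unit = 1,
      Assoc = (\<lambda>m n p. fmap (m * n * p) (m * n * p) (\<lambda>k. k)),
      LUnit = (\<lambda>n. fmap n n (\<lambda>k. k)),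
      RUnit = (\<lambda>n. fmap n n (\<lambda>k. k)),
      Braid = (\<lambda>m n. fmap (m * n) (n * m) (\<lambda>k. lexpos m (lexr n k) (lexl n k)))\<rparr>"


section \<open>\<open>F\<close>-\<open>G\<close>-spaces and Day convolution\<close>

type_synonym ('g, 'u) fspace = "(nat, fmap, ('g, 'u) bspace, ('g, 'u) bmap) fdata"
type_synonym ('g, 'u) ftrans = "(('g, 'u) fspace, nat \<Rightarrow> ('g, 'u) bmap) arrow"

definition fg_space ::
  "(('g, 'u) bspace, ('g, 'u) bmap) moncat \<Rightarrow> ('g, 'u) fspace \<Rightarrow> bool" where
  "fg_space V X \<longleftrightarrow> is_functor Fcat V X \<and> pts (fo X 0) = {pt (fo X 0)}"

definition fg_maps ::
  "('g, 'r) monoid_scheme \<Rightarrow> ('g, 'u) fspace \<Rightarrow> ('g, 'u) fspace \<Rightarrow> ('g, 'u) ftrans set" where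
  "fg_maps G X Y =
     {\<theta>. src \<theta> = X \<and> tgt \<theta> = Y \<and> fg_space (GTop G) X \<and> fg_space (GTop G) Y \<and>
         (\<forall>n. mor \<theta> n \<in> Hom (GTop G) (fo X n) (fo Y n)) \<and>
         (\<forall>m n. \<forall>f\<in>Hom Fcat m n.
            mor \<theta> n \<cdot>\<^bsub>GTop G\<^esub> fa X f = fa Y f \<cdot>\<^bsub>GTop G\<^esub> mor \<theta> m)}"

text \<open>
  Natural transformations from \<open>(m, n) \<mapsto> X(m) \<and> Y(n)\<close> to \<open>(m, n) \<mapsto> Z(m \<and> n)\<close>.
\<close>

definition pairing ::
  "('g, 'r) monoid_scheme \<Rightarrow> ('g, 'u) fspace \<Rightarrow> ('g, 'u) fspace \<Rightarrow> ('g, 'u) fspace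
     \<Rightarrow> (nat \<Rightarrow> nat \<Rightarrow> ('g, 'u) bmap) \<Rightarrow> bool" where
  "pairing G X Y Z \<beta> \<longleftrightarrow>
     (\<forall>m n. \<beta> m n \<in> Hom (GTop G) (Ten (GTop G) (fo X m) (fo Y n)) (fo Z (Ten Fcat m n))) \<and>
     (\<forall>m m' n n'. \<forall>f\<in>Hom Fcat m m'. \<forall>g\<in>Hom Fcat n n'.
        \<beta> m' n' \<cdot>\<^bsub>GTop G\<^esub> TenA (GTop G) (fa X f) (fa Y g) =
        fa Z (TenA Fcat f g) \<cdot>\<^bsub>GTop G\<^esub> \<beta> m n)"

text \<open>
  \<open>(W, \<eta>)\<close> is a left Kan extension of \<open>(m, n) \<mapsto> X(m) \<and> Y(n)\<close> along the smash product of \<open>F\<close>.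
  As the based hom spaces of \<open>F\<close> are discrete with base point the zero map, a functor on \<open>F\<close> is
  enriched over based spaces iff it preserves zero maps, which is what \<open>X(0) = *\<close> amounts to, and
  every natural transformation between such functors is enriched; so this is the universal property in
  the enriched setting.  The Kan extension is formed in \<open>GTop\<close>, because colimits need not preserve
  nondegeneracy of base points.
\<close>

definition left_Kan ::
  "('g, 'r) monoid_scheme \<Rightarrow> ('g, 'u) fspace \<Rightarrow> ('g, 'u) fspace \<Rightarrow> ('g, 'u) fspace
     \<Rightarrow> (nat \<Rightarrow> nat \<Rightarrow> ('g, 'u) bmap) \<Rightarrow> bool" where
  "left_Kan G X Y W \<eta> \<longleftrightarrow>
     fg_space (GTop G) W \<and> pairing G X Y W \<eta> \<and>
     (\<forall>Z \<beta>. fg_space (GTop G) Z \<and> pairing G X Y Z \<beta> \<longrightarrow>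
        (\<exists>!\<theta>. \<theta> \<in> fg_maps G W Z \<and>
              (\<forall>m n. mor \<theta> (Ten Fcat m n) \<cdot>\<^bsub>GTop G\<^esub> \<eta> m n = \<beta> m n)))"

definition day_pair ::
  "('g, 'r) monoid_scheme \<Rightarrow> ('g, 'u) fspace \<Rightarrow> ('g, 'u) fspace
     \<Rightarrow> ('g, 'u) fspace \<times> (nat \<Rightarrow> nat \<Rightarrow> ('g, 'u) bmap)" where
  "day_pair G X Y = (SOME p. left_Kan G X Y (fst p) (snd p))"

definition day ::
  "('g, 'r) monoid_scheme \<Rightarrow> ('g, 'u) fspace \<Rightarrow> ('g, 'u) fspace \<Rightarrow> ('g, 'u) fspace" where
  "day G X Y = fst (day_pair G X Y)"

definition dayin ::
  "('g, 'r) monoid_scheme \<Rightarrow> ('g, 'u) fspace \<Rightarrow> ('g, 'u) fspace \<Rightarrow> nat \<Rightarrow> nat \<Rightarrow> ('g, 'u) bmap" where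
  "dayin G X Y = snd (day_pair G X Y)"

definition IF :: "('g, 'u) fspace" where
  "IF = \<lparr>fo = dspace,
         fa = (\<lambda>f. bmap (dspace (src f)) (dspace (tgt f)) (\<lambda>z. unat (mor f (inv_into UNIV unat z))))\<rparr>"

text \<open>
  The tensor product of maps and the constraints of the Day convolution are the maps determined
  by the universal property and the corresponding maps of \<open>GTop\<close> and of \<open>F\<close>.  The unit
  constraints are determined by their components at the unit \<open>1\<close> of \<open>F\<close>, by the Yoneda lemma for
  \<open>IF = F(1, -)\<close>; there \<open>IF(1) = S\<^sup>0\<close> is the unit of \<open>GTop\<close>.
\<close>

definition day_map :: "('g, 'r) monoid_scheme \<Rightarrow> ('g, 'u) ftrans \<Rightarrow> ('g, 'u) ftrans \<Rightarrow> ('g, 'u) ftrans" where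
  "day_map G \<theta> \<psi> =
     (THE \<tau>. \<tau> \<in> fg_maps G (day G (src \<theta>) (src \<psi>)) (day G (tgt \<theta>) (tgt \<psi>)) \<and>
       (\<forall>m n. mor \<tau> (Ten Fcat m n) \<cdot>\<^bsub>GTop G\<^esub> dayin G (src \<theta>) (src \<psi>) m n =
              dayin G (tgt \<theta>) (tgt \<psi>) m n \<cdot>\<^bsub>GTop G\<^esub> TenA (GTop G) (mor \<theta> m) (mor \<psi> n)))"

definition day_assoc ::
  "('g, 'r) monoid_scheme \<Rightarrow> ('g, 'u) fspace \<Rightarrow> ('g, 'u) fspace \<Rightarrow> ('g, 'u) fspace \<Rightarrow> ('g, 'u) ftrans" where
  "day_assoc G X Y Z =
     (THE \<tau>. \<tau> \<in> fg_maps G (day G (day G X Y) Z) (day G X (day G Y Z)) \<and>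
       (\<forall>m n p. fa (day G X (day G Y Z)) (Assoc Fcat m n p)
                  \<cdot>\<^bsub>GTop G\<^esub> mor \<tau> (Ten Fcat (Ten Fcat m n) p)
                  \<cdot>\<^bsub>GTop G\<^esub> dayin G (day G X Y) Z (Ten Fcat m n) p
                  \<cdot>\<^bsub>GTop G\<^esub> TenA (GTop G) (dayin G X Y m n) (Ident (GTop G) (fo Z p)) =
                dayin G X (day G Y Z) m (Ten Fcat n p)
                  \<cdot>\<^bsub>GTop G\<^esub> TenA (GTop G) (Ident (GTop G) (fo X m)) (dayin G Y Z n p)
                  \<cdot>\<^bsub>GTop G\<^esub> Assoc (GTop G) (fo X m) (fo Y n) (fo Z p)))"

definition day_lunit :: "('g, 'r) monoid_scheme \<Rightarrow> ('g, 'u) fspace \<Rightarrow> ('g, 'u) ftrans" where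
  "day_lunit G X =
     (THE \<tau>. \<tau> \<in> fg_maps G (day G IF X) X \<and>
       (\<forall>n. fa X (LUnit Fcat n) \<cdot>\<^bsub>GTop G\<^esub> mor \<tau> (Ten Fcat (Unit Fcat) n)
              \<cdot>\<^bsub>GTop G\<^esub> dayin G IF X (Unit Fcat) n = LUnit (GTop G) (fo X n)))"

definition day_runit :: "('g, 'r) monoid_scheme \<Rightarrow> ('g, 'u) fspace \<Rightarrow> ('g, 'u) ftrans" where
  "day_runit G X =
     (THE \<tau>. \<tau> \<in> fg_maps G (day G X IF) X \<and>
       (\<forall>n. fa X (RUnit Fcat n) \<cdot>\<^bsub>GTop G\<^esub> mor \<tau> (Ten Fcat n (Unit Fcat))
              \<cdot>\<^bsub>GTop G\<^esub> dayin G X IF n (Unit Fcat) = RUnit (GTop G) (fo X n)))"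

definition day_braid ::
  "('g, 'r) monoid_scheme \<Rightarrow> ('g, 'u) fspace \<Rightarrow> ('g, 'u) fspace \<Rightarrow> ('g, 'u) ftrans" where
  "day_braid G X Y =
     (THE \<tau>. \<tau> \<in> fg_maps G (day G X Y) (day G Y X) \<and>
       (\<forall>m n. fa (day G Y X) (Braid Fcat m n)
                \<cdot>\<^bsub>GTop G\<^esub> mor \<tau> (Ten Fcat m n) \<cdot>\<^bsub>GTop G\<^esub> dayin G X Y m n =
              dayin G Y X n m \<cdot>\<^bsub>GTop G\<^esub> Braid (GTop G) (fo X m) (fo Y n)))"

definition FGTop :: "('g, 'r) monoid_scheme \<Rightarrow> (('g, 'u) fspace, ('g, 'u) ftrans) moncat" where
  "FGTop G =
     \<lparr>Obj = {X. fg_space (GTop G) X},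
      Hom = fg_maps G,
      Ident = (\<lambda>X. \<lparr>src = X, tgt = X, mor = (\<lambda>n. Ident (GTop G) (fo X n))\<rparr>),
      Comp = (\<lambda>\<psi> \<theta>. \<lparr>src = src \<theta>, tgt = tgt \<psi>, mor = (\<lambda>n. mor \<psi> n \<cdot>\<^bsub>GTop G\<^esub> mor \<theta> n)\<rparr>),
      Ten = day G,
      TenA = day_map G,
      Unit = IF,
      Assoc = day_assoc G,
      LUnit = day_lunit G,
      RUnit = day_runit G,
      Braid = day_braid G\<rparr>"

text \<open>\<open>F\<close>-\<open>G\<close>-spaces proper are levelwise nondegenerately based.\<close>

definition FG :: "('g, 'r) monoid_scheme \<Rightarrow> (('g, 'u) fspace, ('g, 'u) ftrans) moncat" where
  "FG G = (FGTop G)\<lparr>Obj := {X. fg_space (GT G) X}\<rparr>"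

definition F1_space :: "('g, 'r) monoid_scheme \<Rightarrow> ('g, 'u) bspace \<Rightarrow> ('g, 'u) fspace" where
  "F1_space G X =
     \<lparr>fo = (\<lambda>n. smash (fo IF n) X),
      fa = (\<lambda>f. smash_map (fa IF f) (Ident (GTop G) X))\<rparr>"

definition F1 ::
  "('g, 'r) monoid_scheme
     \<Rightarrow> (('g, 'u) bspace, ('g, 'u) bmap, ('g, 'u) fspace, ('g, 'u) ftrans) fdata" where
  "F1 G =
     \<lparr>fo = F1_space G,
      fa = (\<lambda>h. \<lparr>src = F1_space G (src h), tgt = F1_space G (tgt h),
                 mor = (\<lambda>n. smash_map (Ident (GTop G) (fo IF n)) h)\<rparr>)\<rparr>"

end

theory Submission
  imports Defs
begin

text \<open>
  Call an \<open>F\<close>-\<open>G\<close>-space \<open>W\<close> free on a based \<open>G\<close>-space \<open>A\<close> if maps \<open>W \<rightarrow> Z\<close> correspond to based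
  \<open>G\<close>-maps \<open>A \<rightarrow> Z(1)\<close>. By the Yoneda lemma \<open>F1(A)\<close> is free on \<open>A\<close>, and the unit is free on \<open>S\<^sup>0\<close>.
  Pairings of two free objects are determined by their component at \<open>(1, 1)\<close>, so the Day
  convolution of objects free on \<open>A\<close> and \<open>B\<close> exists and is free on \<open>A \<and> B\<close>. Hence it is isomorphic
  to \<open>F1(A \<and> B)\<close>, and every coherence diagram has to be compared only at \<open>1\<close> and on generators,
  where it is an identity between explicit maps of smash products.

  The point-set input is that smash products stay weak Hausdorff and that
  \<open>(X \<and> Y) \<and> Z \<rightarrow> X \<and> (Y \<and> Z)\<close> is continuous.
\<close>

section \<open>Topologies tested by compact Hausdorff spaces\<close>

text \<open>The Day convolution is a \<open>SOME\<close> and its structure maps are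
  \<open>THE\<close> terms, so nothing can be computed about them before the relevant universal
  property is established. It is established for pairs of free objects; every object in the
  coherence diagrams is F1 of a space, the unit, or an iterated convolution of these. The chosen
  convolution is known only up to isomorphism, so freeness is recorded together with a generating
  map, which can be carried across isomorphisms and through further convolutions.

  On the topological side, products carry a k-ified topology, and distinct points of a weak
  Hausdorff space need not have disjoint neighbourhoods. Continuity is therefore checked along maps
  from compact Hausdorff spaces, and separation is replaced by closedness of the images of such
  maps. Test spaces live on one type of sets of sets of points, which is why injections between such
  types occur as hypotheses.

  Nondegeneracy matters for F1 to take objects of \<open>GT\<close> to objects of \<open>FG\<close>:
  homotopies on the copies of X are glued at the common base point.\<close>

lemma infinite_bij_pair:
  assumes "infinite (UNIV :: 'a set)"
  shows "\<exists>f :: 'a \<times> 'a \<Rightarrow> 'a. bij f"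
  using card_of_Times_same_infinite[OF assms] by (auto simp: card_of_ordIso[symmetric])

lemma inj_image_image: "inj f \<Longrightarrow> inj (image (image f))"
  by (simp add: inj_image_eq_iff inj_def)

text \<open>Makes a test space of a product usable as a test space of each factor.\<close>

lemma inj_pair_sets:
  assumes "infinite (UNIV :: 'u set)"
  shows "\<exists>j :: ('u \<times> 'u) set set \<Rightarrow> 'u set set. inj j"
  using infinite_bij_pair[OF assms] inj_image_image bij_is_inj by blast

text \<open>The diagonal embeds points into pairs; this moves a test space of a single space to the
  type that tests products.\<close>

lemma inj_diagonal_sets: "\<exists>j :: 'u set set \<Rightarrow> ('u \<times> 'u) set set. inj j"
  using inj_image_image[of "\<lambda>x :: 'u. (x, x)"] by (meson Pair_inject injI)

text \<open>The tube argument for associativity tests a space with the product of two test spaces,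
  so that product has to fit into the same type again.\<close>

lemma inj_product_sets:
  assumes "infinite (UNIV :: 'a set)"
  shows "\<exists>j :: 'a set set \<times> 'a set set \<Rightarrow> 'a set set. inj j"
proof -
  have "infinite (UNIV :: 'a set set)"
    using assms by (simp add: Finite_Set.finite_set)
  then have "infinite (UNIV :: 'a set set set)"
    by (simp add: Finite_Set.finite_set)
  then show ?thesis
    using infinite_bij_pair[where 'a = "'a set set"] bij_is_inj by (metis Finite_Set.finite_set)
qed

lemma inj_id_sets: "\<exists>j :: 'a set set \<Rightarrow> 'a set set. inj j"
  by (rule exI[of _ id]) simp

section \<open>Quotient topologies\<close>

lemma istopology_quot:
  "istopology (\<lambda>U. U \<subseteq> q ` topspace X \<and> openin X {x \<in> topspace X. q x \<in> U})"
  unfolding istopology_def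
proof (rule conjI; intro allI impI)
  fix S T
  assume "S \<subseteq> q ` topspace X \<and> openin X {x \<in> topspace X. q x \<in> S}"
    and "T \<subseteq> q ` topspace X \<and> openin X {x \<in> topspace X. q x \<in> T}"
  moreover have "{x \<in> topspace X. q x \<in> S \<inter> T}
      = {x \<in> topspace X. q x \<in> S} \<inter> {x \<in> topspace X. q x \<in> T}" by auto
  ultimately show "S \<inter> T \<subseteq> q ` topspace X \<and> openin X {x \<in> topspace X. q x \<in> S \<inter> T}"
    by (auto intro: openin_Int)
next
  fix \<K>
  assume *: "\<forall>K\<in>\<K>. K \<subseteq> q ` topspace X \<and> openin X {x \<in> topspace X. q x \<in> K}"
  have "{x \<in> topspace X. q x \<in> \<Union>\<K>} = \<Union>((\<lambda>K. {x \<in> topspace X. q x \<in> K}) ` \<K>)" by auto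
  then show "\<Union>\<K> \<subseteq> q ` topspace X \<and> openin X {x \<in> topspace X. q x \<in> \<Union>\<K>}"
    using * by (auto intro!: openin_Union)
qed

lemma openin_quot:
  "openin (quot_topology X q) U \<longleftrightarrow> U \<subseteq> q ` topspace X \<and> openin X {x \<in> topspace X. q x \<in> U}"
  unfolding quot_topology_def by (simp only: topology_inverse'[OF istopology_quot])

lemma topspace_quot [simp]: "topspace (quot_topology X q) = q ` topspace X"
proof -
  have "{x \<in> topspace X. q x \<in> q ` topspace X} = topspace X" by auto
  then have "openin (quot_topology X q) (q ` topspace X)"
    unfolding openin_quot by simp
  then show ?thesis
    unfolding topspace_def[of "quot_topology X q"] openin_quot by blast
qed

lemma quotient_map_quot: "quotient_map X (quot_topology X q) q"
  by (auto simp: quotient_map_def openin_quot)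

text \<open>The quotient topology along an injection is a homeomorphic copy. This moves a compact
  Hausdorff space of any small enough type onto the one type over which \<open>test_map\<close>
  ranges.\<close>

lemma test_map_copy:
  fixes j :: "'k \<Rightarrow> 'a set set"
  assumes "compact_space K" "Hausdorff_space K" "continuous_map K X u" "inj j"
  shows "test_map X (quot_topology K j) (u \<circ> inv_into UNIV j)"
proof -
  have h: "homeomorphic_map K (quot_topology K j) j"
    using quotient_map_quot assms(4) by (auto simp: homeomorphic_map_def intro: inj_on_subset)
  then have hs: "K homeomorphic_space quot_topology K j"
    using homeomorphic_map_imp_homeomorphic_space by blast
  have "(u \<circ> inv_into UNIV j) \<circ> j = u"
    using assms(4) by (auto simp: fun_eq_iff)
  then have "continuous_map (quot_topology K j) X (u \<circ> inv_into UNIV j)"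
    using continuous_compose_quotient_map[OF quotient_map_quot] assms(3) by metis
  then show ?thesis
    using assms hs homeomorphic_compact_space homeomorphic_Hausdorff_space
    unfolding test_map_def by blast
qed

text \<open>Frees the definition from its fixed type of test spaces;
  \<open>compactly_closedD\<close> does the same for compactly closed sets.\<close>

lemma weak_HausdorffD:
  fixes X :: "'a topology" and K :: "'k topology"
  assumes "weak_Hausdorff X" "compact_space K" "Hausdorff_space K" "continuous_map K X u"
    and "\<exists>j :: 'k \<Rightarrow> 'a set set. inj j"
  shows "closedin X (u ` topspace K)"
proof -
  obtain j :: "'k \<Rightarrow> 'a set set" where j: "inj j" using assms(5) by blast
  have "closedin X ((u \<circ> inv_into UNIV j) ` topspace (quot_topology K j))"
    using assms(1) test_map_copy[OF assms(2-4) j] unfolding weak_Hausdorff_def by blast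
  then show ?thesis
    using j by (simp add: image_comp comp_def)
qed

lemma compactly_closedD:
  fixes X :: "'a topology" and K :: "'k topology"
  assumes "compactly_closed X C" "compact_space K" "Hausdorff_space K" "continuous_map K X u"
    and "\<exists>j :: 'k \<Rightarrow> 'a set set. inj j"
  shows "closedin K {k \<in> topspace K. u k \<in> C}"
proof -
  obtain j :: "'k \<Rightarrow> 'a set set" where j: "inj j" using assms(5) by blast
  have "closedin (quot_topology K j) {k \<in> topspace (quot_topology K j). (u \<circ> inv_into UNIV j) k \<in> C}"
    using assms(1) test_map_copy[OF assms(2-4) j] unfolding compactly_closed_def by blast
  then have "closedin K {k \<in> topspace K. j k \<in> {k \<in> topspace (quot_topology K j). (u \<circ> inv_into UNIV j) k \<in> C}}"
    using quotient_imp_continuous_map[OF quotient_map_quot] closedin_continuous_map_preimage by blast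
  moreover have "{k \<in> topspace K. j k \<in> {k \<in> topspace (quot_topology K j). (u \<circ> inv_into UNIV j) k \<in> C}}
      = {k \<in> topspace K. u k \<in> C}"
    using j by auto
  ultimately show ?thesis by simp
qed

section \<open>k-ification and compactly generated spaces\<close>

lemma closedin_imp_compactly_closed: "closedin X C \<Longrightarrow> compactly_closed X C"
  unfolding compactly_closed_def test_map_def
  by (auto dest: closedin_subset closedin_continuous_map_preimage)

lemma istopology_kify:
  "istopology (\<lambda>U. U \<subseteq> topspace X \<and> compactly_closed X (topspace X - U))"
  unfolding istopology_def
proof (rule conjI; intro allI impI)
  fix S T
  assume S: "S \<subseteq> topspace X \<and> compactly_closed X (topspace X - S)"
    and T: "T \<subseteq> topspace X \<and> compactly_closed X (topspace X - T)"
  have "closedin K {k \<in> topspace K. u k \<in> topspace X - S \<inter> T}" if "test_map X K u" for K u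
  proof -
    have "{k \<in> topspace K. u k \<in> topspace X - S \<inter> T}
      = {k \<in> topspace K. u k \<in> topspace X - S} \<union> {k \<in> topspace K. u k \<in> topspace X - T}" by auto
    then show ?thesis using S T that by (auto simp: compactly_closed_def)
  qed
  then show "S \<inter> T \<subseteq> topspace X \<and> compactly_closed X (topspace X - S \<inter> T)"
    using S by (auto simp: compactly_closed_def)
next
  fix \<K>
  assume *: "\<forall>K\<in>\<K>. K \<subseteq> topspace X \<and> compactly_closed X (topspace X - K)"
  have "closedin K {k \<in> topspace K. u k \<in> topspace X - \<Union>\<K>}" if t: "test_map X K u" for K u
  \<comment> \<open>The empty family is separate because its intersection would be the universe, not
    the space.\<close>
  proof (cases "\<K> = {}")
    case True
    then have "{k \<in> topspace K. u k \<in> topspace X - \<Union>\<K>} = topspace K"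
      using t by (auto simp: test_map_def continuous_map_def)
    then show ?thesis by simp
  next
    case False
    then have "{k \<in> topspace K. u k \<in> topspace X - \<Union>\<K>}
        = \<Inter>((\<lambda>U. {k \<in> topspace K. u k \<in> topspace X - U}) ` \<K>)" by auto
    then show ?thesis using * t False by (auto simp: compactly_closed_def intro!: closedin_Inter)
  qed
  then show "\<Union>\<K> \<subseteq> topspace X \<and> compactly_closed X (topspace X - \<Union>\<K>)"
    using * by (auto simp: compactly_closed_def)
qed

lemma openin_kify:
  "openin (kify X) U \<longleftrightarrow> U \<subseteq> topspace X \<and> compactly_closed X (topspace X - U)"
  unfolding kify_def by (simp only: topology_inverse'[OF istopology_kify])

lemma topspace_kify [simp]: "topspace (kify X) = topspace X"
proof -
  have "openin (kify X) (topspace X)"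
    by (auto simp: openin_kify compactly_closed_def)
  then show ?thesis
    by (metis openin_kify openin_subset openin_topspace subset_antisym)
qed

lemma closedin_kify: "closedin (kify X) C \<longleftrightarrow> compactly_closed X C"
proof -
  have "C \<subseteq> topspace X \<Longrightarrow> topspace X - (topspace X - C) = C" by auto
  then show ?thesis
    by (auto simp: closedin_def openin_kify) (auto simp: compactly_closed_def)
qed

lemma continuous_map_kify_id: "continuous_map (kify X) X (\<lambda>x. x)"
  using closedin_imp_compactly_closed closedin_subset
  by (fastforce simp: continuous_map_closedin closedin_kify Collect_conj_eq Int_absorb1)

text \<open>The sets that become closed under k-ification are exactly those whose preimages under
  test maps are already closed, so compact Hausdorff spaces do not notice the change of
  topology.\<close>

lemma continuous_map_into_kify:
  fixes X :: "'a topology" and K :: "'k topology"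
  assumes "compact_space K" "Hausdorff_space K" "\<exists>j :: 'k \<Rightarrow> 'a set set. inj j"
  shows "continuous_map K (kify X) u \<longleftrightarrow> continuous_map K X u"
proof
  assume "continuous_map K (kify X) u"
  then show "continuous_map K X u"
    using continuous_map_compose[OF _ continuous_map_kify_id] by (fastforce simp: comp_def)
next
  assume u: "continuous_map K X u"
  then show "continuous_map K (kify X) u"
    using compactly_closedD[OF _ assms(1,2) u assms(3)]
    by (auto simp: continuous_map_closedin closedin_kify)
qed

lemma test_map_kify: "test_map (kify X) K u \<longleftrightarrow> test_map X K u"
  using continuous_map_into_kify[OF _ _ inj_id_sets] by (auto simp: test_map_def)

text \<open>The other half of the universal property. Most continuity proofs below go through it: a
  map is followed along an arbitrary test map, where ordinary products and finite closed covers can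
  be used.\<close>

lemma continuous_map_from_kify:
  assumes "\<And>K u. test_map X K u \<Longrightarrow> continuous_map K Z (\<lambda>k. f (u k))"
    and "f \<in> topspace X \<rightarrow> topspace Z"
  shows "continuous_map (kify X) Z f"
  unfolding continuous_map_closedin
proof (intro conjI allI impI)
  show "f \<in> topspace (kify X) \<rightarrow> topspace Z" using assms(2) by simp
  fix C assume C: "closedin Z C"
  have "closedin K {k \<in> topspace K. u k \<in> {x \<in> topspace X. f x \<in> C}}" if "test_map X K u" for K u
  proof -
    have "{k \<in> topspace K. u k \<in> {x \<in> topspace X. f x \<in> C}} = {k \<in> topspace K. f (u k) \<in> C}"
      using that by (auto simp: test_map_def continuous_map_def)
    then show ?thesis
      using closedin_continuous_map_preimage[OF assms(1)[OF that] C] by simp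
  qed
  then show "closedin (kify X) {x \<in> topspace (kify X). f x \<in> C}"
    by (auto simp: closedin_kify compactly_closed_def)
qed

lemma CGWH_kify_eq: "CGWH X \<Longrightarrow> kify X = X"
  unfolding topology_eq openin_closedin_eq
  by (auto simp: closedin_kify CGWH_def closedin_imp_compactly_closed)

lemma continuous_map_from_CGWH:
  assumes "CGWH X" "\<And>K u. test_map X K u \<Longrightarrow> continuous_map K Z (\<lambda>k. f (u k))"
    and "f \<in> topspace X \<rightarrow> topspace Z"
  shows "continuous_map X Z f"
  using continuous_map_from_kify[OF assms(2,3)] CGWH_kify_eq[OF assms(1)] by simp

lemma closedin_points_weak_Hausdorff:
  fixes X :: "'a topology"
  assumes "weak_Hausdorff X" "x \<in> topspace X"
  shows "closedin X {x}"
proof -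
  \<comment> \<open>A one-point space; \<open>{}\<close> is just a convenient element of the type of
    test spaces.\<close>
  let ?K = "discrete_topology {{}} :: 'a set set topology"
  have "test_map X ?K (\<lambda>_. x)"
    using assms(2) by (auto simp: test_map_def compact_space_discrete_topology)
  then show ?thesis
    using assms(1) unfolding weak_Hausdorff_def by fastforce
qed

text \<open>Normality of \<open>K\<close> makes up for the missing Hausdorff property of \<open>X\<close>: disjoint
  neighbourhoods of two fibres of \<open>u\<close> have complements with closed images.\<close>

lemma closedin_fibre_product:
  fixes X :: "'a topology" and K :: "'k topology" and L :: "'l topology"
  assumes X: "weak_Hausdorff X"
    and K: "compact_space K" "Hausdorff_space K" and u: "continuous_map K X u"
    and v: "continuous_map L X v"
    and j: "\<exists>j :: 'k \<Rightarrow> 'a set set. inj j"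
  shows "closedin (prod_topology K L) {p \<in> topspace K \<times> topspace L. u (fst p) = v (snd p)}"
    (is "closedin _ ?E")
proof -
  \<comment> \<open>\<open>u\<close> is a closed map, since a closed subset of \<open>K\<close> is
    itself a compact Hausdorff test space.\<close>
  have cl: "closedin X (u ` C)" if "closedin K C" for C
  proof -
    have "closedin X (u ` topspace (subtopology K C))"
      using that K u j
      by (intro weak_HausdorffD[OF X])
         (auto simp: compact_space_subtopology closedin_compact_space Hausdorff_space_subtopology
           continuous_map_from_subtopology)
    then show ?thesis using closedin_subset[OF that] by (simp add: Int_absorb1)
  qed
  have "openin (prod_topology K L) (topspace (prod_topology K L) - ?E)"
  proof (subst openin_subopen, rule ballI)
    fix p assume p: "p \<in> topspace (prod_topology K L) - ?E"
    obtain k l where kl: "p = (k, l)" by (cases p)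
    then have ne: "u k \<noteq> v l" and k: "k \<in> topspace K" and l: "l \<in> topspace L"
      using p by auto
    have uk: "u k \<in> topspace X" and vl: "v l \<in> topspace X"
      using k l u v by (auto simp: continuous_map_def)
    have "normal_space K"
      using K compact_Hausdorff_or_regular_imp_normal_space by blast
    moreover have "closedin K {x \<in> topspace K. u x \<in> {u k}}" "closedin K {x \<in> topspace K. u x \<in> {v l}}"
      using closedin_continuous_map_preimage[OF u] closedin_points_weak_Hausdorff[OF X] uk vl by blast+
    moreover have "disjnt {x \<in> topspace K. u x \<in> {u k}} {x \<in> topspace K. u x \<in> {v l}}"
      using ne by (auto simp: disjnt_iff)
    ultimately have "\<exists>U V. openin K U \<and> openin K V \<and> {x \<in> topspace K. u x \<in> {u k}} \<subseteq> U \<and>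
        {x \<in> topspace K. u x \<in> {v l}} \<subseteq> V \<and> disjnt U V"
      unfolding normal_space_def by presburger
    then obtain U V where UV: "openin K U" "openin K V" "disjnt U V"
      "{x \<in> topspace K. u x \<in> {u k}} \<subseteq> U" "{x \<in> topspace K. u x \<in> {v l}} \<subseteq> V"
      by blast
    \<comment> \<open>\<open>A\<close> consists of the points whose whole fibre lies in
      \<open>U\<close>; \<open>B\<close> consists of the points of \<open>L\<close> whose value is
      attained on \<open>K\<close> only inside \<open>V\<close>, if at all. A common value of
      \<open>x\<close> in \<open>A\<close> and \<open>y\<close> in \<open>B\<close> would put
      \<open>x\<close> into both \<open>U\<close> and \<open>V\<close>.\<close>
    define A where "A = {x \<in> topspace K. u x \<in> topspace X - u ` (topspace K - U)}"
    define B where "B = {x \<in> topspace L. v x \<in> topspace X - u ` (topspace K - V)}"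
    have AB: "openin K A \<and> openin L B"
      unfolding A_def B_def
      by (intro conjI; rule openin_continuous_map_preimage[OF u] openin_continuous_map_preimage[OF v],
          rule openin_diff[OF openin_topspace], rule cl,
          rule closedin_diff[OF closedin_topspace], rule UV)+
    have kl': "k \<in> A \<and> l \<in> B"
      unfolding A_def B_def using UV k l uk vl by auto
    have "u x \<noteq> v y" if "x \<in> A" "y \<in> B" for x y
    proof
      assume "u x = v y"
      then have "x \<in> topspace K" "u x \<notin> u ` (topspace K - U)" "u x \<notin> u ` (topspace K - V)"
        using that unfolding A_def B_def by auto
      then show False using UV(3) unfolding disjnt_iff by blast
    qed
    then have sub: "A \<times> B \<subseteq> topspace (prod_topology K L) - ?E"
      unfolding A_def B_def by auto
    have "openin (prod_topology K L) (A \<times> B) \<and> (k, l) \<in> A \<times> B"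
      using AB kl' by (simp add: openin_prod_Times_iff)
    with sub show "\<exists>T. openin (prod_topology K L) T \<and> p \<in> T \<and> T \<subseteq> topspace (prod_topology K L) - ?E"
      unfolding kl by (intro exI[of _ "A \<times> B"] conjI) simp_all
  qed
  moreover have "?E \<subseteq> topspace (prod_topology K L)" by auto
  ultimately show ?thesis
    unfolding closedin_def by blast
qed

section \<open>Products of compactly generated spaces\<close>

lemma topspace_kprod [simp]: "topspace (kprod X Y) = topspace X \<times> topspace Y"
  by (simp add: kprod_def)

lemma continuous_map_into_kprod:
  fixes X :: "'a topology" and Y :: "'b topology" and K :: "'k topology"
  assumes "compact_space K" "Hausdorff_space K" "\<exists>j :: 'k \<Rightarrow> ('a \<times> 'b) set set. inj j"
  shows "continuous_map K (kprod X Y) u \<longleftrightarrow>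
    continuous_map K X (\<lambda>k. fst (u k)) \<and> continuous_map K Y (\<lambda>k. snd (u k))"
  using continuous_map_into_kify[OF assms] by (simp add: kprod_def continuous_map_pairwise comp_def)

lemma continuous_map_from_kprod:
  fixes X :: "'a topology" and Y :: "'b topology" and Z :: "'c topology"
  assumes "\<And>(K :: ('a \<times> 'b) set set topology) a b. compact_space K \<Longrightarrow> Hausdorff_space K \<Longrightarrow>
      continuous_map K X a \<Longrightarrow> continuous_map K Y b \<Longrightarrow> continuous_map K Z (\<lambda>k. f (a k, b k))"
    and "\<And>x y. x \<in> topspace X \<Longrightarrow> y \<in> topspace Y \<Longrightarrow> f (x, y) \<in> topspace Z"
  shows "continuous_map (kprod X Y) Z f"
  unfolding kprod_def
proof (rule continuous_map_from_kify)
  fix K :: "('a \<times> 'b) set set topology" and u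
  assume "test_map (prod_topology X Y) K u"
  then show "continuous_map K Z (\<lambda>k. f (u k))"
    using assms(1)[of K "\<lambda>k. fst (u k)" "\<lambda>k. snd (u k)"]
    by (simp add: test_map_def continuous_map_pairwise comp_def)
qed (use assms(2) in auto)

text \<open>The preimage of the image of a test map \<open>u\<close> under another test map
  \<open>v\<close> is the projection of the fibre product of \<open>u\<close> and \<open>v\<close>.
  This fibre product is the intersection of those of the two coordinates, hence closed, and
  projection along the compact space \<open>K\<close> is a closed map.\<close>

lemma CGWH_kprod:
  fixes X :: "'u topology" and Y :: "'u topology"
  assumes inf: "infinite (UNIV :: 'u set)" and X: "CGWH X" and Y: "CGWH Y"
  shows "CGWH (kprod X Y)"
proof -
  have wX: "weak_Hausdorff X" and wY: "weak_Hausdorff Y" using X Y by (auto simp: CGWH_def)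
  have "closedin (kprod X Y) (u ` topspace K)" if t: "test_map (kprod X Y) K u" for K u
  proof -
    have K: "compact_space K" "Hausdorff_space K"
      and u: "continuous_map K X (\<lambda>k. fst (u k))" "continuous_map K Y (\<lambda>k. snd (u k))"
      using t continuous_map_into_kprod[OF _ _ inj_id_sets] by (auto simp: test_map_def)
    have "closedin L {l \<in> topspace L. v l \<in> u ` topspace K}"
      if t': "test_map (prod_topology X Y) L v" for L v
    proof -
      have L: "compact_space L" "Hausdorff_space L"
        and v: "continuous_map L X (\<lambda>k. fst (v k))" "continuous_map L Y (\<lambda>k. snd (v k))"
        using t' by (auto simp: test_map_def continuous_map_pairwise comp_def)
      let ?E = "{p \<in> topspace K \<times> topspace L. fst (u (fst p)) = fst (v (snd p))} \<inter>
          {p \<in> topspace K \<times> topspace L. snd (u (fst p)) = snd (v (snd p))}"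
      have "closedin (prod_topology K L) ?E"
        using closedin_fibre_product[OF wX K u(1) v(1) inj_pair_sets[OF inf]]
          closedin_fibre_product[OF wY K u(2) v(2) inj_pair_sets[OF inf]] by blast
      then have "closedin L (snd ` ?E)"
        using closed_map_snd[OF K(1)] unfolding closed_map_def by blast
      moreover have "snd ` ?E = {l \<in> topspace L. v l \<in> u ` topspace K}"
      proof (rule subset_antisym; rule subsetI)
        fix l assume "l \<in> {l \<in> topspace L. v l \<in> u ` topspace K}"
        then obtain k where "l \<in> topspace L" "k \<in> topspace K" "v l = u k" by auto
        then show "l \<in> snd ` ?E" by (intro image_eqI[of _ _ "(k, l)"]) auto
      next
        fix l assume "l \<in> snd ` ?E"
        then obtain k where "k \<in> topspace K" "l \<in> topspace L" "u k = v l"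
          by (auto simp: prod_eq_iff)
        then show "l \<in> {l \<in> topspace L. v l \<in> u ` topspace K}"
          by (metis (mono_tags, lifting) image_eqI mem_Collect_eq)
      qed
      ultimately show ?thesis by simp
    qed
    moreover have "u ` topspace K \<subseteq> topspace X \<times> topspace Y"
      using t continuous_map_image_subset_topspace[of K "kprod X Y" u] by (simp add: test_map_def)
    ultimately show ?thesis
      unfolding kprod_def closedin_kify by (auto simp: compactly_closed_def)
  qed
  \<comment> \<open>Only compact generation is left: the product and its k-ification have the same
    test maps, hence the same compactly closed sets.\<close>
  then show ?thesis
    unfolding CGWH_def weak_Hausdorff_def
    by (auto simp: kprod_def closedin_kify) (auto simp: compactly_closed_def test_map_kify)
qed

lemma closedin_kprod_if_closedin_prod:
  "closedin (prod_topology X Y) C \<Longrightarrow> closedin (kprod X Y) C"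
  unfolding kprod_def closedin_kify by (rule closedin_imp_compactly_closed)

section \<open>Collapsing a closed subspace\<close>

lemma closedin_quot:
  "closedin (quot_topology X q) C \<longleftrightarrow> C \<subseteq> q ` topspace X \<and> closedin X {x \<in> topspace X. q x \<in> C}"
proof (cases "C \<subseteq> q ` topspace X")
  case True
  then show ?thesis
    using quotient_map_quot[of X q] unfolding quotient_map_closedin topspace_quot by simp
next
  case False
  then show ?thesis using closedin_subset[of "quot_topology X q" C] by auto
qed

lemma compact_Hausdorff_closed_subspace:
  assumes "compact_space K" "Hausdorff_space K" "closedin K C"
  shows "compact_space (subtopology K C)" "Hausdorff_space (subtopology K C)"
    "topspace (subtopology K C) = C"
  using assms by (simp_all add: compact_space_subtopology closedin_compact_space
      Hausdorff_space_subtopology Int_absorb1 closedin_subset)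

lemma compact_Hausdorff_closed_neighbourhood:
  assumes "compact_space K" "Hausdorff_space K" "openin K W" "k \<in> W"
  obtains U M where "openin K U" "closedin K M" "k \<in> U" "U \<subseteq> M" "M \<subseteq> W"
proof -
  have "neighbourhood_base_of (closedin K) K"
    using assms neighbourhood_base_of_closedin compact_Hausdorff_imp_regular_space by blast
  then show ?thesis
    using that assms(3,4) unfolding neighbourhood_base_of by meson
qed

text \<open>A test map into the quotient of \<open>P\<close> by \<open>A\<close> lifts to \<open>P\<close> away from the preimage of the
  base point. This reduces closedness of its image to closedness of images of test maps into \<open>P\<close>.\<close>

lemma CGWH_collapse:
  fixes P :: "'p topology" and q :: "'p \<Rightarrow> 'q"
  assumes P: "CGWH P" and A: "closedin P A" and qA: "\<And>x. x \<in> topspace P \<Longrightarrow> q x = b \<longleftrightarrow> x \<in> A"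
    and inj: "inj_on q (topspace P - A)"
    and j1: "\<exists>j :: 'q set set \<Rightarrow> 'p set set. inj j" and j2: "\<exists>j :: 'p set set \<Rightarrow> 'q set set. inj j"
  shows "CGWH (quot_topology P q)"
proof -
  let ?Q = "quot_topology P q"
  \<comment> \<open>The inverse of \<open>q\<close> away from the collapsed set.\<close>
  define s where "s = inv_into (topspace P - A) q"
  have sq: "s (q x) = x" if "x \<in> topspace P" "x \<notin> A" for x
    unfolding s_def using inj that by (simp add: inv_into_f_f)
  have qs: "q (s y) = y \<and> s y \<in> topspace P - A" if y: "y \<in> q ` topspace P" "y \<noteq> b" for y
  proof -
    obtain x where "x \<in> topspace P" "y = q x" using y by blast
    moreover from this have "x \<notin> A" using y qA by auto
    ultimately show ?thesis using sq by auto
  qed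
  \<comment> \<open>A set that contains \<open>A\<close> or misses it is saturated, so its image is
    closed as soon as the set is.\<close>
  have cl: "closedin ?Q (q ` C)" if C: "closedin P C" and or: "A \<subseteq> C \<or> C \<inter> A = {}" for C
  proof -
    have Cs: "C \<subseteq> topspace P" using C closedin_subset by blast
    have "x \<in> C" if x: "x \<in> topspace P" and c: "c \<in> C" and e: "q x = q c" for x c
    proof (cases "x \<in> A")
      case True
      then have "c \<in> A" using qA[OF x] qA[of c] c e Cs by auto
      then show ?thesis using or c True by blast
    next
      case False
      moreover have "c \<notin> A" using False qA[OF x] qA[of c] c e Cs by auto
      ultimately have "x = c" using sq[of x] sq[of c] x c Cs e by auto
      then show ?thesis using c by simp
    qed
    then have "{x \<in> topspace P. q x \<in> q ` C} = C" using Cs by auto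
    then show ?thesis using C Cs by (auto simp: closedin_quot)
  qed
  have wP: "weak_Hausdorff P" and kP: "\<And>C. compactly_closed P C \<Longrightarrow> closedin P C"
    using P by (auto simp: CGWH_def)
  have lift: "closedin P (s ` u ` K')"
    if t: "test_map ?Q K u" and K': "closedin K K'" and b: "b \<notin> u ` K'" for K u K'
  proof -
    have K: "compact_space K" "Hausdorff_space K" "continuous_map K ?Q u"
      using t by (auto simp: test_map_def)
    note sub = compact_Hausdorff_closed_subspace[OF K(1,2) K']
    have uK: "u k \<in> q ` topspace P" if "k \<in> K'" for k
      using that closedin_subset[OF K'] K(3) by (auto simp: continuous_map_def)
    have "continuous_map (subtopology K K') P (\<lambda>k. s (u k))"
      unfolding continuous_map_closedin
    proof (intro conjI allI impI)
      show "(\<lambda>k. s (u k)) \<in> topspace (subtopology K K') \<rightarrow> topspace P"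
        unfolding sub(3) using uK qs b by fastforce
      fix C assume C: "closedin P C"
      \<comment> \<open>Adding \<open>A\<close> makes \<open>C\<close> saturated. On
        \<open>K'\<close> this does not enlarge the preimage, because \<open>u\<close> avoids
        \<open>b\<close> there.\<close>
      have "closedin K {k \<in> topspace K. u k \<in> q ` (C \<union> A)}"
        using closedin_continuous_map_preimage[OF K(3) cl] A C by auto
      moreover have "{k \<in> K'. s (u k) \<in> C} = {k \<in> topspace K. u k \<in> q ` (C \<union> A)} \<inter> K'"
      proof -
        have "s (u k) \<in> C \<longleftrightarrow> u k \<in> q ` (C \<union> A)" if k: "k \<in> K'" for k
        proof
          have *: "u k \<noteq> b" "u k \<in> q ` topspace P" using uK[OF k] b k by auto
          then have "q (s (u k)) = u k" using qs by blast
          then show "s (u k) \<in> C \<Longrightarrow> u k \<in> q ` (C \<union> A)" by (metis UnI1 imageI)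
          assume "u k \<in> q ` (C \<union> A)"
          then obtain x where x: "x \<in> C \<union> A" "u k = q x" by blast
          have "x \<in> topspace P" using x(1) closedin_subset[OF C] closedin_subset[OF A] by blast
          moreover from this have "x \<notin> A" using qA *(1) x(2) by blast
          ultimately show "s (u k) \<in> C" using x sq by auto
        qed
        then show ?thesis using closedin_subset[OF K'] by blast
      qed
      ultimately show "closedin (subtopology K K') {k \<in> topspace (subtopology K K'). s (u k) \<in> C}"
        unfolding sub(3) closedin_subtopology by blast
    qed
    from weak_HausdorffD[OF wP sub(1,2) this j1] show ?thesis
      unfolding sub(3) by (simp add: image_image)
  qed
  have "closedin ?Q (u ` topspace K)" if t: "test_map ?Q K u" for K u
  proof -
    have K: "compact_space K" "Hausdorff_space K" and u: "continuous_map K ?Q u"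
      using t by (auto simp: test_map_def)
    have uK: "u ` topspace K \<subseteq> q ` topspace P"
      using continuous_map_image_subset_topspace[OF u] by simp
    show ?thesis
    proof (cases "b \<in> u ` topspace K")
      case False
      have C: "closedin P (s ` u ` topspace K)"
        using lift[OF t closedin_topspace False] .
      have sA: "s ` u ` topspace K \<inter> A = {}"
      proof -
        have "s y \<notin> A" if "y \<in> u ` topspace K" for y
          using qs[of y] uK False that by (metis DiffD2 subsetD)
        then show ?thesis by blast
      qed
      have "q ` s ` u ` topspace K = u ` topspace K"
      proof -
        have "q (s y) = y" if "y \<in> u ` topspace K" for y
          using qs[of y] uK False that by (metis subsetD)
        then show ?thesis by (auto simp: image_iff)
      qed
      then show ?thesis using cl[OF C] sA by simp
    next
      case True
      \<comment> \<open>The image contains the base point, so \<open>u\<close> has no lift on all of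
        \<open>K\<close>. Instead, the full preimage \<open>?D\<close> of the image is shown to be
        compactly closed by testing it with a second compact space.\<close>
      let ?D = "{x \<in> topspace P. q x \<in> u ` topspace K}"
      have AD: "A \<subseteq> ?D"
      proof
        fix x assume "x \<in> A"
        moreover from this have x: "x \<in> topspace P" using closedin_subset[OF A] by blast
        ultimately have "q x = b" using qA by simp
        then show "x \<in> ?D" using x True by simp
      qed
      have "closedin L {l \<in> topspace L. v l \<in> ?D}" if t': "test_map P L v" for L v
      proof -
        have L: "compact_space L" "Hausdorff_space L" and v: "continuous_map L P v"
          using t' by (auto simp: test_map_def)
        let ?E = "{l \<in> topspace L. v l \<in> ?D}"
        have "openin L (topspace L - ?E)"
        proof (subst openin_subopen, rule ballI)
          fix l assume l: "l \<in> topspace L - ?E"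
          have op: "openin L {l \<in> topspace L. v l \<in> topspace P - A}"
            by (rule openin_continuous_map_preimage[OF v openin_diff[OF openin_topspace A]])
          have mem: "l \<in> {l \<in> topspace L. v l \<in> topspace P - A}"
            using l AD v by (auto simp: continuous_map_def)
          obtain U M where UM: "openin L U" "closedin L M" "l \<in> U" "U \<subseteq> M"
            "M \<subseteq> {l \<in> topspace L. v l \<in> topspace P - A}"
            by (rule compact_Hausdorff_closed_neighbourhood[OF L op mem])
          have "closedin P (v ` M)"
          proof -
            note sub = compact_Hausdorff_closed_subspace[OF L UM(2)]
            show ?thesis
              using weak_HausdorffD[OF wP sub(1,2) continuous_map_from_subtopology[OF v] inj_id_sets]
              unfolding sub(3) .
          qed
          moreover have "v ` M \<inter> A = {}" using UM(5) by auto
          ultimately have "closedin ?Q (q ` v ` M)" using cl by blast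
          then have K': "closedin K {k \<in> topspace K. u k \<in> q ` v ` M}" (is "closedin K ?K'")
            using closedin_continuous_map_preimage[OF u] by blast
          have "b \<notin> u ` ?K'"
          proof
            assume "b \<in> u ` ?K'"
            then obtain m where "m \<in> M" "q (v m) = b" by auto
            then show False using UM(5) qA by blast
          qed
          from lift[OF t K' this] have "closedin L {l \<in> topspace L. v l \<in> s ` u ` ?K'}"
            using closedin_continuous_map_preimage[OF v] by blast
          then have op': "openin L (U - {l \<in> topspace L. v l \<in> s ` u ` ?K'})"
            by (rule openin_diff[OF UM(1)])
          have mem': "l \<notin> {l \<in> topspace L. v l \<in> s ` u ` ?K'}"
          proof
            assume "l \<in> {l \<in> topspace L. v l \<in> s ` u ` ?K'}"
            then obtain k where k: "k \<in> topspace K" "u k \<in> q ` v ` M" "v l = s (u k)" by auto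
            then obtain m where m: "m \<in> M" "u k = q (v m)" by auto
            then have "s (u k) = v m" using UM(5) sq by auto
            then have "q (v l) = u k" using k m by simp
            then have "l \<in> ?E" using k(1) l v by (auto simp: continuous_map_def)
            then show False using l by simp
          qed
          have sub': "U - {l \<in> topspace L. v l \<in> s ` u ` ?K'} \<subseteq> topspace L - ?E"
          proof
            fix x assume x: "x \<in> U - {l \<in> topspace L. v l \<in> s ` u ` ?K'}"
            then have xM: "x \<in> M" and xL: "x \<in> topspace L" using UM(4,5) by auto
            have "x \<notin> ?E"
            proof
              assume "x \<in> ?E"
              then obtain k where k: "k \<in> topspace K" "q (v x) = u k" by auto
              then have "u k \<in> q ` v ` M" using xM by (metis imageI)
              moreover have "v x = s (u k)"
                using k(2) sq[of "v x"] xM UM(5) by auto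
              ultimately show False using x k xL by auto
            qed
            then show "x \<in> topspace L - ?E" using xL by simp
          qed
          show "\<exists>T. openin L T \<and> l \<in> T \<and> T \<subseteq> topspace L - ?E"
            by (rule exI, rule conjI, rule op', rule conjI, rule DiffI, rule UM(3), rule mem', rule sub')
        qed
        moreover have "?E \<subseteq> topspace L" by (rule Collect_restrict)
        ultimately show ?thesis unfolding closedin_def by (rule conjI[rotated])
      qed
      then have "compactly_closed P ?D"
        unfolding compactly_closed_def by (intro conjI allI impI Collect_restrict)
      then have "closedin P ?D" by (rule kP)
      then show ?thesis using uK by (simp add: closedin_quot)
    qed
  qed
  moreover have "closedin ?Q C" if C: "compactly_closed ?Q C" for C
  proof -
    have "closedin K {k \<in> topspace K. u k \<in> {x \<in> topspace P. q x \<in> C}}" if t: "test_map P K u" for K u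
    proof -
      \<comment> \<open>A test map of \<open>P\<close> becomes one of the quotient after composition
        with \<open>q\<close>, so closedness of preimages passes from the quotient back to
        \<open>P\<close>.\<close>
      have "continuous_map K ?Q (q \<circ> u)"
        using t continuous_map_compose[OF _ quotient_imp_continuous_map[OF quotient_map_quot]]
        unfolding test_map_def by blast
      then have "closedin K {k \<in> topspace K. (q \<circ> u) k \<in> C}"
        using t compactly_closedD[OF C _ _ _ j2] unfolding test_map_def by blast
      moreover have "{k \<in> topspace K. (q \<circ> u) k \<in> C} = {k \<in> topspace K. u k \<in> {x \<in> topspace P. q x \<in> C}}"
        using t by (auto simp: test_map_def continuous_map_def)
      ultimately show ?thesis by simp
    qed
    then have "compactly_closed P {x \<in> topspace P. q x \<in> C}"
      unfolding compactly_closed_def by (intro conjI allI impI Collect_restrict)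
    then have "closedin P {x \<in> topspace P. q x \<in> C}" by (rule kP)
    then show ?thesis using C by (auto simp: closedin_quot compactly_closed_def)
  qed
  ultimately show ?thesis unfolding CGWH_def weak_Hausdorff_def by blast
qed

section \<open>Smash products of based \<open>G\<close>-spaces\<close>

lemma continuous_map_in: "continuous_map X Y f \<Longrightarrow> x \<in> topspace X \<Longrightarrow> f x \<in> topspace Y"
  unfolding continuous_map_def by blast

text \<open>Bijectivity is automatic, since the inverse of \<open>\<phi> g\<close> is the action of
  the inverse of \<open>g\<close>. Extensionality has to be supplied because \<open>Bij\<close>
  contains only extensional functions.\<close>

lemma group_actionI:
  assumes "group G"
    and ext: "\<And>g. g \<in> carrier G \<Longrightarrow> \<phi> g \<in> extensional E"
    and cl: "\<And>g x. g \<in> carrier G \<Longrightarrow> x \<in> E \<Longrightarrow> \<phi> g x \<in> E"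
    and one: "\<And>x. x \<in> E \<Longrightarrow> \<phi> \<one>\<^bsub>G\<^esub> x = x"
    and mult: "\<And>g h x. g \<in> carrier G \<Longrightarrow> h \<in> carrier G \<Longrightarrow> x \<in> E \<Longrightarrow> \<phi> (g \<otimes>\<^bsub>G\<^esub> h) x = \<phi> g (\<phi> h x)"
  shows "group_action G E \<phi>"
proof -
  interpret group G by fact
  have inv: "\<phi> (inv\<^bsub>G\<^esub> g) (\<phi> g x) = x \<and> \<phi> g (\<phi> (inv\<^bsub>G\<^esub> g) x) = x" if "g \<in> carrier G" "x \<in> E" for g x
    using that mult[of "inv\<^bsub>G\<^esub> g" g x] mult[of g "inv\<^bsub>G\<^esub> g" x] one by simp
  have bij: "\<phi> g \<in> Bij E" if g: "g \<in> carrier G" for g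
  proof -
    have "bij_betw (\<phi> g) E E"
      by (rule bij_betw_byWitness[where f' = "\<phi> (inv\<^bsub>G\<^esub> g)"]) (use inv cl g in auto)
    then show ?thesis using ext g by (auto simp: Bij_def)
  qed
  have "\<phi> \<in> hom G (BijGroup E)"
  proof (rule homI)
    show "\<phi> g \<in> carrier (BijGroup E)" if "g \<in> carrier G" for g
      using bij that by (simp add: BijGroup_def)
    show "\<phi> (g \<otimes>\<^bsub>G\<^esub> h) = \<phi> g \<otimes>\<^bsub>BijGroup E\<^esub> \<phi> h" if gh: "g \<in> carrier G" "h \<in> carrier G" for g h
    proof (rule extensionalityI[of _ E])
      show "\<phi> (g \<otimes>\<^bsub>G\<^esub> h) \<in> extensional E" using ext gh by simp
      show "\<phi> g \<otimes>\<^bsub>BijGroup E\<^esub> \<phi> h \<in> extensional E"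
        using bij gh by (simp add: BijGroup_def compose_def)
      show "\<phi> (g \<otimes>\<^bsub>G\<^esub> h) x = (\<phi> g \<otimes>\<^bsub>BijGroup E\<^esub> \<phi> h) x" if "x \<in> E" for x
        using bij gh mult that by (simp add: BijGroup_def compose_def)
    qed
  qed
  then show ?thesis
    unfolding group_action_def group_hom_def group_hom_axioms_def
    using group_BijGroup by blast
qed

lemma group_actionD:
  assumes "group_action G E \<phi>"
  shows "g \<in> carrier G \<Longrightarrow> x \<in> E \<Longrightarrow> \<phi> g x \<in> E"
    and "x \<in> E \<Longrightarrow> \<phi> \<one>\<^bsub>G\<^esub> x = x"
    and "g \<in> carrier G \<Longrightarrow> h \<in> carrier G \<Longrightarrow> x \<in> E \<Longrightarrow> \<phi> (g \<otimes>\<^bsub>G\<^esub> h) x = \<phi> g (\<phi> h x)"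
proof -
  interpret group_action G E \<phi> by fact
  show "g \<in> carrier G \<Longrightarrow> x \<in> E \<Longrightarrow> \<phi> g x \<in> E" using element_image by blast
  show "x \<in> E \<Longrightarrow> \<phi> \<one>\<^bsub>G\<^esub> x = x" using id_eq_one by (metis restrict_apply)
  show "g \<in> carrier G \<Longrightarrow> h \<in> carrier G \<Longrightarrow> x \<in> E \<Longrightarrow> \<phi> (g \<otimes>\<^bsub>G\<^esub> h) x = \<phi> g (\<phi> h x)"
    using composition_rule by blast
qed

lemma group_action_of_based: "based_g_space G X \<Longrightarrow> group_action G (pts X) (act X)"
  unfolding based_g_space_def g_space_def by blast

lemma based_g_spaceD:
  assumes "based_g_space G X"
  shows "CGWH (spc X)" "weak_Hausdorff (spc X)" "pt X \<in> pts X"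
    and "g \<in> carrier G \<Longrightarrow> x \<in> pts X \<Longrightarrow> act X g x \<in> pts X"
    and "g \<in> carrier G \<Longrightarrow> act X g (pt X) = pt X"
    and "x \<in> pts X \<Longrightarrow> act X \<one>\<^bsub>G\<^esub> x = x"
    and "g \<in> carrier G \<Longrightarrow> h \<in> carrier G \<Longrightarrow> x \<in> pts X \<Longrightarrow>
      act X (g \<otimes>\<^bsub>G\<^esub> h) x = act X g (act X h x)"
    and "g \<in> carrier G \<Longrightarrow> continuous_map (spc X) (spc X) (act X g)"
proof -
  have X: "CGWH (spc X)" "group_action G (pts X) (act X)" "pt X \<in> pts X"
    "\<forall>g\<in>carrier G. continuous_map (spc X) (spc X) (act X g)" "\<forall>g\<in>carrier G. act X g (pt X) = pt X"
    using assms unfolding based_g_space_def g_space_def by blast+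
  show "CGWH (spc X)" "pt X \<in> pts X" by (fact X)+
  show "weak_Hausdorff (spc X)" using X(1) unfolding CGWH_def by blast
  show "g \<in> carrier G \<Longrightarrow> act X g (pt X) = pt X" using X(5) by blast
  show "g \<in> carrier G \<Longrightarrow> continuous_map (spc X) (spc X) (act X g)" using X(4) by blast
qed (rule group_actionD[OF group_action_of_based[OF assms]]; assumption)+

lemma closedin_pt: "based_g_space G X \<Longrightarrow> closedin (spc X) {pt X}"
  by (rule closedin_points_weak_Hausdorff[OF based_g_spaceD(2,3)])

text \<open>The parameter \<open>U\<close> only fixes the type \<open>'u\<close> of points.\<close>

locale gspaces = group G for G :: "('g, 'r) monoid_scheme" +
  fixes U :: "'u itself"
  assumes inf: "infinite (UNIV :: 'u set)"
begin

section \<open>Codes of pairs and of natural numbers\<close>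

lemma inj_upair: "inj (case_prod (upair :: 'u \<Rightarrow> 'u \<Rightarrow> 'u))"
proof -
  have "\<exists>f :: 'u \<times> 'u \<Rightarrow> 'u. inj f" using infinite_bij_pair[OF inf] bij_is_inj by blast
  then have "inj (SOME f :: 'u \<times> 'u \<Rightarrow> 'u. inj f)" by (rule someI_ex)
  then show ?thesis unfolding upair_def case_prod_curry .
qed

lemma upair_inject [simp]: "upair a b = upair c d \<longleftrightarrow> (a :: 'u) = c \<and> b = d"
  using injD[OF inj_upair, of "(a, b)" "(c, d)"] by auto

lemma ufst_upair [simp]: "ufst (upair a b) = (a :: 'u)"
  and usnd_upair [simp]: "usnd (upair a b) = (b :: 'u)"
  using inv_into_f_f[OF inj_upair, of "(a, b)"] by (simp_all add: ufst_def usnd_def)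

lemma inj_unat: "inj (unat :: nat \<Rightarrow> 'u)"
proof -
  have "\<exists>f :: nat \<Rightarrow> 'u. inj f" using infinite_countable_subset[OF inf] by blast
  then show ?thesis unfolding unat_def by (rule someI_ex)
qed

lemma unat_inject [simp]: "unat i = (unat j :: 'u) \<longleftrightarrow> i = j"
  using injD[OF inj_unat, of i j] by auto

lemma inv_unat [simp]: "inv_into UNIV unat (unat i :: 'u) = i"
  using inj_unat by simp

section \<open>Points, action and topology of a smash product\<close>

lemma pt_smash: "pt (smash X Y) = smash_cls X Y (pt X) (pt Y)"
  unfolding smash_def Let_def by (simp only: bspace.select_convs)

lemma smash_cls_pt [simp]:
  "smash_cls X Y (pt X) y = pt (smash X Y)"
  "smash_cls X Y x (pt Y) = pt (smash X Y)"
  unfolding pt_smash by (simp_all add: smash_cls_def)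

lemma smash_cls_eq_pt:
  fixes X :: "('g, 'u) bspace"
  shows "smash_cls X Y x y = pt (smash X Y) \<longleftrightarrow> x = pt X \<or> y = pt Y"
  unfolding pt_smash by (auto simp: smash_cls_def)

lemma smash_cls_eq_iff:
  fixes X :: "('g, 'u) bspace"
  shows "smash_cls X Y x y = smash_cls X Y x' y' \<longleftrightarrow>
    x = x' \<and> y = y' \<or> (x = pt X \<or> y = pt Y) \<and> (x' = pt X \<or> y' = pt Y)"
  by (auto simp: smash_cls_def)

text \<open>A class off the wedge is represented by its own pair and every other class by the pair
  of base points. Hence a formula in the coordinates of the representative may be evaluated on any
  representing pair once it is constant on the wedge.\<close>

lemma smash_cls_elim:
  fixes X :: "('g, 'u) bspace"
  assumes "x = pt X \<or> y = pt Y \<Longrightarrow> H x y = H (pt X) (pt Y)"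
  shows "H (ufst (smash_cls X Y x y)) (usnd (smash_cls X Y x y)) = H x y"
  using assms by (auto simp: smash_cls_def)

lemma spc_smash: "spc (smash X Y) = quot_topology (kprod (spc X) (spc Y)) (\<lambda>(x, y). smash_cls X Y x y)"
  unfolding smash_def Let_def by (simp only: bspace.select_convs)

lemma act_smash_def:
  "act (smash X Y) g =
    (\<lambda>z\<in>pts (smash X Y). smash_cls X Y (act X g (ufst z)) (act Y g (usnd z)))"
  unfolding spc_smash unfolding smash_def Let_def by (simp only: bspace.select_convs)

lemma pts_smash: "pts (smash X Y) = (\<lambda>(x, y). smash_cls X Y x y) ` (pts X \<times> pts Y)"
  by (simp add: spc_smash)

lemma smash_cls_in [simp]: "x \<in> pts X \<Longrightarrow> y \<in> pts Y \<Longrightarrow> smash_cls X Y x y \<in> pts (smash X Y)"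
  unfolding pts_smash by (rule image_eqI[of _ _ "(x, y)"]) simp_all

lemma pts_smashE:
  assumes "z \<in> pts (smash X Y)"
  obtains x y where "x \<in> pts X" "y \<in> pts Y" "z = smash_cls X Y x y"
proof -
  obtain p where "p \<in> pts X \<times> pts Y" "z = (case p of (x, y) \<Rightarrow> smash_cls X Y x y)"
    using assms unfolding pts_smash by (rule imageE)
  then show ?thesis using that[of "fst p" "snd p"] by (simp add: mem_Times_iff case_prod_unfold)
qed

lemma act_smash:
  fixes X :: "('g, 'u) bspace"
  assumes "based_g_space G X" "based_g_space G Y" "g \<in> carrier G" "x \<in> pts X" "y \<in> pts Y"
  shows "act (smash X Y) g (smash_cls X Y x y) = smash_cls X Y (act X g x) (act Y g y)"
proof -
  have "act (smash X Y) g (smash_cls X Y x y)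
      = smash_cls X Y (act X g (ufst (smash_cls X Y x y))) (act Y g (usnd (smash_cls X Y x y)))"
    using smash_cls_in[OF assms(4,5)] by (simp add: act_smash_def)
  also have "\<dots> = smash_cls X Y (act X g x) (act Y g y)"
    by (rule smash_cls_elim)
       (elim disjE; simp add: based_g_spaceD(5)[OF assms(1,3)] based_g_spaceD(5)[OF assms(2,3)])
  finally show ?thesis .
qed

lemma continuous_map_smash_cls:
  fixes X Y :: "('g, 'u) bspace" and K :: "'k topology"
  assumes "compact_space K" "Hausdorff_space K" "\<exists>j :: 'k \<Rightarrow> ('u \<times> 'u) set set. inj j"
    and "continuous_map K (spc X) a" "continuous_map K (spc Y) b"
  shows "continuous_map K (spc (smash X Y)) (\<lambda>k. smash_cls X Y (a k) (b k))"
proof -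
  have "continuous_map K (kprod (spc X) (spc Y)) (\<lambda>k. (a k, b k))"
    using continuous_map_into_kprod[OF assms(1-3)] assms(4,5) by simp
  from continuous_map_compose[OF this quotient_imp_continuous_map[OF quotient_map_quot],
      of "\<lambda>(x, y). smash_cls X Y x y"]
  show ?thesis unfolding spc_smash comp_def case_prod_conv .
qed

text \<open>The quotient map and the k-ification are removed together: only pairs of maps from one
  compact Hausdorff space have to be considered.\<close>

lemma continuous_map_from_smash:
  fixes X Y :: "('g, 'u) bspace"
  assumes "\<And>(K :: ('u \<times> 'u) set set topology) a b. compact_space K \<Longrightarrow> Hausdorff_space K \<Longrightarrow>
      continuous_map K (spc X) a \<Longrightarrow> continuous_map K (spc Y) b \<Longrightarrow>
      continuous_map K T (\<lambda>k. h (smash_cls X Y (a k) (b k)))"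
    and "\<And>x y. x \<in> pts X \<Longrightarrow> y \<in> pts Y \<Longrightarrow> h (smash_cls X Y x y) \<in> topspace T"
  shows "continuous_map (spc (smash X Y)) T h"
  unfolding spc_smash
proof (rule continuous_compose_quotient_map[OF quotient_map_quot])
  show "continuous_map (kprod (spc X) (spc Y)) T (h \<circ> (\<lambda>(x, y). smash_cls X Y x y))"
    using assms by (intro continuous_map_from_kprod) auto
qed

lemma CGWH_smash:
  fixes X Y :: "('g, 'u) bspace"
  assumes "based_g_space G X" "based_g_space G Y"
  shows "CGWH (spc (smash X Y))"
  unfolding spc_smash
proof (rule CGWH_collapse)
  show "CGWH (kprod (spc X) (spc Y))"
    using CGWH_kprod[OF inf] assms based_g_spaceD(1) by blast
  \<comment> \<open>The wedge; it is closed because base points are closed in weak Hausdorff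
    spaces.\<close>
  let ?A = "{pt X} \<times> pts Y \<union> pts X \<times> {pt Y}"
  show "closedin (kprod (spc X) (spc Y)) ?A"
    by (rule closedin_kprod_if_closedin_prod, rule closedin_Un)
       (simp_all only: closedin_prod_Times_iff closedin_topspace closedin_pt[OF assms(1)]
         closedin_pt[OF assms(2)] simp_thms)
  show "(case p of (x, y) \<Rightarrow> smash_cls X Y x y) = pt (smash X Y) \<longleftrightarrow> p \<in> ?A"
    if "p \<in> topspace (kprod (spc X) (spc Y))" for p
    using that by (auto simp: smash_cls_eq_pt)
  show "inj_on (\<lambda>(x, y). smash_cls X Y x y) (topspace (kprod (spc X) (spc Y)) - ?A)"
    by (auto simp: inj_on_def smash_cls_eq_iff)
  show "\<exists>j :: 'u set set \<Rightarrow> ('u \<times> 'u) set set. inj j" by (rule inj_diagonal_sets)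
  show "\<exists>j :: ('u \<times> 'u) set set \<Rightarrow> 'u set set. inj j" by (rule inj_pair_sets[OF inf])
qed

lemma based_g_space_smash [simp]:
  fixes X Y :: "('g, 'u) bspace"
  assumes X: "based_g_space G X" and Y: "based_g_space G Y"
  shows "based_g_space G (smash X Y)"
proof -
  note XD = based_g_spaceD[OF X] and YD = based_g_spaceD[OF Y] and act = act_smash[OF X Y]
  have "continuous_map (spc (smash X Y)) (spc (smash X Y)) (act (smash X Y) g)"
    if g: "g \<in> carrier G" for g
  proof (rule continuous_map_from_smash)
    fix K :: "('u \<times> 'u) set set topology" and a b
    assume K: "compact_space K" "Hausdorff_space K"
      and a: "continuous_map K (spc X) a" and b: "continuous_map K (spc Y) b"
    have "continuous_map K (spc (smash X Y)) (\<lambda>k. smash_cls X Y (act X g (a k)) (act Y g (b k)))"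
      using continuous_map_compose[OF a XD(8)[OF g]] continuous_map_compose[OF b YD(8)[OF g]]
      by (intro continuous_map_smash_cls[OF K inj_id_sets]) (simp_all add: comp_def)
    then show "continuous_map K (spc (smash X Y)) (\<lambda>k. act (smash X Y) g (smash_cls X Y (a k) (b k)))"
      by (rule continuous_map_eq)
         (simp add: act g continuous_map_in[OF a] continuous_map_in[OF b])
  qed (simp add: act g XD YD)
  moreover have "group_action G (pts (smash X Y)) (act (smash X Y))"
  proof (rule group_actionI)
    show "group G" by (rule is_group)
    show "act (smash X Y) g \<in> extensional (pts (smash X Y))" for g
      unfolding act_smash_def by simp
  qed (auto elim!: pts_smashE simp: act XD YD)
  moreover have "pt (smash X Y) \<in> pts (smash X Y)"
    unfolding pt_smash using XD(3) YD(3) by (rule smash_cls_in)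
  moreover have "act (smash X Y) g (pt (smash X Y)) = pt (smash X Y)" if "g \<in> carrier G" for g
    unfolding pt_smash act[OF that XD(3) YD(3)] XD(5)[OF that] YD(5)[OF that] ..
  ultimately show ?thesis
    unfolding based_g_space_def g_space_def
    using CGWH_smash[OF X Y] by simp
qed

section \<open>Finite discrete spaces\<close>

lemma pts_dspace [simp]: "pts (dspace n) = unat ` {..n}"
  by (simp add: dspace_def)

lemma pt_dspace [simp]: "pt (dspace n) = unat 0"
  by (simp add: dspace_def)

lemma based_g_space_dspace [simp]: "based_g_space G (dspace n :: ('g, 'u) bspace)"
proof -
  have "CGWH (discrete_topology (unat ` {..n}) :: 'u topology)"
    by (auto simp: CGWH_def weak_Hausdorff_def compactly_closed_def test_map_def continuous_map_def)
  moreover have "group_action G (unat ` {..n} :: 'u set) (\<lambda>g. \<lambda>z\<in>unat ` {..n}. z)"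
    by (rule group_actionI[OF is_group]) auto
  ultimately show ?thesis
    by (auto simp: based_g_space_def g_space_def dspace_def)
qed

end

section \<open>Finite wedges\<close>

text \<open>The retraction of the wedge onto its copy of \<open>X\<close> with index
  \<open>i\<close>, collapsing all other copies. For \<open>i = 0\<close> it is constant on the
  wedge, as the only representative with index 0 is the base point.\<close>

definition wproj :: "nat \<Rightarrow> ('g, 'u) bspace \<Rightarrow> 'u \<Rightarrow> 'u" where
  "wproj i X z = (if ufst z = unat i then usnd z else pt X)"

abbreviation wcls :: "nat \<Rightarrow> ('g, 'u) bspace \<Rightarrow> nat \<Rightarrow> 'u \<Rightarrow> 'u" where
  "wcls n X i x \<equiv> smash_cls (dspace n) X (unat i) x"

text \<open>The copy of \<open>X\<close> with index \<open>i\<close> inside the wedge, described as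
  a fixed point set so that it can be pulled back along test maps. For \<open>i = 0\<close> it is
  the base point alone.\<close>

definition wpart :: "nat \<Rightarrow> nat \<Rightarrow> ('g, 'u) bspace \<Rightarrow> 'u set" where
  "wpart i n X = {z \<in> pts (smash (dspace n) X). z = wcls n X i (wproj i X z)}"

context gspaces
begin

lemma wcls_0 [simp]: "wcls n X 0 x = pt (smash (dspace n) X)"
  using smash_cls_pt(1)[of "dspace n" X x] by simp

lemma wcls_in [simp]: "i \<le> n \<Longrightarrow> x \<in> pts X \<Longrightarrow> wcls n X i x \<in> pts (smash (dspace n) X)"
  by (rule smash_cls_in) simp_all

lemma pts_wedgeE:
  fixes X :: "('g, 'u) bspace"
  assumes "z \<in> pts (smash (dspace n) X)"
  obtains i x where "i \<le> n" "x \<in> pts X" "z = wcls n X i x"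
proof -
  obtain y x where "y \<in> pts (dspace n :: ('g, 'u) bspace)" "x \<in> pts X" "z = smash_cls (dspace n) X y x"
    using assms by (rule pts_smashE)
  then show ?thesis using that by auto
qed

lemma act_dspace: "i \<le> n \<Longrightarrow> act (dspace n) g (unat i) = unat i"
  by (simp add: dspace_def)

lemma act_wcls:
  fixes X :: "('g, 'u) bspace"
  assumes "based_g_space G X" "g \<in> carrier G" "i \<le> n" "x \<in> pts X"
  shows "act (smash (dspace n) X) g (wcls n X i x) = wcls n X i (act X g x)"
  using assms by (simp add: act_smash act_dspace)

lemma wproj_wcls:
  fixes X :: "('g, 'u) bspace"
  shows "wproj i X (wcls n X j x) = (if j = i \<and> i \<noteq> 0 then x else pt X)"
  by (auto simp: wproj_def smash_cls_def)

text \<open>The index coordinate of a test map takes values in a finite discrete space, so it cuts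
  the test space into finitely many closed pieces with constant index.\<close>

lemma continuous_map_from_wedge:
  fixes X :: "('g, 'u) bspace"
  assumes h: "\<And>i. i \<le> n \<Longrightarrow> continuous_map (spc X) T (\<lambda>x. h (wcls n X i x))"
  shows "continuous_map (spc (smash (dspace n) X)) T h"
proof (rule continuous_map_from_smash)
  fix K :: "('u \<times> 'u) set set topology" and a b
  assume K: "compact_space K" "Hausdorff_space K"
    and a: "continuous_map K (spc (dspace n :: ('g, 'u) bspace)) a" and b: "continuous_map K (spc X) b"
  have ad: "a k \<in> unat ` {..n}" if "k \<in> topspace K" for k
    using continuous_map_in[OF a that] by simp
  show "continuous_map K T (\<lambda>k. h (smash_cls (dspace n) X (a k) (b k)))"
  proof (rule pasting_lemma_closed[where I = "{..n}" and T = "\<lambda>i. {k \<in> topspace K. a k \<in> {unat i}}"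
        and f = "\<lambda>i k. h (wcls n X i (b k))"])
    fix i assume i: "i \<in> {..n}"
    have "closedin (spc (dspace n :: ('g, 'u) bspace)) {unat i}" using i by (simp add: dspace_def)
    from closedin_continuous_map_preimage[OF a this]
    show "closedin K {k \<in> topspace K. a k \<in> {unat i}}" .
    show "continuous_map (subtopology K {k \<in> topspace K. a k \<in> {unat i}}) T (\<lambda>k. h (wcls n X i (b k)))"
      using continuous_map_from_subtopology[OF continuous_map_compose[OF b h[of i]]] i
      by (simp add: comp_def)
  next
    fix k assume "k \<in> topspace K"
    then show "\<exists>i. i \<in> {..n} \<and> k \<in> {k \<in> topspace K. a k \<in> {unat i}} \<and>
        h (smash_cls (dspace n) X (a k) (b k)) = h (wcls n X i (b k))"
      using ad[of k] by auto
  qed auto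
next
  fix y x assume "y \<in> pts (dspace n :: ('g, 'u) bspace)" and x: "x \<in> pts X"
  then obtain i where "i \<le> n" "y = unat i" by auto
  then show "h (smash_cls (dspace n) X y x) \<in> topspace T"
    using continuous_map_in[OF h x] by simp
qed

text \<open>\<open>X\<close> is compactly generated, so the inclusion may be tested on compact
  spaces, where it is a pair of a constant and a continuous map.\<close>

lemma continuous_map_wcls:
  fixes X :: "('g, 'u) bspace"
  assumes X: "based_g_space G X" and i: "i \<le> n"
  shows "continuous_map (spc X) (spc (smash (dspace n) X)) (wcls n X i)"
proof (rule continuous_map_from_CGWH[OF based_g_spaceD(1)[OF X]])
  fix K :: "'u set set topology" and u
  assume "test_map (spc X) K u"
  then show "continuous_map K (spc (smash (dspace n) X)) (\<lambda>k. wcls n X i (u k))"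
    unfolding test_map_def using i
    by (intro continuous_map_smash_cls inj_diagonal_sets) auto
qed (use i in auto)

lemma continuous_map_wproj:
  fixes X :: "('g, 'u) bspace"
  assumes X: "based_g_space G X"
  shows "continuous_map (spc (smash (dspace n) X)) (spc X) (wproj i X)"
proof (rule continuous_map_from_wedge)
  fix j
  show "continuous_map (spc X) (spc X) (\<lambda>x. wproj i X (wcls n X j x))"
    using based_g_spaceD(3)[OF X] by (cases "j = i \<and> i \<noteq> 0") (simp_all add: wproj_wcls del: wcls_0)
qed

text \<open>A point lies in the copy with index \<open>i\<close> iff all projections to the other
  copies send it to the base point, and base points are closed.\<close>

lemma closedin_wpart:
  fixes X :: "('g, 'u) bspace"
  assumes X: "based_g_space G X"
  shows "closedin (spc (smash (dspace n) X)) (wpart i n X)"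
proof -
  let ?S = "spc (smash (dspace n) X)"
  let ?C = "\<lambda>j. {z \<in> topspace ?S. wproj j X z \<in> {pt X}}"
  \<comment> \<open>The intersection with the whole space keeps the formula correct when the index
    set is empty.\<close>
  have "wpart i n X = (\<Inter>j\<in>{1..n} - {i}. ?C j) \<inter> topspace ?S"
  proof (rule subset_antisym; rule subsetI)
    fix z assume "z \<in> wpart i n X"
    then have z: "z \<in> topspace ?S" "z = wcls n X i (wproj i X z)" unfolding wpart_def by auto
    have "wproj j X z = pt X" if "j \<noteq> i" for j
      by (subst z(2)) (simp add: wproj_wcls that[symmetric] del: wcls_0)
    then show "z \<in> (\<Inter>j\<in>{1..n} - {i}. ?C j) \<inter> topspace ?S" using z(1) by auto
  next
    fix z assume z: "z \<in> (\<Inter>j\<in>{1..n} - {i}. ?C j) \<inter> topspace ?S"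
    then have "z \<in> topspace ?S" by simp
    then obtain j x where jx: "j \<le> n" "x \<in> pts X" "z = wcls n X j x" by (rule pts_wedgeE)
    have "z = wcls n X i (wproj i X z)"
    proof (cases "j = i \<and> i \<noteq> 0")
      case True
      then have "wproj i X z = x" unfolding jx(3) wproj_wcls by simp
      then show ?thesis using jx(3) True by simp
    next
      case False
      then have p: "wproj i X z = pt X" unfolding jx(3) wproj_wcls by auto
      have "x = pt X \<or> j = 0"
      proof (rule disjCI)
        assume "j \<noteq> 0"
        then have "j \<in> {1..n} - {i}" using False jx(1) by auto
        then have "z \<in> ?C j" using z by blast
        then show "x = pt X" unfolding jx(3) using \<open>j \<noteq> 0\<close> by (simp add: wproj_wcls)
      qed
      then have "z = pt (smash (dspace n) X)" using jx(3) by auto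
      then show ?thesis using p by simp
    qed
    then show "z \<in> wpart i n X" using z unfolding wpart_def by auto
  qed
  moreover have "closedin ?S (?C j)" for j
    by (rule closedin_continuous_map_preimage[OF continuous_map_wproj[OF X] closedin_pt[OF X]])
  then have "closedin ?S ((\<Inter>j\<in>J. ?C j) \<inter> topspace ?S)" for J :: "nat set"
  proof (cases "J = {}")
    case False
    then show ?thesis using \<open>\<And>j. closedin ?S (?C j)\<close>
      by (intro closedin_Int[OF closedin_INT closedin_topspace])
  qed simp
  ultimately show ?thesis by simp
qed

lemma wpartD: "z \<in> wpart i n X \<Longrightarrow> z = wcls n X i (wproj i X z)"
  by (simp add: wpart_def)

lemma wcls_in_wpart:
  fixes X :: "('g, 'u) bspace"
  shows "i \<le> n \<Longrightarrow> x \<in> pts X \<Longrightarrow> wcls n X i x \<in> wpart i n X"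
  by (cases "i = 0") (simp_all add: wpart_def wproj_wcls del: wcls_0, simp add: wcls_in[of 0, simplified])

text \<open>A smash product of two wedges is covered by finitely many copies of
  \<open>smash X Y\<close>. On a test space the corresponding pieces are closed, and on each of them
  the projections recover the pair in \<open>X\<close> and \<open>Y\<close> continuously. Both
  arguments here are already classes, so continuity on copies of the space could not be read off
  from index coordinates.\<close>

lemma continuous_map_from_smash_wedges:
  fixes X Y :: "('g, 'u) bspace"
  assumes X: "based_g_space G X" and Y: "based_g_space G Y"
    and c: "\<And>i j. i \<le> m \<Longrightarrow> j \<le> n \<Longrightarrow> continuous_map (spc (smash X Y)) T (c i j)"
    and h: "\<And>i j x y. i \<le> m \<Longrightarrow> j \<le> n \<Longrightarrow> x \<in> pts X \<Longrightarrow> y \<in> pts Y \<Longrightarrow>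
      h (smash_cls (smash (dspace m) X) (smash (dspace n) Y) (wcls m X i x) (wcls n Y j y))
        = c i j (smash_cls X Y x y)"
  shows "continuous_map (spc (smash (smash (dspace m) X) (smash (dspace n) Y))) T h"
proof (rule continuous_map_from_smash)
  fix K :: "('u \<times> 'u) set set topology" and a b
  let ?mX = "smash (dspace m) X" and ?nY = "smash (dspace n) Y"
  assume K: "compact_space K" "Hausdorff_space K"
    and a: "continuous_map K (spc ?mX) a" and b: "continuous_map K (spc ?nY) b"
  have pa: "continuous_map K (spc X) (\<lambda>k. wproj i X (a k))" for i
    using continuous_map_compose[OF a continuous_map_wproj[OF X]] by (simp add: comp_def)
  have pb: "continuous_map K (spc Y) (\<lambda>k. wproj j Y (b k))" for j
    using continuous_map_compose[OF b continuous_map_wproj[OF Y]] by (simp add: comp_def)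
  let ?f = "\<lambda>(i, j) k. c i j (smash_cls X Y (wproj i X (a k)) (wproj j Y (b k)))"
  let ?T = "\<lambda>(i, j). {k \<in> topspace K. a k \<in> wpart i m X} \<inter> {k \<in> topspace K. b k \<in> wpart j n Y}"
  have eq: "h (smash_cls ?mX ?nY (a k) (b k)) = ?f (i, j) k"
    if "k \<in> ?T (i, j)" "i \<le> m" "j \<le> n" for i j k
  proof -
    have "a k \<in> wpart i m X" using that(1) by simp
    then have "a k = wcls m X i (wproj i X (a k))" by (rule wpartD)
    moreover have "b k \<in> wpart j n Y" using that(1) by simp
    then have "b k = wcls n Y j (wproj j Y (b k))" by (rule wpartD)
    moreover have "wproj i X (a k) \<in> pts X" "wproj j Y (b k) \<in> pts Y"
      using continuous_map_in[OF pa] continuous_map_in[OF pb] that(1) by auto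
    ultimately show ?thesis using h[OF that(2,3)] by (metis (mono_tags, lifting) case_prod_conv)
  qed
  show "continuous_map K T (\<lambda>k. h (smash_cls ?mX ?nY (a k) (b k)))"
  proof (rule pasting_lemma_closed[where I = "{..m} \<times> {..n}" and T = ?T and f = ?f])
    fix p assume "p \<in> {..m} \<times> {..n}"
    then obtain i j where p: "p = (i, j)" "i \<le> m" "j \<le> n" by auto
    show "closedin K (?T p)" unfolding p(1) case_prod_conv
      using closedin_continuous_map_preimage[OF a closedin_wpart[OF X]]
        closedin_continuous_map_preimage[OF b closedin_wpart[OF Y]] by (rule closedin_Int)
    have "continuous_map K T (?f p)" unfolding p(1) case_prod_conv
      using continuous_map_compose[OF continuous_map_smash_cls[OF K inj_id_sets pa pb] c[OF p(2,3)]]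
      by (simp add: comp_def)
    then show "continuous_map (subtopology K (?T p)) T (?f p)"
      by (rule continuous_map_from_subtopology)
  next
    \<comment> \<open>Compatibility on overlaps is free: by \<open>eq\<close> both formulas compute
      the value of the same map \<open>h\<close>.\<close>
    fix p q k assume "p \<in> {..m} \<times> {..n}" "q \<in> {..m} \<times> {..n}" "k \<in> topspace K \<inter> ?T p \<inter> ?T q"
    then show "?f p k = ?f q k"
      using eq[of k "fst p" "snd p"] eq[of k "fst q" "snd q"] by auto
  next
    fix k assume k: "k \<in> topspace K"
    obtain i x where ix: "i \<le> m" "x \<in> pts X" "a k = wcls m X i x"
      using continuous_map_in[OF a k] by (rule pts_wedgeE)
    obtain j y where jy: "j \<le> n" "y \<in> pts Y" "b k = wcls n Y j y"
      using continuous_map_in[OF b k] by (rule pts_wedgeE)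
    have "k \<in> ?T (i, j)"
      using k ix jy wcls_in_wpart by auto
    moreover from eq[OF this ix(1) jy(1)]
    have "h (smash_cls ?mX ?nY (a k) (b k)) = ?f (i, j) k" .
    ultimately show "\<exists>p. p \<in> {..m} \<times> {..n} \<and> k \<in> ?T p \<and> h (smash_cls ?mX ?nY (a k) (b k)) = ?f p k"
      using ix(1) jy(1) by (intro exI[of _ "(i, j)"]) simp
  qed simp
next
  fix v w
  assume v: "v \<in> pts (smash (dspace m) X)" and w: "w \<in> pts (smash (dspace n) Y)"
  obtain i x where ix: "i \<le> m" "x \<in> pts X" "v = wcls m X i x"
    using v by (rule pts_wedgeE)
  obtain j y where jy: "j \<le> n" "y \<in> pts Y" "w = wcls n Y j y"
    using w by (rule pts_wedgeE)
  show "h (smash_cls (smash (dspace m) X) (smash (dspace n) Y) v w) \<in> topspace T"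
    using h[OF ix(1) jy(1) ix(2) jy(2)] continuous_map_in[OF c[OF ix(1) jy(1)] smash_cls_in[OF ix(2) jy(2)]]
      ix(3) jy(3) by simp
qed

text \<open>The homotopy is extended on each copy of \<open>X\<close> separately. All extensions
  restrict to \<open>h\<close> at the base point, so they glue, and continuity is again checked on
  the closed pieces cut out by \<open>wpart\<close>.\<close>

lemma nondegenerate_wedge:
  fixes X :: "('g, 'u) bspace"
  assumes X: "based_g_space G X" and nd: "nondegenerate G X"
  shows "nondegenerate G (smash (dspace n) X)"
  unfolding nondegenerate_def
proof (intro allI impI, elim conjE)
  fix Y :: "('u \<times> real) topology" and b f and h :: "real \<Rightarrow> 'u \<times> real"
  let ?nX = "smash (dspace n) X" and ?I = "top_of_set {0..1::real}"
  assume Y: "g_space G Y b" and f: "continuous_map (spc ?nX) Y f"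
    and fe: "\<forall>g\<in>carrier G. \<forall>x\<in>pts ?nX. f (act ?nX g x) = b g (f x)"
    and h: "continuous_map ?I Y h"
    and he: "\<forall>g\<in>carrier G. \<forall>t\<in>{0..1}. b g (h t) = h t"
    and h0: "h 0 = f (pt ?nX)"
  note XD = based_g_spaceD[OF X]
  have "\<exists>H. continuous_map (kprod (spc X) ?I) Y H \<and>
      (\<forall>g\<in>carrier G. \<forall>x\<in>pts X. \<forall>t\<in>{0..1}. H (act X g x, t) = b g (H (x, t))) \<and>
      (\<forall>x\<in>pts X. H (x, 0) = f (wcls n X i x)) \<and> (\<forall>t\<in>{0..1}. H (pt X, t) = h t)"
    if i: "i \<le> n" for i
  proof -
    have "continuous_map (spc X) Y (\<lambda>x. f (wcls n X i x))"
      using continuous_map_compose[OF continuous_map_wcls[OF X i] f] by (simp add: comp_def)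
    moreover have "\<forall>g\<in>carrier G. \<forall>x\<in>pts X. f (wcls n X i (act X g x)) = b g (f (wcls n X i x))"
      using fe wcls_in[OF i] act_wcls[OF X _ i] by metis
    moreover have "h 0 = f (wcls n X i (pt X))" using h0 by simp
    ultimately show ?thesis
      using nd[unfolded nondegenerate_def, rule_format, of Y b "\<lambda>x. f (wcls n X i x)" h] Y h he
      by blast
  qed
  then have "\<exists>HH. \<forall>i. i \<le> n \<longrightarrow> continuous_map (kprod (spc X) ?I) Y (HH i) \<and>
      (\<forall>g\<in>carrier G. \<forall>x\<in>pts X. \<forall>t\<in>{0..1}. HH i (act X g x, t) = b g (HH i (x, t))) \<and>
      (\<forall>x\<in>pts X. HH i (x, 0) = f (wcls n X i x)) \<and> (\<forall>t\<in>{0..1}. HH i (pt X, t) = h t)"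
    by (intro choice allI) blast
  then obtain HH where HH: "\<And>i. i \<le> n \<Longrightarrow> continuous_map (kprod (spc X) ?I) Y (HH i)"
    "\<And>i g x t. i \<le> n \<Longrightarrow> g \<in> carrier G \<Longrightarrow> x \<in> pts X \<Longrightarrow> t \<in> {0..1} \<Longrightarrow>
      HH i (act X g x, t) = b g (HH i (x, t))"
    "\<And>i x. i \<le> n \<Longrightarrow> x \<in> pts X \<Longrightarrow> HH i (x, 0) = f (wcls n X i x)"
    "\<And>i t. i \<le> n \<Longrightarrow> t \<in> {0..1} \<Longrightarrow> HH i (pt X, t) = h t"
    by blast
  define H where "H = (\<lambda>(z, t). HH (inv_into UNIV unat (ufst z)) (usnd z, t))"
  \<comment> \<open>The representative of the base point has index 0 whatever \<open>i\<close> it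
    came from, so \<open>H\<close> evaluates \<open>HH 0\<close> there; this agrees with
    \<open>HH i\<close> since both give \<open>h t\<close>.\<close>
  have H: "H (wcls n X i x, t) = HH i (if i = 0 then pt X else x, t)"
    if "i \<le> n" "t \<in> {0..1}" for i x t
    using that HH(4) unfolding H_def by (auto simp: smash_cls_def simp flip: wcls_0[of n X x])
  show "\<exists>H. continuous_map (kprod (spc ?nX) ?I) Y H \<and>
      (\<forall>g\<in>carrier G. \<forall>x\<in>pts ?nX. \<forall>t\<in>{0..1}. H (act ?nX g x, t) = b g (H (x, t))) \<and>
      (\<forall>x\<in>pts ?nX. H (x, 0) = f x) \<and> (\<forall>t\<in>{0..1}. H (pt ?nX, t) = h t)"
  proof (intro exI[of _ H] conjI ballI)
    fix z assume "z \<in> pts ?nX"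
    then obtain i x where ix: "i \<le> n" "x \<in> pts X" "z = wcls n X i x" by (rule pts_wedgeE)
    show "H (z, 0) = f z"
      using HH(3)[OF ix(1), of "if i = 0 then pt X else x"] ix XD(3) H[OF ix(1), of 0 x] by auto
    fix g t assume g: "g \<in> carrier G" and t: "t \<in> {0..1::real}"
    show "H (act ?nX g z, t) = b g (H (z, t))"
      unfolding ix(3) act_wcls[OF X g ix(1,2)] H[OF ix(1) t]
      using HH(2)[OF ix(1) g _ t, of "if i = 0 then pt X else x"] ix(2) XD(3) XD(5)[OF g]
      by (cases "i = 0") simp_all
  next
    fix t assume t: "t \<in> {0..1::real}"
    show "H (pt ?nX, t) = h t"
      using H[of 0 t "pt X"] HH(4)[of 0 t] t by simp
  next
    show "continuous_map (kprod (spc ?nX) ?I) Y H"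
    proof (rule continuous_map_from_kprod)
      fix K :: "('u \<times> real) set set topology" and a s
      assume K: "compact_space K" "Hausdorff_space K"
        and a: "continuous_map K (spc ?nX) a" and s: "continuous_map K ?I s"
      have pa: "continuous_map K (spc X) (\<lambda>k. wproj i X (a k))" for i
        using continuous_map_compose[OF a continuous_map_wproj[OF X]] by (simp add: comp_def)
      let ?f = "\<lambda>i k. HH i (wproj i X (a k), s k)"
      let ?T = "\<lambda>i. {k \<in> topspace K. a k \<in> wpart i n X}"
      have sI: "s k \<in> {0..1}" if "k \<in> topspace K" for k
        using continuous_map_in[OF s that] by simp
      \<comment> \<open>Matches the exceptional value in \<open>H\<close> for index 0.\<close>
      have w0: "wproj 0 X (a k) = pt X" if k: "k \<in> topspace K" for k
      proof -
        obtain i x where "a k = wcls n X i x"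
          using continuous_map_in[OF a k] by (rule pts_wedgeE)
        then show ?thesis by (simp add: wproj_wcls)
      qed
      have eq: "H (a k, s k) = ?f i k" if k: "k \<in> ?T i" and i: "i \<le> n" for i k
      proof -
        have "a k \<in> wpart i n X" using k by simp
        then have "a k = wcls n X i (wproj i X (a k))" by (rule wpartD)
        then have "H (a k, s k) = H (wcls n X i (wproj i X (a k)), s k)" by simp
        also have "\<dots> = HH i (if i = 0 then pt X else wproj i X (a k), s k)"
          by (rule H[OF i]) (use k sI in auto)
        finally show ?thesis using w0 k by (auto split: if_splits)
      qed
      show "continuous_map K Y (\<lambda>k. H (a k, s k))"
      proof (rule pasting_lemma_closed[where I = "{..n}" and T = ?T and f = ?f])
        fix i assume i: "i \<in> {..n}"
        show "closedin K (?T i)"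
          by (rule closedin_continuous_map_preimage[OF a closedin_wpart[OF X]])
        have "continuous_map K (kprod (spc X) ?I) (\<lambda>k. (wproj i X (a k), s k))"
          using continuous_map_into_kprod[OF K inj_id_sets] pa s by simp
        from continuous_map_compose[OF this HH(1)] i
        show "continuous_map (subtopology K (?T i)) Y (?f i)"
          by (intro continuous_map_from_subtopology) (simp add: comp_def)
      next
        fix i j k assume "i \<in> {..n}" "j \<in> {..n}" "k \<in> topspace K \<inter> ?T i \<inter> ?T j"
        then show "?f i k = ?f j k" using eq[of k i] eq[of k j] by auto
      next
        fix k assume k: "k \<in> topspace K"
        obtain i x where ix: "i \<le> n" "x \<in> pts X" "a k = wcls n X i x"
          using continuous_map_in[OF a k] by (rule pts_wedgeE)
        then have "k \<in> ?T i" using k wcls_in_wpart by auto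
        then show "\<exists>i. i \<in> {..n} \<and> k \<in> ?T i \<and> H (a k, s k) = ?f i k"
          using eq[of k i] ix(1) by (intro exI[of _ i]) simp
      qed simp
    next
      fix z t assume z: "z \<in> topspace (spc ?nX)" and t: "t \<in> topspace ?I"
      obtain i x where ix: "i \<le> n" "x \<in> pts X" "z = wcls n X i x" using z by (rule pts_wedgeE)
      show "H (z, t) \<in> topspace Y"
        using continuous_map_in[OF HH(1)[OF ix(1)], of "(if i = 0 then pt X else x, t)"] H[OF ix(1), of t x] ix XD(3) t
        by (auto split: if_splits)
    qed
  qed
qed

end

section \<open>The category of based \<open>G\<close>-spaces\<close>

abbreviation gcomp :: "('g, 'r) monoid_scheme \<Rightarrow> ('g, 'u) bmap \<Rightarrow> ('g, 'u) bmap \<Rightarrow> ('g, 'u) bmap" where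
  "gcomp G \<equiv> Comp (GTop G)"

lemma GTop_simps [simp]:
  "Obj (GTop G) = {X. based_g_space G X}" "Hom (GTop G) = based_g_maps G"
  "Ten (GTop G) = smash" "TenA (GTop G) = smash_map" "Unit (GTop G) = dspace 1"
  by (simp_all add: GTop_def)

lemma GT_simps [simp]:
  "Obj (GT G) = {X. based_g_space G X \<and> nondegenerate G X}" "Hom (GT G) = based_g_maps G"
  "Ident (GT G) = Ident (GTop G)" "Comp (GT G) = Comp (GTop G)"
  "Ten (GT G) = smash" "TenA (GT G) = smash_map" "Unit (GT G) = dspace 1"
  "Assoc (GT G) = Assoc (GTop G)" "LUnit (GT G) = LUnit (GTop G)"
  "RUnit (GT G) = RUnit (GTop G)" "Braid (GT G) = Braid (GTop G)"
  by (simp_all add: GT_def GTop_def)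

lemma based_g_mapsD:
  assumes "f \<in> based_g_maps G X Y"
  shows "src f = X" "tgt f = Y" "based_g_space G X" "based_g_space G Y"
    "mor f \<in> extensional (pts X)" "continuous_map (spc X) (spc Y) (mor f)" "mor f (pt X) = pt Y"
    "g \<in> carrier G \<Longrightarrow> x \<in> pts X \<Longrightarrow> mor f (act X g x) = act Y g (mor f x)"
    "x \<in> pts X \<Longrightarrow> mor f x \<in> pts Y"
  using assms continuous_map_in[of "spc X" "spc Y" "mor f" x]
  unfolding based_g_maps_def by blast+

lemma based_g_maps_eqI:
  assumes "f \<in> based_g_maps G X Y" "f' \<in> based_g_maps G X Y"
    and "\<And>x. x \<in> pts X \<Longrightarrow> mor f x = mor f' x"
  shows "f = f'"
proof -
  have "mor f = mor f'"
    using based_g_mapsD(5)[OF assms(1)] based_g_mapsD(5)[OF assms(2)] assms(3)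
    by (rule extensionalityI)
  then show ?thesis
    using based_g_mapsD(1,2)[OF assms(1)] based_g_mapsD(1,2)[OF assms(2)]
    by (intro arrow.equality) simp_all
qed

lemma bmap_in:
  assumes "based_g_space G X" "based_g_space G Y" "continuous_map (spc X) (spc Y) f" "f (pt X) = pt Y"
    and "\<And>g x. g \<in> carrier G \<Longrightarrow> x \<in> pts X \<Longrightarrow> f (act X g x) = act Y g (f x)"
  shows "bmap X Y f \<in> based_g_maps G X Y"
proof -
  have "continuous_map (spc X) (spc Y) (restrict f (pts X))"
    using assms(3) by (rule continuous_map_eq) simp
  then show ?thesis
    using assms based_g_spaceD(3,4)[OF assms(1)] by (simp add: based_g_maps_def bmap_def)
qed

lemma mor_bmap: "x \<in> pts X \<Longrightarrow> mor (bmap X Y f) x = f x"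
  and src_bmap [simp]: "src (bmap X Y f) = X" and tgt_bmap [simp]: "tgt (bmap X Y f) = Y"
  by (simp_all add: bmap_def)

lemma GTop_Comp: "gcomp G g f = bmap (src f) (tgt g) (mor g \<circ> mor f)"
  by (simp add: GTop_def)

lemma gcomp_in:
  assumes f: "f \<in> based_g_maps G X Y" and g: "g \<in> based_g_maps G Y Z"
  shows "gcomp G g f \<in> based_g_maps G X Z"
  unfolding GTop_Comp based_g_mapsD(1)[OF f] based_g_mapsD(2)[OF g]
  using based_g_mapsD[OF f] based_g_mapsD[OF g]
  by (intro bmap_in continuous_map_compose) simp_all

lemma mor_gcomp:
  assumes f: "f \<in> based_g_maps G X Y" and "x \<in> pts X"
  shows "mor (gcomp G g f) x = mor g (mor f x)"
  using based_g_mapsD(1)[OF f] assms(2) by (simp add: GTop_Comp mor_bmap)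

lemma gident_in: "based_g_space G X \<Longrightarrow> Ident (GTop G) X \<in> based_g_maps G X X"
  by (simp add: GTop_def bmap_in)

lemma mor_gident: "x \<in> pts X \<Longrightarrow> mor (Ident (GTop G) X) x = x"
  by (simp add: GTop_def mor_bmap)

lemma gcomp_assoc:
  assumes f: "f \<in> based_g_maps G X Y" and g: "g \<in> based_g_maps G Y Z" and h: "h \<in> based_g_maps G Z W"
  shows "gcomp G h (gcomp G g f) = gcomp G (gcomp G h g) f"
  by (rule based_g_maps_eqI[OF gcomp_in[OF gcomp_in[OF f g] h] gcomp_in[OF f gcomp_in[OF g h]]])
     (simp add: mor_gcomp[OF f] mor_gcomp[OF g] mor_gcomp[OF gcomp_in[OF f g]] based_g_mapsD(9)[OF f])

lemma gcomp_ident: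
  assumes f: "f \<in> based_g_maps G X Y"
  shows "gcomp G f (Ident (GTop G) X) = f" "gcomp G (Ident (GTop G) Y) f = f"
proof -
  note i = gident_in[OF based_g_mapsD(3)[OF f]] gident_in[OF based_g_mapsD(4)[OF f]]
  show "gcomp G f (Ident (GTop G) X) = f"
    by (rule based_g_maps_eqI[OF gcomp_in[OF i(1) f] f]) (simp add: mor_gcomp[OF i(1)] mor_gident)
  show "gcomp G (Ident (GTop G) Y) f = f"
    by (rule based_g_maps_eqI[OF gcomp_in[OF f i(2)] f])
       (simp add: mor_gcomp[OF f] mor_gident based_g_mapsD(9)[OF f])
qed

lemma category_GT: "category (GT G)"
  unfolding category_def GT_simps
  by (intro conjI ballI gcomp_in gcomp_ident gcomp_assoc) (auto intro: gident_in)

context gspaces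
begin

text \<open>Well-definedness on classes: based maps send the wedge into the wedge. The suffix
  \<open>raw\<close> marks such formulas before they are restricted to the points of the
  source.\<close>

lemma smash_map_raw:
  fixes X Y X' Y' :: "('g, 'u) bspace"
  assumes "f \<in> based_g_maps G X X'" "f' \<in> based_g_maps G Y Y'" "x \<in> pts X" "y \<in> pts Y"
  shows "smash_cls X' Y' (mor f (ufst (smash_cls X Y x y))) (mor f' (usnd (smash_cls X Y x y)))
    = smash_cls X' Y' (mor f x) (mor f' y)"
  by (rule smash_cls_elim) (use based_g_mapsD(7)[OF assms(1)] based_g_mapsD(7)[OF assms(2)] in auto)

lemma mor_smash_map:
  fixes X Y X' Y' :: "('g, 'u) bspace"
  assumes "f \<in> based_g_maps G X X'" "f' \<in> based_g_maps G Y Y'" "x \<in> pts X" "y \<in> pts Y"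
  shows "mor (smash_map f f') (smash_cls X Y x y) = smash_cls X' Y' (mor f x) (mor f' y)"
  using smash_map_raw[OF assms] assms(3,4) based_g_mapsD(1,2)[OF assms(1)] based_g_mapsD(1,2)[OF assms(2)]
  by (simp add: smash_map_def mor_bmap)

lemma bmap_smash_in:
  fixes X Y Z :: "('g, 'u) bspace"
  assumes X: "based_g_space G X" and Y: "based_g_space G Y" and Z: "based_g_space G Z"
    and c: "continuous_map (spc (smash X Y)) (spc Z) h"
    and p: "h (smash_cls X Y (pt X) (pt Y)) = pt Z"
    and e: "\<And>g x y. g \<in> carrier G \<Longrightarrow> x \<in> pts X \<Longrightarrow> y \<in> pts Y \<Longrightarrow>
      h (smash_cls X Y (act X g x) (act Y g y)) = act Z g (h (smash_cls X Y x y))"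
  shows "bmap (smash X Y) Z h \<in> based_g_maps G (smash X Y) Z"
proof (rule bmap_in[OF based_g_space_smash[OF X Y] Z c])
  show "h (pt (smash X Y)) = pt Z" using p by simp
  fix g v assume g: "g \<in> carrier G" and "v \<in> pts (smash X Y)"
  then obtain x y where xy: "x \<in> pts X" "y \<in> pts Y" "v = smash_cls X Y x y" by (elim pts_smashE)
  show "h (act (smash X Y) g v) = act Z g (h v)"
    unfolding xy(3) act_smash[OF X Y g xy(1,2)] by (rule e[OF g xy(1,2)])
qed

lemma smash_map_in [simp, intro]:
  fixes X Y X' Y' :: "('g, 'u) bspace"
  assumes f: "f \<in> based_g_maps G X X'" and f': "f' \<in> based_g_maps G Y Y'"
  shows "smash_map f f' \<in> based_g_maps G (smash X Y) (smash X' Y')"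
proof -
  note fD = based_g_mapsD[OF f] and f'D = based_g_mapsD[OF f'] and raw = smash_map_raw[OF f f']
  show ?thesis
    unfolding smash_map_def fD(1,2) f'D(1,2)
  proof (rule bmap_smash_in[OF fD(3) f'D(3) based_g_space_smash[OF fD(4) f'D(4)]])
    show "continuous_map (spc (smash X Y)) (spc (smash X' Y'))
        (\<lambda>z. smash_cls X' Y' (mor f (ufst z)) (mor f' (usnd z)))"
    proof (rule continuous_map_from_smash)
      fix K :: "('u \<times> 'u) set set topology" and a b
      assume K: "compact_space K" "Hausdorff_space K"
        and a: "continuous_map K (spc X) a" and b: "continuous_map K (spc Y) b"
      have "continuous_map K (spc (smash X' Y')) (\<lambda>k. smash_cls X' Y' (mor f (a k)) (mor f' (b k)))"
        using continuous_map_compose[OF a fD(6)] continuous_map_compose[OF b f'D(6)]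
        by (intro continuous_map_smash_cls[OF K inj_id_sets]) (simp_all add: comp_def)
      then show "continuous_map K (spc (smash X' Y')) (\<lambda>k. smash_cls X' Y'
          (mor f (ufst (smash_cls X Y (a k) (b k)))) (mor f' (usnd (smash_cls X Y (a k) (b k)))))"
        by (rule continuous_map_eq) (simp add: raw continuous_map_in[OF a] continuous_map_in[OF b])
    qed (simp add: raw fD f'D)
  qed (simp_all add: raw fD(7,8,9) f'D(7,8,9) based_g_spaceD(3,4)[OF fD(3)] based_g_spaceD(3,4)[OF f'D(3)]
      based_g_spaceD(3)[OF fD(4)] act_smash[OF fD(4) f'D(4)] del: smash_cls_pt, simp)
qed

text \<open>If any of the three coordinates is a base point, both sides collapse to the base point;
  otherwise all classes are represented by plain codes of pairs.\<close>

lemma assoc_raw: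
  fixes X Y Z :: "('g, 'u) bspace"
  defines "\<alpha> \<equiv> \<lambda>w. smash_cls X (smash Y Z) (ufst (ufst w)) (smash_cls Y Z (usnd (ufst w)) (usnd w))"
  shows "\<alpha> (smash_cls (smash X Y) Z (smash_cls X Y x y) z) = smash_cls X (smash Y Z) x (smash_cls Y Z y z)"
  unfolding \<alpha>_def
  by (cases "x = pt X"; cases "y = pt Y"; cases "z = pt Z") (simp_all add: pt_smash smash_cls_def)

text \<open>This is where cartesian closedness of compactly generated spaces enters: \<open>(X \<and> Y) \<times> Z\<close>
  carries the quotient topology of \<open>(X \<times> Y) \<times> Z\<close>. Tested on a compact space, this amounts to the
  tube lemma.\<close>

lemma continuous_map_assoc:
  fixes X Y Z :: "('g, 'u) bspace"
  assumes X: "based_g_space G X" and Y: "based_g_space G Y" and Z: "based_g_space G Z"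
  shows "continuous_map (spc (smash (smash X Y) Z)) (spc (smash X (smash Y Z)))
    (\<lambda>w. smash_cls X (smash Y Z) (ufst (ufst w)) (smash_cls Y Z (usnd (ufst w)) (usnd w)))"
    (is "continuous_map _ ?T ?\<alpha>")
proof (rule continuous_map_from_smash)
  fix K :: "('u \<times> 'u) set set topology" and u v
  assume K: "compact_space K" "Hausdorff_space K"
    and u: "continuous_map K (spc (smash X Y)) u" and v: "continuous_map K (spc Z) v"
  let ?c = "smash_cls (smash X Y) Z"
  let ?F = "\<lambda>k. ?\<alpha> (?c (u k) (v k))"
  have cls: "continuous_map L ?T (\<lambda>l. smash_cls X (smash Y Z) (a l) (smash_cls Y Z (b l) (c l)))"
    if "compact_space L" "Hausdorff_space L" "\<exists>j :: 'l \<Rightarrow> ('u \<times> 'u) set set. inj j"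
      "continuous_map L (spc X) a" "continuous_map L (spc Y) b" "continuous_map L (spc Z) c"
    for L :: "'l topology" and a b c
    using that by (intro continuous_map_smash_cls)
  have tgt: "?\<alpha> (?c p z) \<in> topspace ?T" if "p \<in> pts (smash X Y)" "z \<in> pts Z" for p z
    using that by (elim pts_smashE) (simp add: assoc_raw)
  show "continuous_map K ?T ?F"
    unfolding continuous_map_def
  proof (intro conjI allI impI)
    show "?F \<in> topspace K \<rightarrow> topspace ?T"
      using tgt continuous_map_in[OF u] continuous_map_in[OF v] by blast
    fix W assume W: "openin ?T W"
    show "openin K {k \<in> topspace K. ?F k \<in> W}"
    proof (subst openin_subopen, rule ballI)
      fix k0 assume "k0 \<in> {k \<in> topspace K. ?F k \<in> W}"
      then have k0: "k0 \<in> topspace K" "?F k0 \<in> W" by auto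
      obtain x0 y0 where xy: "x0 \<in> pts X" "y0 \<in> pts Y" "u k0 = smash_cls X Y x0 y0"
        using continuous_map_in[OF u k0(1)] by (rule pts_smashE)
      \<comment> \<open>With \<open>u k0\<close> frozen the first two coordinates are the constants
        \<open>x0\<close> and \<open>y0\<close>, so no lift of \<open>u\<close> is required for
        continuity in \<open>k\<close>.\<close>
      have "continuous_map K ?T (\<lambda>k. ?\<alpha> (?c (u k0) (v k)))"
        unfolding xy(3) assoc_raw using cls[OF K inj_id_sets _ _ v] xy(1,2) by simp
      from openin_continuous_map_preimage[OF this W]
      have op: "openin K {k \<in> topspace K. ?\<alpha> (?c (u k0) (v k)) \<in> W}" .
      have mem: "k0 \<in> {k \<in> topspace K. ?\<alpha> (?c (u k0) (v k)) \<in> W}" using k0 by simp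
      obtain V N where VN: "openin K V" "closedin K N" "k0 \<in> V" "V \<subseteq> N"
        "N \<subseteq> {k \<in> topspace K. ?\<alpha> (?c (u k0) (v k)) \<in> W}"
        by (rule compact_Hausdorff_closed_neighbourhood[OF K op mem])
      \<comment> \<open>The tube: all classes whose whole slice over the compact set
        \<open>N\<close> is sent into \<open>W\<close>. Once it is known to be open, its preimage
        under \<open>u\<close>, cut down to \<open>V\<close>, is the desired neighbourhood of
        \<open>k0\<close>.\<close>
      define Q where "Q = {p \<in> pts (smash X Y). \<forall>k\<in>N. ?\<alpha> (?c p (v k)) \<in> W}"
      have "openin (spc (smash X Y)) Q"
      proof -
        let ?q = "\<lambda>(x, y). smash_cls X Y x y"
        let ?P = "prod_topology (spc X) (spc Y)"
        let ?R = "{p \<in> topspace ?P. ?q p \<in> Q}"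
        have "compactly_closed ?P (topspace ?P - ?R)"
          unfolding compactly_closed_def
        proof (intro conjI allI impI)
          fix L :: "('u \<times> 'u) set set topology" and w
          assume "test_map ?P L w"
          then have L: "compact_space L" "Hausdorff_space L" and w: "continuous_map L ?P w"
            and a: "continuous_map L (spc X) (\<lambda>l. fst (w l))" and b: "continuous_map L (spc Y) (\<lambda>l. snd (w l))"
            by (simp_all add: test_map_def continuous_map_pairwise comp_def)
          let ?LK = "prod_topology L K"
          \<comment> \<open>Over a test space \<open>L\<close> of the ordinary product
            \<open>X\<close> times \<open>Y\<close> the first two coordinates are available as maps,
            which turns the associated class into a continuous function on \<open>L\<close> times
            \<open>K\<close>.\<close>
          let ?G = "\<lambda>p. smash_cls X (smash Y Z) (fst (w (fst p))) (smash_cls Y Z (snd (w (fst p))) (v (snd p)))"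
          have LK: "compact_space ?LK" "Hausdorff_space ?LK"
            using L K by (simp_all add: compact_space_prod_topology Hausdorff_space_prod_topology)
          have "infinite (UNIV :: ('u \<times> 'u) set)" using inf by (simp add: finite_prod)
          from cls[OF LK inj_product_sets[OF this]
              continuous_map_compose[OF continuous_map_fst a] continuous_map_compose[OF continuous_map_fst b]
              continuous_map_compose[OF continuous_map_snd v]]
          have G: "continuous_map ?LK ?T ?G" by (simp add: comp_def)
          \<comment> \<open>The bad pairs. Projecting this closed set along the compact factor
            \<open>K\<close> gives exactly the points of \<open>L\<close> outside the preimage of
            the tube.\<close>
          let ?E = "{p \<in> topspace ?LK. ?G p \<in> topspace ?T - W} \<inter> topspace L \<times> N"
          have "closedin ?LK ?E"
            using closedin_continuous_map_preimage[OF G closedin_diff[OF closedin_topspace W]] VN(2)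
            by (intro closedin_Int) (simp_all add: closedin_prod_Times_iff)
          then have "closedin L (fst ` ?E)"
            using closed_map_fst[OF K(1)] unfolding closed_map_def by blast
          moreover have "fst ` ?E = {l \<in> topspace L. w l \<in> topspace ?P - ?R}"
          proof (rule subset_antisym; rule subsetI)
            fix l assume "l \<in> fst ` ?E"
            then obtain k where k: "l \<in> topspace L" "k \<in> N" "?G (l, k) \<notin> W" by auto
            have "smash_cls X Y (fst (w l)) (snd (w l)) \<notin> Q"
              using k(2,3) unfolding Q_def by (auto simp: assoc_raw)
            then show "l \<in> {l \<in> topspace L. w l \<in> topspace ?P - ?R}"
              using k(1) continuous_map_in[OF w k(1)] by (simp add: case_prod_unfold)
          next
            fix l assume "l \<in> {l \<in> topspace L. w l \<in> topspace ?P - ?R}"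
            then have l: "l \<in> topspace L" and n: "?q (w l) \<notin> Q" by auto
            have "?q (w l) \<in> pts (smash X Y)"
              using continuous_map_in[OF a l] continuous_map_in[OF b l] by (simp add: case_prod_unfold)
            then obtain k where k: "k \<in> N" "?\<alpha> (?c (?q (w l)) (v k)) \<notin> W"
              using n unfolding Q_def by blast
            have "k \<in> topspace K" using k(1) closedin_subset[OF VN(2)] by blast
            moreover from this have "?G (l, k) \<in> topspace ?T"
              using continuous_map_in[OF G, of "(l, k)"] l by simp
            moreover have "?G (l, k) \<notin> W" using k(2) by (simp add: case_prod_unfold assoc_raw)
            ultimately show "l \<in> fst ` ?E" using l k(1) by (intro image_eqI[of _ _ "(l, k)"]) simp_all
          qed
          ultimately show "closedin L {l \<in> topspace L. w l \<in> topspace ?P - ?R}" by simp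
        qed simp
        then have "openin (kprod (spc X) (spc Y)) ?R"
          unfolding kprod_def openin_kify by (intro conjI Collect_restrict)
        moreover have "Q \<subseteq> ?q ` topspace (kprod (spc X) (spc Y))"
          unfolding Q_def pts_smash by auto
        ultimately show ?thesis unfolding spc_smash openin_quot by simp
      qed
      from openin_Int[OF openin_continuous_map_preimage[OF u this] VN(1)]
      have "openin K ({k \<in> topspace K. u k \<in> Q} \<inter> V)" .
      moreover have "k0 \<in> {k \<in> topspace K. u k \<in> Q} \<inter> V"
        using k0(1) VN(3,5) continuous_map_in[OF u k0(1)] unfolding Q_def by auto
      moreover have "{k \<in> topspace K. u k \<in> Q} \<inter> V \<subseteq> {k \<in> topspace K. ?F k \<in> W}"
        using VN(4) unfolding Q_def by auto
      ultimately show "\<exists>S. openin K S \<and> k0 \<in> S \<and> S \<subseteq> {k \<in> topspace K. ?F k \<in> W}"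
        by (intro exI conjI)
    qed
  qed
next
  fix p z assume "p \<in> pts (smash X Y)" "z \<in> pts Z"
  then show "?\<alpha> (smash_cls (smash X Y) Z p z) \<in> topspace ?T"
    by (elim pts_smashE) (simp add: assoc_raw)
qed

lemma Assoc_in:
  fixes X Y Z :: "('g, 'u) bspace"
  assumes X: "based_g_space G X" and Y: "based_g_space G Y" and Z: "based_g_space G Z"
  shows "Assoc (GTop G) X Y Z \<in> based_g_maps G (smash (smash X Y) Z) (smash X (smash Y Z))"
    (is "_ \<in> based_g_maps G _ ?T")
proof -
  let ?\<alpha> = "\<lambda>w. smash_cls X (smash Y Z) (ufst (ufst w)) (smash_cls Y Z (usnd (ufst w)) (usnd w))"
  note XY = based_g_space_smash[OF X Y] and YZ = based_g_space_smash[OF Y Z]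
  have "bmap (smash (smash X Y) Z) ?T ?\<alpha> \<in> based_g_maps G (smash (smash X Y) Z) ?T"
  proof (rule bmap_smash_in[OF XY Z based_g_space_smash[OF X YZ] continuous_map_assoc[OF X Y Z]])
    show "?\<alpha> (smash_cls (smash X Y) Z (pt (smash X Y)) (pt Z)) = pt ?T"
      using assoc_raw[of X Y Z "pt X" "pt Y" "pt Z"] by simp
    fix g p z assume g: "g \<in> carrier G" and z: "z \<in> pts Z" and "p \<in> pts (smash X Y)"
    then obtain x y where xy: "x \<in> pts X" "y \<in> pts Y" "p = smash_cls X Y x y" by (elim pts_smashE)
    show "?\<alpha> (smash_cls (smash X Y) Z (act (smash X Y) g p) (act Z g z))
        = act ?T g (?\<alpha> (smash_cls (smash X Y) Z p z))"
      unfolding xy(3) act_smash[OF X Y g xy(1,2)] assoc_raw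
        act_smash[OF X YZ g xy(1) smash_cls_in[OF xy(2) z]] act_smash[OF Y Z g xy(2) z] ..
  qed
  then show ?thesis by (simp add: GTop_def)
qed

lemma mor_Assoc:
  fixes X Y Z :: "('g, 'u) bspace"
  assumes "x \<in> pts X" "y \<in> pts Y" "z \<in> pts Z"
  shows "mor (Assoc (GTop G) X Y Z) (smash_cls (smash X Y) Z (smash_cls X Y x y) z)
    = smash_cls X (smash Y Z) x (smash_cls Y Z y z)"
  using assms by (simp add: GTop_def mor_bmap assoc_raw)

section \<open>Unit and braiding isomorphisms\<close>

lemma usnd_wcls:
  fixes X :: "('g, 'u) bspace"
  shows "i \<le> 1 \<Longrightarrow> usnd (wcls 1 X i x) = (if i = 0 then pt X else x)"
  by (cases "i = 0") (simp_all add: smash_cls_def pt_smash)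

lemma continuous_map_usnd:
  fixes X :: "('g, 'u) bspace"
  assumes X: "based_g_space G X"
  shows "continuous_map (spc (smash (dspace 1) X)) (spc X) usnd"
proof (rule continuous_map_from_wedge)
  fix i :: nat assume "i \<le> 1"
  then show "continuous_map (spc X) (spc X) (\<lambda>x. usnd (wcls 1 X i x))"
    using based_g_spaceD(3)[OF X] unfolding usnd_wcls[OF \<open>i \<le> 1\<close>] by (cases "i = 0") simp_all
qed

lemma LUnit_in:
  fixes X :: "('g, 'u) bspace"
  assumes X: "based_g_space G X"
  shows "LUnit (GTop G) X \<in> based_g_maps G (smash (dspace 1) X) X"
proof -
  have "bmap (smash (dspace 1) X) X usnd \<in> based_g_maps G (smash (dspace 1) X) X"
  proof (rule bmap_smash_in[OF based_g_space_dspace X X continuous_map_usnd[OF X]])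
    show "usnd (smash_cls (dspace 1) X (pt (dspace 1)) (pt X)) = pt X"
      using usnd_wcls[of 0 X "pt X"] by simp
    fix g y x assume g: "g \<in> carrier G" and x: "x \<in> pts X" and "y \<in> pts (dspace 1 :: ('g, 'u) bspace)"
    then obtain i where i: "i \<le> 1" "y = unat i" by auto
    show "usnd (smash_cls (dspace 1) X (act (dspace 1) g y) (act X g x))
        = act X g (usnd (smash_cls (dspace 1) X y x))"
      unfolding i(2) act_dspace[OF i(1)] usnd_wcls[OF i(1)] using based_g_spaceD(5)[OF X g] by simp
  qed
  then show ?thesis by (simp add: GTop_def)
qed

lemma mor_LUnit:
  fixes X :: "('g, 'u) bspace"
  assumes "i \<le> 1" "x \<in> pts X"
  shows "mor (LUnit (GTop G) X) (wcls 1 X i x) = (if i = 0 then pt X else x)"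
  using usnd_wcls[OF assms(1), of X x] wcls_in[OF assms]
  by (simp add: GTop_def mor_bmap del: wcls_0)

lemma ufst_rcls:
  fixes X :: "('g, 'u) bspace"
  shows "ufst (smash_cls X (dspace 1) x (unat i)) = (if i = 0 then pt X else x)"
  by (cases "i = 0") (simp_all add: smash_cls_def)

lemma RUnit_in:
  fixes X :: "('g, 'u) bspace"
  assumes X: "based_g_space G X"
  shows "RUnit (GTop G) X \<in> based_g_maps G (smash X (dspace 1)) X"
proof -
  have "bmap (smash X (dspace 1)) X ufst \<in> based_g_maps G (smash X (dspace 1)) X"
  proof (rule bmap_smash_in[OF X based_g_space_dspace X])
    show "ufst (smash_cls X (dspace 1) (pt X) (pt (dspace 1))) = pt X"
      using ufst_rcls[of X "pt X" 0] by simp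
    fix g y x assume g: "g \<in> carrier G" and x: "x \<in> pts X" and "y \<in> pts (dspace 1 :: ('g, 'u) bspace)"
    then obtain i where i: "i \<le> 1" "y = unat i" by auto
    show "ufst (smash_cls X (dspace 1) (act X g x) (act (dspace 1) g y))
        = act X g (ufst (smash_cls X (dspace 1) x y))"
      unfolding i(2) act_dspace[OF i(1)] ufst_rcls using based_g_spaceD(5)[OF X g] by simp
  next
    show "continuous_map (spc (smash X (dspace 1))) (spc X) ufst"
    proof (rule continuous_map_from_smash)
      fix K :: "('u \<times> 'u) set set topology" and a b
      assume K: "compact_space K" "Hausdorff_space K"
        and a: "continuous_map K (spc X) a"
        and b: "continuous_map K (spc (dspace 1 :: ('g, 'u) bspace)) b"
      \<comment> \<open>Gluing over finite wedges was set up with the discrete factor on the left;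
        on a test space the two coordinates are exchanged to reduce to that case.\<close>
      have "continuous_map K (spc X) (\<lambda>k. usnd (smash_cls (dspace 1) X (b k) (a k)))"
        using continuous_map_compose[OF continuous_map_smash_cls[OF K inj_id_sets b a]
            continuous_map_usnd[OF X]] by (simp add: comp_def)
      then show "continuous_map K (spc X) (\<lambda>k. ufst (smash_cls X (dspace 1) (a k) (b k)))"
      proof (rule continuous_map_eq)
        fix k assume "k \<in> topspace K"
        then obtain i where i: "i \<le> 1" "b k = unat i" using continuous_map_in[OF b] by auto
        show "usnd (smash_cls (dspace 1) X (b k) (a k)) = ufst (smash_cls X (dspace 1) (a k) (b k))"
          unfolding i(2) usnd_wcls[OF i(1)] ufst_rcls ..
      qed
    next
      fix x y assume x: "x \<in> pts X" and "y \<in> pts (dspace 1 :: ('g, 'u) bspace)"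
      then obtain i where i: "y = unat i" by auto
      show "ufst (smash_cls X (dspace 1) x y) \<in> topspace (spc X)"
        unfolding i ufst_rcls using x based_g_spaceD(3)[OF X] by simp
    qed
  qed
  then show ?thesis by (simp add: GTop_def)
qed

lemma mor_RUnit:
  fixes X :: "('g, 'u) bspace"
  assumes "i \<le> 1" "x \<in> pts X"
  shows "mor (RUnit (GTop G) X) (smash_cls X (dspace 1) x (unat i)) = (if i = 0 then pt X else x)"
  using ufst_rcls[of X x i] smash_cls_in[OF assms(2), of "unat i" "dspace 1"] assms(1)
  by (simp add: GTop_def mor_bmap)

lemma braid_raw:
  fixes X Y :: "('g, 'u) bspace"
  shows "smash_cls Y X (usnd (smash_cls X Y x y)) (ufst (smash_cls X Y x y)) = smash_cls Y X y x"
  by (auto simp: smash_cls_def)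

lemma Braid_in:
  fixes X Y :: "('g, 'u) bspace"
  assumes X: "based_g_space G X" and Y: "based_g_space G Y"
  shows "Braid (GTop G) X Y \<in> based_g_maps G (smash X Y) (smash Y X)"
proof -
  let ?b = "\<lambda>z. smash_cls Y X (usnd z) (ufst z)"
  have "bmap (smash X Y) (smash Y X) ?b \<in> based_g_maps G (smash X Y) (smash Y X)"
  proof (rule bmap_smash_in[OF X Y based_g_space_smash[OF Y X]])
    show "?b (smash_cls X Y (pt X) (pt Y)) = pt (smash Y X)"
      unfolding braid_raw by simp
    show "?b (smash_cls X Y (act X g x) (act Y g y)) = act (smash Y X) g (?b (smash_cls X Y x y))"
      if "g \<in> carrier G" "x \<in> pts X" "y \<in> pts Y" for g x y
      unfolding braid_raw by (simp add: act_smash[OF Y X that(1,3,2)])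
    show "continuous_map (spc (smash X Y)) (spc (smash Y X)) ?b"
    proof (rule continuous_map_from_smash)
      fix K :: "('u \<times> 'u) set set topology" and a b
      assume K: "compact_space K" "Hausdorff_space K"
        and a: "continuous_map K (spc X) a" and b: "continuous_map K (spc Y) b"
      show "continuous_map K (spc (smash Y X)) (\<lambda>k. ?b (smash_cls X Y (a k) (b k)))"
        unfolding braid_raw by (rule continuous_map_smash_cls[OF K inj_id_sets b a])
    qed (simp add: braid_raw)
  qed
  then show ?thesis by (simp add: GTop_def)
qed

lemma mor_Braid:
  fixes X Y :: "('g, 'u) bspace"
  assumes "x \<in> pts X" "y \<in> pts Y"
  shows "mor (Braid (GTop G) X Y) (smash_cls X Y x y) = smash_cls Y X y x"
  using assms by (simp add: GTop_def mor_bmap braid_raw)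

end

section \<open>Finite based sets\<close>

text \<open>The element \<open>i\<close> of the based set with \<open>n\<close> nonbase points, seen
  as a morphism from 1, as in the Yoneda lemma. \<open>iota n 0\<close> is the zero map.\<close>

definition iota :: "nat \<Rightarrow> nat \<Rightarrow> fmap" where
  "iota n i = fmap 1 n (\<lambda>_. i)"

lemma Fcat_simps [simp]: "Obj Fcat = UNIV" "Ten Fcat m n = m * n" "Unit Fcat = 1"
  by (simp_all add: Fcat_def)

lemma Fcat_HomD:
  assumes "f \<in> Hom Fcat m n"
  shows "src f = m" "tgt f = n" "mor f 0 = 0" "k \<le> m \<Longrightarrow> mor f k \<le> n"
  using assms by (simp_all add: Fcat_def)

lemma fmap_in: "(\<And>k. 1 \<le> k \<Longrightarrow> k \<le> m \<Longrightarrow> f k \<le> n) \<Longrightarrow> fmap m n f \<in> Hom Fcat m n"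
  by (simp add: Fcat_def fmap_def)

lemma mor_fmap: "1 \<le> k \<Longrightarrow> k \<le> m \<Longrightarrow> mor (fmap m n f) k = f k"
  by (simp add: fmap_def)

lemma iota_in [simp]: "i \<le> n \<Longrightarrow> iota n i \<in> Hom Fcat 1 n"
  unfolding iota_def by (rule fmap_in)

lemma Fcat_Comp: "Comp Fcat g f = fmap (src f) (tgt g) (mor g \<circ> mor f)"
  by (simp add: Fcat_def)

lemma Fcat_Comp_in:
  assumes f: "f \<in> Hom Fcat m n" and g: "g \<in> Hom Fcat n p"
  shows "Comp Fcat g f \<in> Hom Fcat m p"
  unfolding Fcat_Comp Fcat_HomD(1)[OF f] Fcat_HomD(2)[OF g]
  using Fcat_HomD(4)[OF f] Fcat_HomD(4)[OF g] by (intro fmap_in) simp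

lemma mor_Fcat_Comp:
  assumes f: "f \<in> Hom Fcat m n" and g: "g \<in> Hom Fcat n p" and "k \<le> m"
  shows "mor (Comp Fcat g f) k = mor g (mor f k)"
  using assms Fcat_HomD(3)[OF f] Fcat_HomD(3)[OF g] Fcat_HomD(1)[OF f]
  by (cases "k = 0") (simp_all add: Fcat_Comp fmap_def)

lemma Fcat_Comp_iota:
  assumes "f \<in> Hom Fcat m n" "i \<le> m"
  shows "Comp Fcat f (iota m i) = iota n (mor f i)"
  using Fcat_HomD(2)[OF assms(1)] unfolding Fcat_Comp iota_def by (auto simp: fmap_def)

lemma Fcat_Ident: "Ident Fcat n = fmap n n (\<lambda>k. k)"
  by (simp add: Fcat_def)

lemma iota_1_1: "iota 1 1 = Ident Fcat 1"
  unfolding Fcat_Ident iota_def by (auto simp: fmap_def)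

lemma Fcat_Ident_in: "Ident Fcat n \<in> Hom Fcat n n"
  unfolding Fcat_Ident by (rule fmap_in)

lemma mor_Fcat_Ident: "k \<le> n \<Longrightarrow> mor (Ident Fcat n) k = k"
  unfolding Fcat_Ident by (simp add: fmap_def)

section \<open>The lexicographic order and smash products of finite based sets\<close>

lemma lexpos_le: "i \<le> m \<Longrightarrow> j \<le> n \<Longrightarrow> lexpos n i j \<le> m * n"
proof -
  assume ij: "i \<le> m" "j \<le> n"
  have "(i - 1) * n + j \<le> i * n" if "i \<noteq> 0"
    using that ij(2) by (cases i) simp_all
  also have "i * n \<le> m * n" using ij(1) by simp
  finally show ?thesis by (simp add: lexpos_def)
qed

lemma lexpos_0 [simp]: "lexpos n 0 j = 0" "lexpos n i 0 = 0"
  by (simp_all add: lexpos_def)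

lemma lexpos_pos: "i \<noteq> 0 \<Longrightarrow> j \<noteq> 0 \<Longrightarrow> Suc 0 \<le> lexpos n i j"
  by (simp add: lexpos_def)

lemma lexl_lexpos: "i \<noteq> 0 \<Longrightarrow> j \<noteq> 0 \<Longrightarrow> j \<le> n \<Longrightarrow> lexl n (lexpos n i j) = i"
  and lexr_lexpos: "i \<noteq> 0 \<Longrightarrow> j \<noteq> 0 \<Longrightarrow> j \<le> n \<Longrightarrow> lexr n (lexpos n i j) = j"
proof -
  assume ij: "i \<noteq> 0" "j \<noteq> 0" "j \<le> n"
  then obtain i' j' where "i = Suc i'" "j = Suc j'" by (metis not0_implies_Suc)
  then show "lexl n (lexpos n i j) = i" "lexr n (lexpos n i j) = j"
    using ij(3) by (simp_all add: lexl_def lexr_def lexpos_def)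
qed

lemma lexpos_1 [simp]: "j \<le> n \<Longrightarrow> lexpos n (Suc 0) j = j" "lexpos (Suc 0) i (Suc 0) = i"
  by (auto simp: lexpos_def)

text \<open>For nonzero indices both sides equal (i - 1) n p + (j - 1) p + k. This is the strict
  associativity that allows the associativity constraint of \<open>Fcat\<close> to be an
  identity.\<close>

lemma lexpos_assoc: "lexpos p (lexpos n i j) k = lexpos (n * p) i (lexpos p j k)"
proof (cases "i = 0 \<or> j = 0 \<or> k = 0")
  case True
  then show ?thesis by auto
next
  case False
  then obtain i' j' where "i = Suc i'" "j = Suc j'" by (metis not0_implies_Suc)
  then show ?thesis using False by (simp add: lexpos_def algebra_simps)
qed

lemma Fcat_TenA: "TenA Fcat f g = fmap (src f * src g) (tgt f * tgt g)
    (\<lambda>k. lexpos (tgt g) (mor f (lexl (src g) k)) (mor g (lexr (src g) k)))"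
  by (simp add: Fcat_def)

lemma lexl_le: "1 \<le> k \<Longrightarrow> k \<le> m * n \<Longrightarrow> lexl n k \<le> m"
  and lexr_le: "1 \<le> k \<Longrightarrow> k \<le> m * n \<Longrightarrow> lexr n k \<le> n"
proof -
  assume k: "1 \<le> k" "k \<le> m * n"
  then have n: "0 < n" by (cases n) simp_all
  have "k - 1 < m * n" using k by simp
  then have "(k - 1) div n < m" using n by (simp add: less_mult_imp_div_less)
  then show "lexl n k \<le> m" by (simp add: lexl_def)
  show "lexr n k \<le> n" using n by (simp add: lexr_def Suc_leI)
qed

lemma TenA_in:
  assumes f: "f \<in> Hom Fcat m m'" and g: "g \<in> Hom Fcat n n'"
  shows "TenA Fcat f g \<in> Hom Fcat (m * n) (m' * n')"
  unfolding Fcat_TenA Fcat_HomD(1,2)[OF f] Fcat_HomD(1,2)[OF g]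
  by (rule fmap_in) (intro lexpos_le Fcat_HomD(4)[OF f] Fcat_HomD(4)[OF g] lexl_le lexr_le)

lemma mor_TenA:
  assumes f: "f \<in> Hom Fcat m m'" and g: "g \<in> Hom Fcat n n'" and ij: "i \<le> m" "j \<le> n"
  shows "mor (TenA Fcat f g) (lexpos n i j) = lexpos n' (mor f i) (mor g j)"
proof (cases "i = 0 \<or> j = 0")
  case True
  then show ?thesis
    using Fcat_HomD(3)[OF f] Fcat_HomD(3)[OF g] Fcat_HomD(3)[OF TenA_in[OF f g]] by auto
next
  case False
  then show ?thesis
    unfolding Fcat_TenA Fcat_HomD(1,2)[OF f] Fcat_HomD(1,2)[OF g]
    using ij by (simp add: mor_fmap lexpos_pos lexpos_le lexl_lexpos lexr_lexpos)
qed

text \<open>The generating morphisms are closed under the tensor product, because 1 is the unit and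
  its only nonzero point has lexicographic coordinates (1, 1). It expresses any pairing through its
  component at (1, 1).\<close>

lemma TenA_iota:
  assumes "i \<le> m" "j \<le> n"
  shows "TenA Fcat (iota m i) (iota n j) = iota (m * n) (lexpos n i j)"
  unfolding Fcat_TenA Fcat_HomD(1,2)[OF iota_in[OF assms(1)]] Fcat_HomD(1,2)[OF iota_in[OF assms(2)]]
  by (auto simp: iota_def fmap_def lexl_def lexr_def)

lemma Assoc_Fcat: "Assoc Fcat m n p = Ident Fcat (m * n * p)"
  and LUnit_Fcat: "LUnit Fcat n = Ident Fcat n" and RUnit_Fcat: "RUnit Fcat n = Ident Fcat n"
  by (simp_all add: Fcat_def)

lemma Fcat_Braid: "Braid Fcat m n = fmap (m * n) (n * m) (\<lambda>k. lexpos m (lexr n k) (lexl n k))"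
  by (simp add: Fcat_def)

lemma Braid_Fcat_in: "Braid Fcat m n \<in> Hom Fcat (m * n) (n * m)"
  unfolding Fcat_Braid by (rule fmap_in) (intro lexpos_le lexl_le lexr_le)

lemma mor_Braid_Fcat: "i \<le> m \<Longrightarrow> j \<le> n \<Longrightarrow> mor (Braid Fcat m n) (lexpos n i j) = lexpos m j i"
  using Fcat_HomD(3)[OF Braid_Fcat_in[of m n]]
  by (cases "i = 0 \<or> j = 0")
     (auto simp: Fcat_Braid mor_fmap lexpos_pos lexpos_le lexl_lexpos lexr_lexpos)

section \<open>Free \<open>F\<close>-\<open>G\<close>-spaces\<close>

lemma fg_spaceD:
  assumes "fg_space (GTop G) Z"
  shows "based_g_space G (fo Z n)"
    "f \<in> Hom Fcat m n \<Longrightarrow> fa Z f \<in> based_g_maps G (fo Z m) (fo Z n)"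
    "fa Z (Ident Fcat n) = Ident (GTop G) (fo Z n)"
    "f \<in> Hom Fcat m n \<Longrightarrow> g \<in> Hom Fcat n p \<Longrightarrow> fa Z (Comp Fcat g f) = gcomp G (fa Z g) (fa Z f)"
    "pts (fo Z 0) = {pt (fo Z 0)}"
  using assms by (auto simp: fg_space_def is_functor_def)

lemma mor_fa_in:
  "fg_space (GTop G) Z \<Longrightarrow> f \<in> Hom Fcat m n \<Longrightarrow> z \<in> pts (fo Z m) \<Longrightarrow> mor (fa Z f) z \<in> pts (fo Z n)"
  using fg_spaceD(2) by (rule based_g_mapsD(9))

lemma mor_fa_Ident: "fg_space (GTop G) Z \<Longrightarrow> z \<in> pts (fo Z n) \<Longrightarrow> mor (fa Z (Ident Fcat n)) z = z"
  by (simp only: fg_spaceD(3) mor_gident)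

lemma mor_fa_Comp:
  assumes "fg_space (GTop G) Z" "f \<in> Hom Fcat m n" "g \<in> Hom Fcat n p" "z \<in> pts (fo Z m)"
  shows "mor (fa Z (Comp Fcat g f)) z = mor (fa Z g) (mor (fa Z f) z)"
  unfolding fg_spaceD(4)[OF assms(1-3)] by (rule mor_gcomp[OF fg_spaceD(2)[OF assms(1,2)] assms(4)])

lemma mor_fa_iota:
  assumes "fg_space (GTop G) Z" "f \<in> Hom Fcat m n" "i \<le> m" "z \<in> pts (fo Z 1)"
  shows "mor (fa Z f) (mor (fa Z (iota m i)) z) = mor (fa Z (iota n (mor f i))) z"
  using mor_fa_Comp[OF assms(1) iota_in[OF assms(3)] assms(2,4)] Fcat_Comp_iota[OF assms(2,3)] by simp

lemma mor_fa_iota_1: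
  "fg_space (GTop G) Z \<Longrightarrow> z \<in> pts (fo Z 1) \<Longrightarrow> mor (fa Z (iota 1 1)) z = z"
  unfolding iota_1_1 by (rule mor_fa_Ident)

text \<open>The zero map factors through the object 0, where the value of \<open>Z\<close> is a
  point. This is the place where \<open>X(0) = *\<close> yields compatibility with base
  points.\<close>

lemma mor_fa_iota_0:
  assumes Z: "fg_space (GTop G) Z" and z: "z \<in> pts (fo Z 1)"
  shows "mor (fa Z (iota n 0)) z = pt (fo Z n)"
proof -
  have 0: "fmap 0 n (\<lambda>_. 0) \<in> Hom Fcat 0 n" by (rule fmap_in) simp
  have "mor (fa Z (iota 0 0)) z \<in> pts (fo Z 0)" using mor_fa_in[OF Z iota_in z] by simp
  then have "mor (fa Z (iota 0 0)) z = pt (fo Z 0)" using fg_spaceD(5)[OF Z] by simp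
  moreover have "mor (fa Z (fmap 0 n (\<lambda>_. 0))) (pt (fo Z 0)) = pt (fo Z n)"
    by (rule based_g_mapsD(7)[OF fg_spaceD(2)[OF Z 0]])
  ultimately show ?thesis
    using mor_fa_iota[OF Z 0 le_refl z] Fcat_HomD(3)[OF 0] by simp
qed

lemma fg_spaceI:
  assumes 1: "\<And>n. based_g_space G (fo Z n)"
    and 2: "\<And>m n f. f \<in> Hom Fcat m n \<Longrightarrow> fa Z f \<in> based_g_maps G (fo Z m) (fo Z n)"
    and 3: "\<And>n z. z \<in> pts (fo Z n) \<Longrightarrow> mor (fa Z (Ident Fcat n)) z = z"
    and 4: "\<And>m n p f g z. f \<in> Hom Fcat m n \<Longrightarrow> g \<in> Hom Fcat n p \<Longrightarrow> z \<in> pts (fo Z m) \<Longrightarrow>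
      mor (fa Z (Comp Fcat g f)) z = mor (fa Z g) (mor (fa Z f) z)"
    and 5: "\<And>z. z \<in> pts (fo Z 0) \<Longrightarrow> z = pt (fo Z 0)"
  shows "fg_space (GTop G) Z"
  unfolding fg_space_def is_functor_def
proof (intro conjI ballI; simp?)
  show "based_g_space G (fo Z n)" for n by (rule 1)
  show "fa Z f \<in> based_g_maps G (fo Z m) (fo Z n)" if "f \<in> Hom Fcat m n" for m n f
    using that by (rule 2)
  show "fa Z (Ident Fcat n) = Ident (GTop G) (fo Z n)" for n
    by (rule based_g_maps_eqI[OF 2[OF Fcat_Ident_in] gident_in[OF 1]]) (simp add: 3 mor_gident)
  show "fa Z (Comp Fcat g f) = gcomp G (fa Z g) (fa Z f)"
    if f: "f \<in> Hom Fcat m n" and g: "g \<in> Hom Fcat n p" for m n p f g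
    by (rule based_g_maps_eqI[OF 2[OF Fcat_Comp_in[OF f g]] gcomp_in[OF 2[OF f] 2[OF g]]])
       (simp add: 4[OF f g] mor_gcomp[OF 2[OF f]])
  show "pts (fo Z 0) = {pt (fo Z 0)}" using 5 based_g_spaceD(3)[OF 1] by blast
qed

lemma fg_space_GT:
  "fg_space (GT G) Z \<longleftrightarrow> fg_space (GTop G) Z \<and> (\<forall>n. nondegenerate G (fo Z n))"
  by (auto simp: fg_space_def is_functor_def)

lemma fg_mapsD:
  assumes "\<theta> \<in> fg_maps G X Y"
  shows "src \<theta> = X" "tgt \<theta> = Y" "fg_space (GTop G) X" "fg_space (GTop G) Y"
    "mor \<theta> n \<in> based_g_maps G (fo X n) (fo Y n)"
    "f \<in> Hom Fcat m n \<Longrightarrow> gcomp G (mor \<theta> n) (fa X f) = gcomp G (fa Y f) (mor \<theta> m)"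
  using assms by (auto simp: fg_maps_def)

lemma mor_mor_in: "\<theta> \<in> fg_maps G X Y \<Longrightarrow> x \<in> pts (fo X n) \<Longrightarrow> mor (mor \<theta> n) x \<in> pts (fo Y n)"
  using fg_mapsD(5) by (rule based_g_mapsD(9))

lemma fg_maps_nat:
  assumes \<theta>: "\<theta> \<in> fg_maps G X Y" and f: "f \<in> Hom Fcat m n" and x: "x \<in> pts (fo X m)"
  shows "mor (mor \<theta> n) (mor (fa X f) x) = mor (fa Y f) (mor (mor \<theta> m) x)"
  using mor_gcomp[OF fg_spaceD(2)[OF fg_mapsD(3)[OF \<theta>] f] x] mor_gcomp[OF fg_mapsD(5)[OF \<theta>] x]
    fg_mapsD(6)[OF \<theta> f] by metis

lemma fg_mapsI:
  assumes X: "fg_space (GTop G) X" and Y: "fg_space (GTop G) Y" and st: "src \<theta> = X" "tgt \<theta> = Y"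
    and 1: "\<And>n. mor \<theta> n \<in> based_g_maps G (fo X n) (fo Y n)"
    and 2: "\<And>m n f x. f \<in> Hom Fcat m n \<Longrightarrow> x \<in> pts (fo X m) \<Longrightarrow>
      mor (mor \<theta> n) (mor (fa X f) x) = mor (fa Y f) (mor (mor \<theta> m) x)"
  shows "\<theta> \<in> fg_maps G X Y"
proof -
  have "gcomp G (mor \<theta> n) (fa X f) = gcomp G (fa Y f) (mor \<theta> m)" if f: "f \<in> Hom Fcat m n" for m n f
    by (rule based_g_maps_eqI[OF gcomp_in[OF fg_spaceD(2)[OF X f] 1] gcomp_in[OF 1 fg_spaceD(2)[OF Y f]]])
       (simp add: mor_gcomp[OF fg_spaceD(2)[OF X f]] mor_gcomp[OF 1] 2[OF f])
  then show ?thesis using X Y st 1 by (simp add: fg_maps_def)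
qed

lemma fg_maps_eqI:
  assumes \<theta>: "\<theta> \<in> fg_maps G X Y" and \<theta>': "\<theta>' \<in> fg_maps G X Y"
    and eq: "\<And>n x. x \<in> pts (fo X n) \<Longrightarrow> mor (mor \<theta> n) x = mor (mor \<theta>' n) x"
  shows "\<theta> = \<theta>'"
proof -
  have "mor \<theta> n = mor \<theta>' n" for n
    using fg_mapsD(5)[OF \<theta>] fg_mapsD(5)[OF \<theta>'] eq by (rule based_g_maps_eqI)
  then show ?thesis
    using fg_mapsD(1,2)[OF \<theta>] fg_mapsD(1,2)[OF \<theta>'] by (intro arrow.equality ext) simp_all
qed

abbreviation fcomp :: "('g, 'r) monoid_scheme \<Rightarrow> ('g, 'u) ftrans \<Rightarrow> ('g, 'u) ftrans \<Rightarrow> ('g, 'u) ftrans" where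
  "fcomp G \<equiv> Comp (FGTop G)"

lemma FGTop_Comp: "fcomp G \<psi> \<theta> = \<lparr>src = src \<theta>, tgt = tgt \<psi>, mor = (\<lambda>n. gcomp G (mor \<psi> n) (mor \<theta> n))\<rparr>"
  and FGTop_Ident: "Ident (FGTop G) X = \<lparr>src = X, tgt = X, mor = (\<lambda>n. Ident (GTop G) (fo X n))\<rparr>"
  by (simp_all add: FGTop_def)

lemma FG_simps [simp]:
  "Obj (FG G) = {X. fg_space (GT G) X}" "Hom (FG G) = fg_maps G"
  "Ident (FG G) = Ident (FGTop G)" "Comp (FG G) = Comp (FGTop G)"
  "Ten (FG G) = day G" "TenA (FG G) = day_map G" "Unit (FG G) = IF"
  "Assoc (FG G) = day_assoc G" "LUnit (FG G) = day_lunit G"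
  "RUnit (FG G) = day_runit G" "Braid (FG G) = day_braid G"
  by (simp_all add: FG_def FGTop_def)

lemma mor_fcomp:
  assumes "\<theta> \<in> fg_maps G X Y" "x \<in> pts (fo X n)"
  shows "mor (mor (fcomp G \<psi> \<theta>) n) x = mor (mor \<psi> n) (mor (mor \<theta> n) x)"
  using mor_gcomp[OF fg_mapsD(5)[OF assms(1)] assms(2)] by (simp add: FGTop_Comp)

lemma fcomp_in:
  assumes \<theta>: "\<theta> \<in> fg_maps G X Y" and \<psi>: "\<psi> \<in> fg_maps G Y Z"
  shows "fcomp G \<psi> \<theta> \<in> fg_maps G X Z"
proof (rule fg_mapsI[OF fg_mapsD(3)[OF \<theta>] fg_mapsD(4)[OF \<psi>]])
  show "src (fcomp G \<psi> \<theta>) = X" "tgt (fcomp G \<psi> \<theta>) = Z"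
    using fg_mapsD(1)[OF \<theta>] fg_mapsD(2)[OF \<psi>] by (simp_all add: FGTop_Comp)
  show "mor (fcomp G \<psi> \<theta>) n \<in> based_g_maps G (fo X n) (fo Z n)" for n
    using gcomp_in[OF fg_mapsD(5)[OF \<theta>] fg_mapsD(5)[OF \<psi>]] by (simp add: FGTop_Comp)
  show "mor (mor (fcomp G \<psi> \<theta>) n) (mor (fa X f) x) = mor (fa Z f) (mor (mor (fcomp G \<psi> \<theta>) m) x)"
    if f: "f \<in> Hom Fcat m n" and x: "x \<in> pts (fo X m)" for m n f x
    by (simp add: mor_fcomp[OF \<theta>] x mor_fa_in[OF fg_mapsD(3)[OF \<theta>] f] fg_maps_nat[OF \<theta> f]
        fg_maps_nat[OF \<psi> f] mor_mor_in[OF \<theta>])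
qed

lemma mor_fident: "x \<in> pts (fo X n) \<Longrightarrow> mor (mor (Ident (FGTop G) X) n) x = x"
  by (simp add: FGTop_Ident mor_gident)

lemma fident_in:
  assumes X: "fg_space (GTop G) X"
  shows "Ident (FGTop G) X \<in> fg_maps G X X"
proof (rule fg_mapsI[OF X X])
  show "src (Ident (FGTop G) X) = X" "tgt (Ident (FGTop G) X) = X" by (simp_all add: FGTop_Ident)
  show "mor (Ident (FGTop G) X) n \<in> based_g_maps G (fo X n) (fo X n)" for n
    using gident_in[OF fg_spaceD(1)[OF X]] by (simp add: FGTop_Ident)
qed (simp add: mor_fident mor_fa_in[OF X])

lemma category_FG: "category (FG G)"
  unfolding category_def
proof (intro conjI ballI; simp add: fg_space_GT)
  fix X assume "fg_space (GTop G) X \<and> (\<forall>n. nondegenerate G (fo X n))"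
  then show "Ident (FGTop G) X \<in> fg_maps G X X" using fident_in by blast
next
  fix X Y Z \<theta> \<psi> assume "\<theta> \<in> fg_maps G X Y" "\<psi> \<in> fg_maps G Y Z"
  then show "fcomp G \<psi> \<theta> \<in> fg_maps G X Z" by (rule fcomp_in)
next
  fix X Y \<theta> assume \<theta>: "\<theta> \<in> fg_maps G X Y"
  note i = fident_in[OF fg_mapsD(3)[OF \<theta>]] fident_in[OF fg_mapsD(4)[OF \<theta>]]
  show "fcomp G \<theta> (Ident (FGTop G) X) = \<theta>"
    by (rule fg_maps_eqI[OF fcomp_in[OF i(1) \<theta>] \<theta>]) (simp add: mor_fcomp[OF i(1)] mor_fident)
  show "fcomp G (Ident (FGTop G) Y) \<theta> = \<theta>"
    by (rule fg_maps_eqI[OF fcomp_in[OF \<theta> i(2)] \<theta>])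
       (simp add: mor_fcomp[OF \<theta>] mor_fident mor_mor_in[OF \<theta>])
next
  fix X Y Z W \<theta> \<psi> \<rho>
  assume \<theta>: "\<theta> \<in> fg_maps G X Y" and \<psi>: "\<psi> \<in> fg_maps G Y Z" and \<rho>: "\<rho> \<in> fg_maps G Z W"
  show "fcomp G \<rho> (fcomp G \<psi> \<theta>) = fcomp G (fcomp G \<rho> \<psi>) \<theta>"
    by (rule fg_maps_eqI[OF fcomp_in[OF fcomp_in[OF \<theta> \<psi>] \<rho>] fcomp_in[OF \<theta> fcomp_in[OF \<psi> \<rho>]]])
       (simp add: mor_fcomp[OF \<theta>] mor_fcomp[OF \<psi>] mor_fcomp[OF fcomp_in[OF \<theta> \<psi>]] mor_mor_in[OF \<theta>])
qed

text \<open>\<open>free_on G W A e\<close>: restriction along \<open>e\<close> identifies maps \<open>W \<rightarrow> Z\<close> with based \<open>G\<close>-maps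
  \<open>A \<rightarrow> Z(\<one>)\<close>. The third conjunct, which gives uniqueness, says that \<open>W\<close> is generated by \<open>A\<close>.\<close>

definition free_on ::
  "('g, 'r) monoid_scheme \<Rightarrow> ('g, 'u) fspace \<Rightarrow> ('g, 'u) bspace \<Rightarrow> ('g, 'u) bmap \<Rightarrow> bool" where
  "free_on G W A e \<longleftrightarrow> fg_space (GTop G) W \<and> e \<in> based_g_maps G A (fo W 1) \<and>
     (\<forall>n. \<forall>w\<in>pts (fo W n). \<exists>i\<le>n. \<exists>a\<in>pts A. w = mor (fa W (iota n i)) (mor e a)) \<and>
     (\<forall>Z f. fg_space (GTop G) Z \<and> f \<in> based_g_maps G A (fo Z 1) \<longrightarrow>
        (\<exists>\<theta>\<in>fg_maps G W Z. \<forall>a\<in>pts A. mor (mor \<theta> 1) (mor e a) = mor f a))"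

lemma free_onD:
  assumes "free_on G W A e"
  shows "fg_space (GTop G) W" "e \<in> based_g_maps G A (fo W 1)" "based_g_space G A"
    "a \<in> pts A \<Longrightarrow> mor e a \<in> pts (fo W 1)"
  using assms based_g_mapsD(3,9)[of e G A "fo W 1"] unfolding free_on_def by blast+

lemma free_on_gen:
  assumes "free_on G W A e" "w \<in> pts (fo W n)"
  obtains i a where "i \<le> n" "a \<in> pts A" "w = mor (fa W (iota n i)) (mor e a)"
  using assms unfolding free_on_def by blast

lemma free_on_extend:
  assumes "free_on G W A e" "fg_space (GTop G) Z" "f \<in> based_g_maps G A (fo Z 1)"
  obtains \<theta> where "\<theta> \<in> fg_maps G W Z" "\<And>a. a \<in> pts A \<Longrightarrow> mor (mor \<theta> 1) (mor e a) = mor f a"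
  using assms unfolding free_on_def by blast

lemma free_on_eqI:
  assumes W: "free_on G W A e" and \<theta>: "\<theta> \<in> fg_maps G W Z" and \<theta>': "\<theta>' \<in> fg_maps G W Z"
    and eq: "\<And>a. a \<in> pts A \<Longrightarrow> mor (mor \<theta> 1) (mor e a) = mor (mor \<theta>' 1) (mor e a)"
  shows "\<theta> = \<theta>'"
proof (rule fg_maps_eqI[OF \<theta> \<theta>'])
  fix n w assume "w \<in> pts (fo W n)"
  then obtain i a where ia: "i \<le> n" "a \<in> pts A" "w = mor (fa W (iota n i)) (mor e a)"
    by (rule free_on_gen[OF W])
  show "mor (mor \<theta> n) w = mor (mor \<theta>' n) w"
    unfolding ia(3) fg_maps_nat[OF \<theta> iota_in[OF ia(1)] free_onD(4)[OF W ia(2)]]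
      fg_maps_nat[OF \<theta>' iota_in[OF ia(1)] free_onD(4)[OF W ia(2)]] eq[OF ia(2)] ..
qed

text \<open>Handles structure maps defined by \<open>THE\<close>. If the defining condition
  \<open>P\<close> is equivalent to prescribed values on generators, freeness supplies the unique
  map satisfying it, and its values on generators are the prescribed ones.\<close>

lemma free_on_the:
  assumes D: "free_on G D A e" and Z: "fg_space (GTop G) Z" and f: "f \<in> based_g_maps G A (fo Z 1)"
    and ex: "\<And>\<tau>. \<tau> \<in> fg_maps G D Z \<Longrightarrow> (\<And>a. a \<in> pts A \<Longrightarrow> mor (mor \<tau> 1) (mor e a) = mor f a) \<Longrightarrow> P \<tau>"
    and uniq: "\<And>\<tau> a. \<tau> \<in> fg_maps G D Z \<Longrightarrow> P \<tau> \<Longrightarrow> a \<in> pts A \<Longrightarrow> mor (mor \<tau> 1) (mor e a) = mor f a"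
    and t: "t = (THE \<tau>. \<tau> \<in> fg_maps G D Z \<and> P \<tau>)"
  shows "t \<in> fg_maps G D Z" "a \<in> pts A \<Longrightarrow> mor (mor t 1) (mor e a) = mor f a"
proof -
  obtain \<tau> where \<tau>: "\<tau> \<in> fg_maps G D Z" "\<And>a. a \<in> pts A \<Longrightarrow> mor (mor \<tau> 1) (mor e a) = mor f a"
    using free_on_extend[OF D Z f] by blast
  have "t = \<tau>"
    unfolding t
  proof (rule the_equality)
    show "\<tau> \<in> fg_maps G D Z \<and> P \<tau>" using \<tau>(1) ex[OF \<tau>] by blast
    fix \<tau>' assume \<tau>': "\<tau>' \<in> fg_maps G D Z \<and> P \<tau>'"
    show "\<tau>' = \<tau>"
      by (rule free_on_eqI[OF D]) (use \<tau>' \<tau> uniq[of \<tau>'] in auto)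
  qed
  then show "t \<in> fg_maps G D Z" "a \<in> pts A \<Longrightarrow> mor (mor t 1) (mor e a) = mor f a"
    using \<tau> by auto
qed

text \<open>Objects representing the same functor are isomorphic: the extension in the other
  direction is inverse because both composites fix the generators.\<close>

lemma free_on_iso:
  assumes W: "free_on G W A e" and W': "free_on G W' A e'"
    and \<theta>: "\<theta> \<in> fg_maps G W W'"
    and \<theta>e: "\<And>a. a \<in> pts A \<Longrightarrow> mor (mor \<theta> 1) (mor e a) = mor e' a"
  shows "is_iso (FG G) W W' \<theta>"
proof -
  obtain \<psi> where \<psi>: "\<psi> \<in> fg_maps G W' W" "\<And>a. a \<in> pts A \<Longrightarrow> mor (mor \<psi> 1) (mor e' a) = mor e a"
    using free_on_extend[OF W' free_onD(1)[OF W] free_onD(2)[OF W]] by blast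
  have "fcomp G \<psi> \<theta> = Ident (FGTop G) W"
    by (rule free_on_eqI[OF W fcomp_in[OF \<theta> \<psi>(1)] fident_in[OF free_onD(1)[OF W]]])
       (simp add: mor_fcomp[OF \<theta>] free_onD(4)[OF W, simplified] \<theta>e[simplified] \<psi>(2)[simplified] mor_fident)
  moreover have "fcomp G \<theta> \<psi> = Ident (FGTop G) W'"
    by (rule free_on_eqI[OF W' fcomp_in[OF \<psi>(1) \<theta>] fident_in[OF free_onD(1)[OF W']]])
       (simp add: mor_fcomp[OF \<psi>(1)] free_onD(4)[OF W', simplified] \<theta>e[simplified] \<psi>(2)[simplified] mor_fident)
  ultimately show ?thesis
    unfolding is_iso_def using \<theta> \<psi>(1) by auto
qed

text \<open>Needed for the convolution picked by \<open>SOME\<close>, which is merely isomorphic to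
  the explicit model. Points of \<open>D\<close> are generated by passing to \<open>W\<close> and
  back.\<close>

lemma free_on_transport:
  assumes W: "free_on G W A e"
    and \<rho>: "\<rho> \<in> fg_maps G W D" and \<sigma>: "\<sigma> \<in> fg_maps G D W"
    and \<rho>\<sigma>: "fcomp G \<rho> \<sigma> = Ident (FGTop G) D" and \<sigma>\<rho>: "fcomp G \<sigma> \<rho> = Ident (FGTop G) W"
    and d: "d \<in> based_g_maps G A (fo D 1)" and de: "\<And>a. a \<in> pts A \<Longrightarrow> mor d a = mor (mor \<rho> 1) (mor e a)"
  shows "free_on G D A d"
  unfolding free_on_def
proof (intro conjI allI ballI impI)
  show D: "fg_space (GTop G) D" by (rule fg_mapsD(4)[OF \<rho>])
  show "d \<in> based_g_maps G A (fo D 1)" by (rule d)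
  fix n w assume w: "w \<in> pts (fo D n)"
  obtain i a where ia: "i \<le> n" "a \<in> pts A" "mor (mor \<sigma> n) w = mor (fa W (iota n i)) (mor e a)"
    using free_on_gen[OF W mor_mor_in[OF \<sigma> w]] .
  have "w = mor (mor \<rho> n) (mor (mor \<sigma> n) w)"
    using mor_fcomp[OF \<sigma> w, of \<rho>] mor_fident[OF w] \<rho>\<sigma> by metis
  also have "\<dots> = mor (fa D (iota n i)) (mor d a)"
    unfolding ia(3) fg_maps_nat[OF \<rho> iota_in[OF ia(1)] free_onD(4)[OF W ia(2)]] de[OF ia(2)] ..
  finally show "\<exists>i\<le>n. \<exists>a\<in>pts A. w = mor (fa D (iota n i)) (mor d a)" using ia(1,2) by blast
next
  fix Z f assume "fg_space (GTop G) Z \<and> f \<in> based_g_maps G A (fo Z 1)"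
  then obtain \<theta> where \<theta>: "\<theta> \<in> fg_maps G W Z" "\<And>a. a \<in> pts A \<Longrightarrow> mor (mor \<theta> 1) (mor e a) = mor f a"
    using free_on_extend[OF W] by blast
  have "mor (mor (fcomp G \<theta> \<sigma>) 1) (mor d a) = mor f a" if a: "a \<in> pts A" for a
  proof -
    note ea = free_onD(4)[OF W a]
    have "mor (mor \<sigma> 1) (mor d a) = mor e a"
      unfolding de[OF a] using mor_fcomp[OF \<rho> ea, of \<sigma>] mor_fident[OF ea] \<sigma>\<rho> by metis
    then show ?thesis
      using mor_fcomp[OF \<sigma> based_g_mapsD(9)[OF d a], of \<theta>] \<theta>(2)[OF a] by simp
  qed
  then show "\<exists>\<theta>\<in>fg_maps G D Z. \<forall>a\<in>pts A. mor (mor \<theta> 1) (mor d a) = mor f a"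
    using fcomp_in[OF \<sigma> \<theta>(1)] by blast
qed

text \<open>The unit of the adjunction between \<open>F1\<close> and evaluation at 1: the inclusion
  of \<open>X\<close> as the copy with index 1.\<close>

definition F1_unit :: "('g, 'u) bspace \<Rightarrow> ('g, 'u) bmap" where
  "F1_unit X = bmap X (smash (dspace 1) X) (wcls 1 X 1)"

context gspaces
begin

section \<open>The unit object and \<open>F1\<close> of a space are free\<close>

lemma fo_IF [simp]: "fo IF n = dspace n"
  by (simp add: IF_def)

lemma mor_fa_IF:
  assumes "f \<in> Hom Fcat m n" "i \<le> m"
  shows "mor (fa IF f :: ('g, 'u) bmap) (unat i) = unat (mor f i)"
  using assms Fcat_HomD(1,2)[OF assms(1)] by (simp add: IF_def mor_bmap)

lemma fa_IF_in:
  assumes f: "f \<in> Hom Fcat m n"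
  shows "(fa IF f :: ('g, 'u) bmap) \<in> based_g_maps G (dspace m) (dspace n)"
proof -
  have "(\<lambda>z :: 'u. unat (mor f (inv_into UNIV unat z))) \<in> unat ` {..m} \<rightarrow> (unat ` {..n} :: 'u set)"
    using Fcat_HomD(4)[OF f] by auto
  then have "bmap (dspace m) (dspace n) (\<lambda>z. unat (mor f (inv_into UNIV unat z)))
      \<in> based_g_maps G (dspace m :: ('g, 'u) bspace) (dspace n)"
    using Fcat_HomD(3,4)[OF f]
    by (intro bmap_in[OF based_g_space_dspace based_g_space_dspace]) (auto simp: dspace_def)
  then show ?thesis using Fcat_HomD(1,2)[OF f] by (simp add: IF_def)
qed

lemma fg_space_IF: "fg_space (GTop G) (IF :: ('g, 'u) fspace)"
proof (rule fg_spaceI)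
  show "based_g_space G (fo (IF :: ('g, 'u) fspace) n)" for n by simp
  show "(fa IF f :: ('g, 'u) bmap) \<in> based_g_maps G (fo IF m) (fo IF n)" if "f \<in> Hom Fcat m n" for m n f
    using fa_IF_in[OF that] by simp
  show "mor (fa IF (Ident Fcat n) :: ('g, 'u) bmap) z = z" if "z \<in> pts (fo IF n :: ('g, 'u) bspace)" for n z
    using that mor_fa_IF[OF Fcat_Ident_in] mor_Fcat_Ident by auto
  show "mor (fa IF (Comp Fcat g f) :: ('g, 'u) bmap) z = mor (fa IF g :: ('g, 'u) bmap) (mor (fa IF f :: ('g, 'u) bmap) z)"
    if f: "f \<in> Hom Fcat m n" and g: "g \<in> Hom Fcat n p" and z: "z \<in> pts (fo IF m :: ('g, 'u) bspace)" for m n p f g z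
    using z mor_fa_IF[OF f] mor_fa_IF[OF g] mor_fa_IF[OF Fcat_Comp_in[OF f g]] Fcat_HomD(4)[OF f]
      mor_Fcat_Comp[OF f g] by auto
  show "z = pt (fo IF 0 :: ('g, 'u) bspace)" if "z \<in> pts (fo IF 0 :: ('g, 'u) bspace)" for z
    using that by simp
qed

lemma fo_F1 [simp]: "fo (F1_space G X) n = smash (dspace n) X"
  by (simp add: F1_space_def)

lemma fa_F1: "fa (F1_space G X) f = smash_map (fa IF f) (Ident (GTop G) X)"
  by (simp add: F1_space_def)

lemma mor_fa_F1:
  fixes X :: "('g, 'u) bspace"
  assumes X: "based_g_space G X" and f: "f \<in> Hom Fcat m n" and "i \<le> m" "x \<in> pts X"
  shows "mor (fa (F1_space G X) f) (wcls m X i x) = wcls n X (mor f i) x"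
  using mor_smash_map[OF fa_IF_in[OF f] gident_in[OF X], of "unat i" x] assms(3,4)
  by (simp add: fa_F1 mor_fa_IF[OF f] mor_gident)

lemma fg_space_F1:
  fixes X :: "('g, 'u) bspace"
  assumes X: "based_g_space G X"
  shows "fg_space (GTop G) (F1_space G X)"
proof (rule fg_spaceI)
  show "based_g_space G (fo (F1_space G X) n)" for n using X by simp
  show "fa (F1_space G X) f \<in> based_g_maps G (fo (F1_space G X) m) (fo (F1_space G X) n)"
    if "f \<in> Hom Fcat m n" for m n f
    using smash_map_in[OF fa_IF_in[OF that] gident_in[OF X]] by (simp add: fa_F1)
  show "mor (fa (F1_space G X) (Ident Fcat n)) z = z" if "z \<in> pts (fo (F1_space G X) n)" for n z
  proof -
    obtain i x where ix: "i \<le> n" "x \<in> pts X" "z = wcls n X i x"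
      using \<open>z \<in> _\<close> unfolding fo_F1 by (rule pts_wedgeE)
    show ?thesis
      unfolding ix(3) mor_fa_F1[OF X Fcat_Ident_in ix(1,2)] mor_Fcat_Ident[OF ix(1)] ..
  qed
  show "mor (fa (F1_space G X) (Comp Fcat g f)) z = mor (fa (F1_space G X) g) (mor (fa (F1_space G X) f) z)"
    if f: "f \<in> Hom Fcat m n" and g: "g \<in> Hom Fcat n p" and z: "z \<in> pts (fo (F1_space G X) m)" for m n p f g z
  proof -
    obtain i x where ix: "i \<le> m" "x \<in> pts X" "z = wcls m X i x"
      using z unfolding fo_F1 by (rule pts_wedgeE)
    show ?thesis
      unfolding ix(3) mor_fa_F1[OF X Fcat_Comp_in[OF f g] ix(1,2)] mor_fa_F1[OF X f ix(1,2)]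
        mor_fa_F1[OF X g Fcat_HomD(4)[OF f ix(1)] ix(2)] mor_Fcat_Comp[OF f g ix(1)] ..
  qed
  show "z = pt (fo (F1_space G X) 0)" if z: "z \<in> pts (fo (F1_space G X) 0)" for z
  proof -
    obtain i x where "i \<le> 0" "x \<in> pts X" "z = wcls 0 X i x"
      using z unfolding fo_F1 by (rule pts_wedgeE)
    then show ?thesis by simp
  qed
qed

lemma F1_unit_in:
  fixes X :: "('g, 'u) bspace"
  assumes X: "based_g_space G X"
  shows "F1_unit X \<in> based_g_maps G X (smash (dspace 1) X)"
  unfolding F1_unit_def
  by (rule bmap_in[OF X based_g_space_smash[OF based_g_space_dspace X] continuous_map_wcls[OF X]])
     (simp_all add: act_wcls[OF X])

lemma mor_F1_unit: "x \<in> pts X \<Longrightarrow> mor (F1_unit X) x = wcls 1 X 1 x"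
  by (simp add: F1_unit_def mor_bmap)

lemma free_on_F1:
  fixes X :: "('g, 'u) bspace"
  assumes X: "based_g_space G X"
  shows "free_on G (F1_space G X) X (F1_unit X)"
  unfolding free_on_def
proof (intro conjI allI ballI impI)
  show F: "fg_space (GTop G) (F1_space G X)" by (rule fg_space_F1[OF X])
  show "F1_unit X \<in> based_g_maps G X (fo (F1_space G X) 1)" using F1_unit_in[OF X] by simp
  fix n w assume "w \<in> pts (fo (F1_space G X) n)"
  then obtain i x where ix: "i \<le> n" "x \<in> pts X" "w = wcls n X i x"
    unfolding fo_F1 by (rule pts_wedgeE)
  have "mor (fa (F1_space G X) (iota n i)) (mor (F1_unit X) x) = w"
    unfolding mor_F1_unit[OF ix(2)] mor_fa_F1[OF X iota_in[OF ix(1)] le_refl ix(2)] ix(3)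
    by (simp add: iota_def fmap_def)
  then show "\<exists>i\<le>n. \<exists>x\<in>pts X. w = mor (fa (F1_space G X) (iota n i)) (mor (F1_unit X) x)"
    using ix(1,2) by metis
next
  fix Z f assume "fg_space (GTop G) Z \<and> f \<in> based_g_maps G X (fo Z 1)"
  then have Z: "fg_space (GTop G) Z" and f: "f \<in> based_g_maps G X (fo Z 1)" by auto
  \<comment> \<open>Naturality along \<open>iota n i\<close> forces this formula. The index is
    decoded from the representative, so the base point class gets index 0, which is harmless by
    \<open>mor_fa_iota_0\<close>.\<close>
  define h where "h n z = mor (fa Z (iota n (inv_into UNIV unat (ufst z)))) (mor f (usnd z))" for n z
  have ptf: "mor f (pt X) = pt (fo Z 1)" by (rule based_g_mapsD(7)[OF f])
  have fx: "mor f x \<in> pts (fo Z 1)" if "x \<in> pts X" for x using based_g_mapsD(9)[OF f that] .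
  have h: "h n (wcls n X i x) = mor (fa Z (iota n i)) (mor f x)" if "i \<le> n" "x \<in> pts X" for n i x
  proof -
    have "mor (fa Z (iota n i)) (pt (fo Z 1)) = pt (fo Z n)" if "i \<le> n" for i
      using based_g_mapsD(7)[OF fg_spaceD(2)[OF Z iota_in[OF that]]] .
    moreover have "mor (fa Z (iota n 0)) (mor f x) = pt (fo Z n)"
      using mor_fa_iota_0[OF Z fx] \<open>x \<in> pts X\<close> by blast
    ultimately show ?thesis
      using \<open>i \<le> n\<close> ptf unfolding h_def by (auto simp: smash_cls_def pt_smash simp flip: wcls_0[of n X x])
  qed
  let ?\<theta> = "\<lparr>src = F1_space G X, tgt = Z, mor = (\<lambda>n. bmap (smash (dspace n) X) (fo Z n) (h n))\<rparr>"
  have \<theta>: "mor (mor ?\<theta> n) (wcls n X i x) = mor (fa Z (iota n i)) (mor f x)"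
    if "i \<le> n" "x \<in> pts X" for n i x
    using h[OF that] wcls_in[OF that] by (simp add: mor_bmap del: wcls_0)
  have "?\<theta> \<in> fg_maps G (F1_space G X) Z"
  proof (rule fg_mapsI[OF fg_space_F1[OF X] Z])
    fix n
    have "bmap (smash (dspace n) X) (fo Z n) (h n) \<in> based_g_maps G (smash (dspace n) X) (fo Z n)"
    proof (rule bmap_smash_in[OF based_g_space_dspace X fg_spaceD(1)[OF Z]])
      show "continuous_map (spc (smash (dspace n) X)) (spc (fo Z n)) (h n)"
      proof (rule continuous_map_from_wedge)
        fix i assume i: "i \<le> n"
        have "continuous_map (spc X) (spc (fo Z n)) (\<lambda>x. mor (fa Z (iota n i)) (mor f x))"
          using continuous_map_compose[OF based_g_mapsD(6)[OF f]
              based_g_mapsD(6)[OF fg_spaceD(2)[OF Z iota_in[OF i]]]] by (simp add: comp_def)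
        then show "continuous_map (spc X) (spc (fo Z n)) (\<lambda>x. h n (wcls n X i x))"
          by (rule continuous_map_eq) (rule h[OF i, symmetric])
      qed
      show "h n (smash_cls (dspace n) X (pt (dspace n)) (pt X)) = pt (fo Z n)"
        using h[of 0 n "pt X"] mor_fa_iota_0[OF Z fx] based_g_spaceD(3)[OF X] by simp
      fix g y x assume g: "g \<in> carrier G" and x: "x \<in> pts X" and "y \<in> pts (dspace n :: ('g, 'u) bspace)"
      then obtain i where i: "i \<le> n" "y = unat i" by auto
      show "h n (smash_cls (dspace n) X (act (dspace n) g y) (act X g x))
          = act (fo Z n) g (h n (smash_cls (dspace n) X y x))"
        unfolding i(2) act_dspace[OF i(1)] h[OF i(1) x] h[OF i(1) based_g_spaceD(4)[OF X g x]]
          based_g_mapsD(8)[OF f g x] based_g_mapsD(8)[OF fg_spaceD(2)[OF Z iota_in[OF i(1)]] g fx[OF x]] ..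
    qed
    then show "mor ?\<theta> n \<in> based_g_maps G (fo (F1_space G X) n) (fo Z n)" by simp
  next
    fix m n k x assume k: "k \<in> Hom Fcat m n" and "x \<in> pts (fo (F1_space G X) m)"
    then obtain i a where ia: "i \<le> m" "a \<in> pts X" "x = wcls m X i a"
      unfolding fo_F1 by (elim pts_wedgeE)
    show "mor (mor ?\<theta> n) (mor (fa (F1_space G X) k) x) = mor (fa Z k) (mor (mor ?\<theta> m) x)"
      unfolding ia(3) mor_fa_F1[OF X k ia(1,2)] \<theta>[OF ia(1,2)] \<theta>[OF Fcat_HomD(4)[OF k ia(1)] ia(2)]
        mor_fa_iota[OF Z k ia(1) fx[OF ia(2)]] ..
  qed simp_all
  moreover have "mor (mor ?\<theta> 1) (mor (F1_unit X) x) = mor f x" if x: "x \<in> pts X" for x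
    unfolding mor_F1_unit[OF x] \<theta>[OF le_refl x] mor_fa_iota_1[OF Z fx[OF x]] ..
  ultimately show "\<exists>\<theta>\<in>fg_maps G (F1_space G X) Z. \<forall>x\<in>pts X. mor (mor \<theta> 1) (mor (F1_unit X) x) = mor f x"
    by blast
qed

lemma free_on_IF: "free_on G IF (dspace 1 :: ('g, 'u) bspace) (Ident (GTop G) (dspace 1))"
  unfolding free_on_def
proof (intro conjI allI ballI impI)
  let ?S = "dspace 1 :: ('g, 'u) bspace"
  let ?e = "Ident (GTop G) ?S"
  show "fg_space (GTop G) (IF :: ('g, 'u) fspace)" by (rule fg_space_IF)
  show "?e \<in> based_g_maps G ?S (fo IF 1)" using gident_in[OF based_g_space_dspace] by simp
  have e: "mor ?e (unat i) = unat i" if "i \<le> 1" for i using that by (intro mor_gident) simp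
  fix n and w :: 'u assume "w \<in> pts (fo IF n :: ('g, 'u) bspace)"
  then obtain i where i: "i \<le> n" "w = unat i" by auto
  have "mor (fa IF (iota n i) :: ('g, 'u) bmap) (mor ?e (unat 1)) = w"
    unfolding e[OF le_refl] mor_fa_IF[OF iota_in[OF i(1)] le_refl] i(2) by (simp add: iota_def fmap_def)
  then show "\<exists>i\<le>n. \<exists>a\<in>pts ?S. w = mor (fa IF (iota n i) :: ('g, 'u) bmap) (mor ?e a)"
    using i(1) by (intro exI[of _ i] conjI bexI[of _ "unat 1"]) auto
next
  let ?S = "dspace 1 :: ('g, 'u) bspace"
  let ?e = "Ident (GTop G) ?S"
  fix Z :: "('g, 'u) fspace" and f assume "fg_space (GTop G) Z \<and> f \<in> based_g_maps G ?S (fo Z 1)"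
  then have Z: "fg_space (GTop G) Z" and f: "f \<in> based_g_maps G ?S (fo Z 1)" by auto
  \<comment> \<open>A based map from the two-point space is determined by its value at the nonbase
    point, which therefore plays the part of the generator.\<close>
  define h where "h n z = mor (fa Z (iota n (inv_into UNIV unat z))) (mor f (unat 1))" for n and z :: 'u
  have f1: "mor f (unat 1) \<in> pts (fo Z 1)" by (rule based_g_mapsD(9)[OF f]) simp
  have h: "h n (unat i) = mor (fa Z (iota n i)) (mor f (unat 1))" for n i by (simp add: h_def)
  let ?\<theta> = "\<lparr>src = IF, tgt = Z, mor = (\<lambda>n. bmap (dspace n) (fo Z n) (h n))\<rparr>"
  have \<theta>: "mor (mor ?\<theta> n) (unat i) = mor (fa Z (iota n i)) (mor f (unat 1))" if "i \<le> n" for n i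
    using that by (simp add: mor_bmap h)
  have "?\<theta> \<in> fg_maps G IF Z"
  proof (rule fg_mapsI[OF fg_space_IF Z])
    fix n
    have hin: "h n (unat i) \<in> pts (fo Z n)" if "i \<le> n" for i
      unfolding h by (rule mor_fa_in[OF Z iota_in[OF that] f1])
    have "bmap (dspace n) (fo Z n) (h n) \<in> based_g_maps G (dspace n) (fo Z n)"
    proof (rule bmap_in[OF based_g_space_dspace fg_spaceD(1)[OF Z]])
      show "continuous_map (spc (dspace n :: ('g, 'u) bspace)) (spc (fo Z n)) (h n)"
        using hin by (auto simp: dspace_def)
      show "h n (pt (dspace n)) = pt (fo Z n)" using mor_fa_iota_0[OF Z f1] by (simp add: h)
      fix g and x :: 'u assume g: "g \<in> carrier G" and "x \<in> pts (dspace n :: ('g, 'u) bspace)"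
      then obtain i where i: "i \<le> n" "x = unat i" by auto
      \<comment> \<open>The group acts trivially on the two-point space, so the image of its nonbase
        point is a fixed point; equivariance of \<open>h n\<close> depends on this.\<close>
      have "act (fo Z 1) g (mor f (unat 1)) = mor f (unat 1)"
        using based_g_mapsD(8)[OF f g, of "unat 1"] by (simp add: act_dspace)
      then show "h n (act (dspace n) g x) = act (fo Z n) g (h n x)"
        unfolding i(2) act_dspace[OF i(1)] h
        using based_g_mapsD(8)[OF fg_spaceD(2)[OF Z iota_in[OF i(1)]] g f1] by simp
    qed
    then show "mor ?\<theta> n \<in> based_g_maps G (fo IF n) (fo Z n)" by simp
  next
    fix m n k and x :: 'u assume k: "k \<in> Hom Fcat m n" and "x \<in> pts (fo IF m :: ('g, 'u) bspace)"
    then obtain i where i: "i \<le> m" "x = unat i" by auto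
    show "mor (mor ?\<theta> n) (mor (fa IF k :: ('g, 'u) bmap) x) = mor (fa Z k) (mor (mor ?\<theta> m) x)"
      unfolding i(2) mor_fa_IF[OF k i(1)] \<theta>[OF i(1)] \<theta>[OF Fcat_HomD(4)[OF k i(1)]]
        mor_fa_iota[OF Z k i(1) f1] ..
  qed simp_all
  moreover have "mor (mor ?\<theta> 1) (mor ?e a) = mor f a" if "a \<in> pts ?S" for a
  proof -
    obtain i where i: "i \<le> 1" "a = unat i" using \<open>a \<in> pts ?S\<close> by auto
    have e: "mor ?e (unat i) = unat i" using i(1) by (intro mor_gident) simp
    have val: "mor (mor ?\<theta> 1) (mor ?e a) = mor (fa Z (iota 1 i)) (mor f (unat 1))"
      unfolding i(2) e \<theta>[OF i(1)] ..
    show ?thesis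
    proof (cases "i = 0")
      case True
      have "mor f (unat 0) = pt (fo Z 1)" using based_g_mapsD(7)[OF f] by simp
      then show ?thesis
        unfolding val unfolding i(2) True mor_fa_iota_0[OF Z f1] by simp
    next
      case False
      then have "i = 1" using i(1) by simp
      then show ?thesis
        unfolding val using i(2) mor_fa_iota_1[OF Z f1] by simp
    qed
  qed
  ultimately show "\<exists>\<theta>\<in>fg_maps G IF Z. \<forall>a\<in>pts ?S. mor (mor \<theta> 1) (mor ?e a) = mor f a"
    by blast
qed

end

section \<open>Day convolution of free \<open>F\<close>-\<open>G\<close>-spaces\<close>

text \<open>The universal pairing on codes: ((i, x), (j, y)) goes to the class of (x, y) in the copy
  whose index is the lexicographic position of (i, j).\<close>

definition F1_pair_fun :: "('g, 'u) bspace \<Rightarrow> ('g, 'u) bspace \<Rightarrow> nat \<Rightarrow> nat \<Rightarrow> 'u \<Rightarrow> 'u" where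
  "F1_pair_fun X Y m n z = wcls (m * n) (smash X Y)
     (lexpos n (inv_into UNIV unat (ufst (ufst z))) (inv_into UNIV unat (ufst (usnd z))))
     (smash_cls X Y (usnd (ufst z)) (usnd (usnd z)))"

definition F1_pair :: "('g, 'u) bspace \<Rightarrow> ('g, 'u) bspace \<Rightarrow> nat \<Rightarrow> nat \<Rightarrow> ('g, 'u) bmap" where
  "F1_pair X Y m n = bmap (smash (smash (dspace m) X) (smash (dspace n) Y))
     (smash (dspace (m * n)) (smash X Y)) (F1_pair_fun X Y m n)"

text \<open>The generating map of a convolution of free objects, built from the generating maps of
  the two factors. Iterating it gives generators of iterated convolutions.\<close>

definition day_gen :: "('g, 'r) monoid_scheme \<Rightarrow> ('g, 'u) fspace \<Rightarrow> ('g, 'u) fspace \<Rightarrow>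
    ('g, 'u) bmap \<Rightarrow> ('g, 'u) bmap \<Rightarrow> ('g, 'u) bmap" where
  "day_gen G W W' e e' = gcomp G (dayin G W W' 1 1) (smash_map e e')"

lemma pairing_in:
  "pairing G X Y Z \<beta> \<Longrightarrow> \<beta> m n \<in> based_g_maps G (smash (fo X m) (fo Y n)) (fo Z (m * n))"
  by (simp add: pairing_def)

lemma left_KanD:
  assumes "left_Kan G X Y W \<eta>"
  shows "fg_space (GTop G) W" "pairing G X Y W \<eta>"
    "fg_space (GTop G) Z \<Longrightarrow> pairing G X Y Z \<beta> \<Longrightarrow>
      \<exists>!\<theta>. \<theta> \<in> fg_maps G W Z \<and> (\<forall>m n. gcomp G (mor \<theta> (m * n)) (\<eta> m n) = \<beta> m n)"
  using assms unfolding left_Kan_def by simp_all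

context gspaces
begin

section \<open>Pairings and their values on generators\<close>

lemma pairing_nat:
  fixes X Y Z :: "('g, 'u) fspace"
  assumes \<beta>: "pairing G X Y Z \<beta>" and X: "fg_space (GTop G) X" and Y: "fg_space (GTop G) Y"
    and f: "f \<in> Hom Fcat m m'" and g: "g \<in> Hom Fcat n n'" and x: "x \<in> pts (fo X m)" and y: "y \<in> pts (fo Y n)"
  shows "mor (\<beta> m' n') (smash_cls (fo X m') (fo Y n') (mor (fa X f) x) (mor (fa Y g) y))
    = mor (fa Z (TenA Fcat f g)) (mor (\<beta> m n) (smash_cls (fo X m) (fo Y n) x y))"
proof -
  let ?p = "smash_cls (fo X m) (fo Y n) x y"
  have p: "?p \<in> pts (smash (fo X m) (fo Y n))" using x y by (rule smash_cls_in)
  have eq: "gcomp G (\<beta> m' n') (smash_map (fa X f) (fa Y g)) = gcomp G (fa Z (TenA Fcat f g)) (\<beta> m n)"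
    using \<beta> f g by (simp add: pairing_def)
  note fX = fg_spaceD(2)[OF X f] and gY = fg_spaceD(2)[OF Y g]
  have "mor (gcomp G (\<beta> m' n') (smash_map (fa X f) (fa Y g))) ?p
      = mor (\<beta> m' n') (smash_cls (fo X m') (fo Y n') (mor (fa X f) x) (mor (fa Y g) y))"
    unfolding mor_gcomp[OF smash_map_in[OF fX gY] p] mor_smash_map[OF fX gY x y] ..
  then show ?thesis unfolding eq mor_gcomp[OF pairing_in[OF \<beta>] p] by (rule sym)
qed

lemma pairing_gen:
  fixes X Y Z :: "('g, 'u) fspace"
  assumes \<beta>: "pairing G X Y Z \<beta>" and X: "fg_space (GTop G) X" and Y: "fg_space (GTop G) Y"
    and ij: "i \<le> m" "j \<le> n" and x: "x \<in> pts (fo X 1)" and y: "y \<in> pts (fo Y 1)"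
  shows "mor (\<beta> m n) (smash_cls (fo X m) (fo Y n) (mor (fa X (iota m i)) x) (mor (fa Y (iota n j)) y))
    = mor (fa Z (iota (m * n) (lexpos n i j))) (mor (\<beta> 1 1) (smash_cls (fo X 1) (fo Y 1) x y))"
  using pairing_nat[OF \<beta> X Y iota_in[OF ij(1)] iota_in[OF ij(2)] x y] unfolding TenA_iota[OF ij] .

lemma pairingI:
  fixes X Y Z :: "('g, 'u) fspace"
  assumes X: "fg_space (GTop G) X" and Y: "fg_space (GTop G) Y" and Z: "fg_space (GTop G) Z"
    and in': "\<And>m n. \<beta> m n \<in> based_g_maps G (smash (fo X m) (fo Y n)) (fo Z (m * n))"
    and nat: "\<And>m m' n n' f g x y. f \<in> Hom Fcat m m' \<Longrightarrow> g \<in> Hom Fcat n n' \<Longrightarrow>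
      x \<in> pts (fo X m) \<Longrightarrow> y \<in> pts (fo Y n) \<Longrightarrow>
      mor (\<beta> m' n') (smash_cls (fo X m') (fo Y n') (mor (fa X f) x) (mor (fa Y g) y))
        = mor (fa Z (TenA Fcat f g)) (mor (\<beta> m n) (smash_cls (fo X m) (fo Y n) x y))"
  shows "pairing G X Y Z \<beta>"
  unfolding pairing_def
proof (intro conjI allI ballI; simp?)
  show "\<beta> m n \<in> based_g_maps G (smash (fo X m) (fo Y n)) (fo Z (m * n))" for m n by (rule in')
  fix m m' n n' f g assume f: "f \<in> Hom Fcat m m'" and g: "g \<in> Hom Fcat n n'"
  note fX = fg_spaceD(2)[OF X f] and gY = fg_spaceD(2)[OF Y g]
  show "gcomp G (\<beta> m' n') (smash_map (fa X f) (fa Y g)) = gcomp G (fa Z (TenA Fcat f g)) (\<beta> m n)"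
  proof (rule based_g_maps_eqI[OF gcomp_in[OF smash_map_in[OF fX gY] in']
        gcomp_in[OF in' fg_spaceD(2)[OF Z TenA_in[OF f g]]]])
    fix p assume p: "p \<in> pts (smash (fo X m) (fo Y n))"
    then obtain x y where xy: "x \<in> pts (fo X m)" "y \<in> pts (fo Y n)" "p = smash_cls (fo X m) (fo Y n) x y"
      by (rule pts_smashE)
    show "mor (gcomp G (\<beta> m' n') (smash_map (fa X f) (fa Y g))) p
        = mor (gcomp G (fa Z (TenA Fcat f g)) (\<beta> m n)) p"
      unfolding mor_gcomp[OF smash_map_in[OF fX gY] p] mor_gcomp[OF in' p]
      unfolding xy(3) mor_smash_map[OF fX gY xy(1,2)] by (rule nat[OF f g xy(1,2)])
  qed
qed

lemma F1_pair_raw: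
  fixes X Y :: "('g, 'u) bspace"
  shows "F1_pair_fun X Y m n (smash_cls (smash (dspace m) X) (smash (dspace n) Y) (wcls m X i x) (wcls n Y j y))
    = wcls (m * n) (smash X Y) (lexpos n i j) (smash_cls X Y x y)"
    (is "F1_pair_fun X Y m n ?z = _")
proof (cases "i = 0 \<or> x = pt X \<or> j = 0 \<or> y = pt Y")
  \<comment> \<open>Base points carry index 0 and \<open>lexpos\<close> sends it to 0, so decoding
    the collapsed representative still gives the base point.\<close>
  case True
  then have "?z = upair (pt (smash (dspace m) X)) (pt (smash (dspace n) Y))"
    unfolding smash_cls_def[of "smash (dspace m) X"] by auto
  moreover have "wcls (m * n) (smash X Y) (lexpos n i j) (smash_cls X Y x y) = pt (smash (dspace (m * n)) (smash X Y))"
    using True by auto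
  moreover have "pt (smash (dspace m) X) = upair (unat 0) (pt X)" "pt (smash (dspace n) Y) = upair (unat 0) (pt Y)"
    by (simp_all add: pt_smash smash_cls_def del: smash_cls_pt)
  ultimately show ?thesis by (simp add: F1_pair_fun_def)
next
  case False
  then have "?z = upair (upair (unat i) x) (upair (unat j) y)"
    by (simp add: smash_cls_def pt_smash)
  then show ?thesis by (simp add: F1_pair_fun_def)
qed

lemma mor_F1_pair:
  fixes X Y :: "('g, 'u) bspace"
  assumes "i \<le> m" "j \<le> n" "x \<in> pts X" "y \<in> pts Y"
  shows "mor (F1_pair X Y m n)
      (smash_cls (smash (dspace m) X) (smash (dspace n) Y) (wcls m X i x) (wcls n Y j y))
    = wcls (m * n) (smash X Y) (lexpos n i j) (smash_cls X Y x y)"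
  unfolding F1_pair_def mor_bmap[OF smash_cls_in[OF wcls_in[OF assms(1,3)] wcls_in[OF assms(2,4)]]]
  by (rule F1_pair_raw)

lemma F1_pair_in:
  fixes X Y :: "('g, 'u) bspace"
  assumes X: "based_g_space G X" and Y: "based_g_space G Y"
  shows "F1_pair X Y m n \<in> based_g_maps G (smash (smash (dspace m) X) (smash (dspace n) Y))
    (smash (dspace (m * n)) (smash X Y))"
  unfolding F1_pair_def
proof (rule bmap_smash_in)
  let ?mX = "smash (dspace m) X" and ?nY = "smash (dspace n) Y"
  note XY = based_g_space_smash[OF X Y]
  note raw = F1_pair_raw
  show "based_g_space G ?mX" "based_g_space G ?nY" "based_g_space G (smash (dspace (m * n)) (smash X Y))"
    using X Y by simp_all
  let ?h = "F1_pair_fun X Y m n"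
  show "continuous_map (spc (smash ?mX ?nY)) (spc (smash (dspace (m * n)) (smash X Y))) ?h"
    by (rule continuous_map_from_smash_wedges[OF X Y continuous_map_wcls[OF XY lexpos_le] raw])
  show "?h (smash_cls ?mX ?nY (pt ?mX) (pt ?nY)) = pt (smash (dspace (m * n)) (smash X Y))"
    using raw[of X Y m n 0 "pt X" 0 "pt Y"] by simp
  fix g v w assume g: "g \<in> carrier G" and v: "v \<in> pts ?mX" and w: "w \<in> pts ?nY"
  obtain i x where ix: "i \<le> m" "x \<in> pts X" "v = wcls m X i x" using v by (rule pts_wedgeE)
  obtain j y where jy: "j \<le> n" "y \<in> pts Y" "w = wcls n Y j y" using w by (rule pts_wedgeE)
  show "?h (smash_cls ?mX ?nY (act ?mX g v) (act ?nY g w))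
      = act (smash (dspace (m * n)) (smash X Y)) g (?h (smash_cls ?mX ?nY v w))"
    unfolding ix(3) jy(3) act_wcls[OF X g ix(1,2)] act_wcls[OF Y g jy(1,2)] raw
      act_wcls[OF XY g lexpos_le[OF ix(1) jy(1)] smash_cls_in[OF ix(2) jy(2)]]
      act_smash[OF X Y g ix(2) jy(2)] ..
qed

lemma pairing_F1:
  fixes X Y :: "('g, 'u) bspace"
  assumes X: "based_g_space G X" and Y: "based_g_space G Y"
  shows "pairing G (F1_space G X) (F1_space G Y) (F1_space G (smash X Y)) (F1_pair X Y)"
proof (rule pairingI)
  note XY = based_g_space_smash[OF X Y]
  show "fg_space (GTop G) (F1_space G X)" "fg_space (GTop G) (F1_space G Y)"
    "fg_space (GTop G) (F1_space G (smash X Y))"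
    using X Y by (simp_all add: fg_space_F1)
  show "F1_pair X Y m n \<in> based_g_maps G (smash (fo (F1_space G X) m) (fo (F1_space G Y) n))
      (fo (F1_space G (smash X Y)) (m * n))" for m n
    using F1_pair_in[OF X Y] by simp
  fix m m' n n' f g v w
  assume f: "f \<in> Hom Fcat m m'" and g: "g \<in> Hom Fcat n n'"
    and v: "v \<in> pts (fo (F1_space G X) m)" and w: "w \<in> pts (fo (F1_space G Y) n)"
  obtain i x where ix: "i \<le> m" "x \<in> pts X" "v = wcls m X i x"
    using v unfolding fo_F1 by (rule pts_wedgeE)
  obtain j y where jy: "j \<le> n" "y \<in> pts Y" "w = wcls n Y j y"
    using w unfolding fo_F1 by (rule pts_wedgeE)
  show "mor (F1_pair X Y m' n') (smash_cls (fo (F1_space G X) m') (fo (F1_space G Y) n')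
        (mor (fa (F1_space G X) f) v) (mor (fa (F1_space G Y) g) w))
      = mor (fa (F1_space G (smash X Y)) (TenA Fcat f g))
        (mor (F1_pair X Y m n) (smash_cls (fo (F1_space G X) m) (fo (F1_space G Y) n) v w))"
    unfolding ix(3) jy(3) fo_F1 mor_fa_F1[OF X f ix(1,2)] mor_fa_F1[OF Y g jy(1,2)]
      mor_F1_pair[OF ix(1) jy(1) ix(2) jy(2)]
      mor_F1_pair[OF Fcat_HomD(4)[OF f ix(1)] Fcat_HomD(4)[OF g jy(1)] ix(2) jy(2)]
      mor_fa_F1[OF XY TenA_in[OF f g] lexpos_le[OF ix(1) jy(1)] smash_cls_in[OF ix(2) jy(2)]]
      mor_TenA[OF f g ix(1) jy(1)] ..
qed

lemma pairing_precomp: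
  fixes X Y Z W W' :: "('g, 'u) fspace"
  assumes \<beta>: "pairing G X Y Z \<beta>" and Z: "fg_space (GTop G) Z"
    and \<kappa>: "\<kappa> \<in> fg_maps G W X" and \<kappa>': "\<kappa>' \<in> fg_maps G W' Y"
  shows "pairing G W W' Z (\<lambda>m n. gcomp G (\<beta> m n) (smash_map (mor \<kappa> m) (mor \<kappa>' n)))"
proof (rule pairingI[OF fg_mapsD(3)[OF \<kappa>] fg_mapsD(3)[OF \<kappa>'] Z])
  show "gcomp G (\<beta> m n) (smash_map (mor \<kappa> m) (mor \<kappa>' n))
      \<in> based_g_maps G (smash (fo W m) (fo W' n)) (fo Z (m * n))" for m n
    by (rule gcomp_in[OF smash_map_in[OF fg_mapsD(5)[OF \<kappa>] fg_mapsD(5)[OF \<kappa>']] pairing_in[OF \<beta>]])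
  have eval: "mor (gcomp G (\<beta> m n) (smash_map (mor \<kappa> m) (mor \<kappa>' n))) (smash_cls (fo W m) (fo W' n) x y)
      = mor (\<beta> m n) (smash_cls (fo X m) (fo Y n) (mor (mor \<kappa> m) x) (mor (mor \<kappa>' n) y))"
    if "x \<in> pts (fo W m)" "y \<in> pts (fo W' n)" for m n x y
    unfolding mor_gcomp[OF smash_map_in[OF fg_mapsD(5)[OF \<kappa>] fg_mapsD(5)[OF \<kappa>']] smash_cls_in[OF that]]
      mor_smash_map[OF fg_mapsD(5)[OF \<kappa>] fg_mapsD(5)[OF \<kappa>'] that] ..
  fix m m' n n' f g x y
  assume f: "f \<in> Hom Fcat m m'" and g: "g \<in> Hom Fcat n n'"
    and x: "x \<in> pts (fo W m)" and y: "y \<in> pts (fo W' n)"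
  show "mor (gcomp G (\<beta> m' n') (smash_map (mor \<kappa> m') (mor \<kappa>' n')))
        (smash_cls (fo W m') (fo W' n') (mor (fa W f) x) (mor (fa W' g) y))
      = mor (fa Z (TenA Fcat f g))
        (mor (gcomp G (\<beta> m n) (smash_map (mor \<kappa> m) (mor \<kappa>' n))) (smash_cls (fo W m) (fo W' n) x y))"
    unfolding eval[OF x y] eval[OF mor_fa_in[OF fg_mapsD(3)[OF \<kappa>] f x] mor_fa_in[OF fg_mapsD(3)[OF \<kappa>'] g y]]
      fg_maps_nat[OF \<kappa> f x] fg_maps_nat[OF \<kappa>' g y]
    by (rule pairing_nat[OF \<beta> fg_mapsD(4)[OF \<kappa>] fg_mapsD(4)[OF \<kappa>'] f g mor_mor_in[OF \<kappa> x] mor_mor_in[OF \<kappa>' y]])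
qed

lemma mor_pairing_precomp:
  fixes X Y Z W W' :: "('g, 'u) fspace"
  assumes "\<kappa> \<in> fg_maps G W X" "\<kappa>' \<in> fg_maps G W' Y" "x \<in> pts (fo W m)" "y \<in> pts (fo W' n)"
  shows "mor (gcomp G \<beta> (smash_map (mor \<kappa> m) (mor \<kappa>' n))) (smash_cls (fo W m) (fo W' n) x y)
      = mor \<beta> (smash_cls (fo X m) (fo Y n) (mor (mor \<kappa> m) x) (mor (mor \<kappa>' n) y))"
  unfolding mor_gcomp[OF smash_map_in[OF fg_mapsD(5)[OF assms(1)] fg_mapsD(5)[OF assms(2)]]
      smash_cls_in[OF assms(3,4)]]
    mor_smash_map[OF fg_mapsD(5)[OF assms(1)] fg_mapsD(5)[OF assms(2)] assms(3,4)] ..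

lemma pairing_postcomp:
  fixes X Y Z Z' :: "('g, 'u) fspace"
  assumes \<beta>: "pairing G X Y Z \<beta>" and X: "fg_space (GTop G) X" and Y: "fg_space (GTop G) Y"
    and \<theta>: "\<theta> \<in> fg_maps G Z Z'"
  shows "pairing G X Y Z' (\<lambda>m n. gcomp G (mor \<theta> (m * n)) (\<beta> m n))"
proof (rule pairingI[OF X Y fg_mapsD(4)[OF \<theta>]])
  show "gcomp G (mor \<theta> (m * n)) (\<beta> m n) \<in> based_g_maps G (smash (fo X m) (fo Y n)) (fo Z' (m * n))" for m n
    by (rule gcomp_in[OF pairing_in[OF \<beta>] fg_mapsD(5)[OF \<theta>]])
  fix m m' n n' f g x y
  assume f: "f \<in> Hom Fcat m m'" and g: "g \<in> Hom Fcat n n'"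
    and x: "x \<in> pts (fo X m)" and y: "y \<in> pts (fo Y n)"
  note p = smash_cls_in[OF x y]
  note p' = smash_cls_in[OF mor_fa_in[OF X f x] mor_fa_in[OF Y g y]]
  show "mor (gcomp G (mor \<theta> (m' * n')) (\<beta> m' n'))
        (smash_cls (fo X m') (fo Y n') (mor (fa X f) x) (mor (fa Y g) y))
      = mor (fa Z' (TenA Fcat f g))
        (mor (gcomp G (mor \<theta> (m * n)) (\<beta> m n)) (smash_cls (fo X m) (fo Y n) x y))"
    unfolding mor_gcomp[OF pairing_in[OF \<beta>] p] mor_gcomp[OF pairing_in[OF \<beta>] p']
      pairing_nat[OF \<beta> X Y f g x y]
    by (rule fg_maps_nat[OF \<theta> TenA_in[OF f g] based_g_mapsD(9)[OF pairing_in[OF \<beta>] p]])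
qed

lemma pairing_eqI:
  fixes W W' Z :: "('g, 'u) fspace"
  assumes W: "free_on G W A e" and W': "free_on G W' B e'"
    and \<beta>: "pairing G W W' Z \<beta>" and \<beta>': "pairing G W W' Z \<beta>'"
    and eq: "\<And>a b. a \<in> pts A \<Longrightarrow> b \<in> pts B \<Longrightarrow>
      mor (\<beta> 1 1) (smash_cls (fo W 1) (fo W' 1) (mor e a) (mor e' b))
        = mor (\<beta>' 1 1) (smash_cls (fo W 1) (fo W' 1) (mor e a) (mor e' b))"
  shows "\<beta> m n = \<beta>' m n"
proof (rule based_g_maps_eqI[OF pairing_in[OF \<beta>] pairing_in[OF \<beta>']])
  fix p assume "p \<in> pts (smash (fo W m) (fo W' n))"
  then obtain w w' where w: "w \<in> pts (fo W m)" and w': "w' \<in> pts (fo W' n)"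
    and p: "p = smash_cls (fo W m) (fo W' n) w w'" by (rule pts_smashE)
  obtain i a where ia: "i \<le> m" "a \<in> pts A" "w = mor (fa W (iota m i)) (mor e a)"
    by (rule free_on_gen[OF W w])
  obtain j b where jb: "j \<le> n" "b \<in> pts B" "w' = mor (fa W' (iota n j)) (mor e' b)"
    by (rule free_on_gen[OF W' w'])
  note g = free_onD(1)[OF W] free_onD(1)[OF W'] ia(1) jb(1) free_onD(4)[OF W ia(2)] free_onD(4)[OF W' jb(2)]
  show "mor (\<beta> m n) p = mor (\<beta>' m n) p"
    unfolding p ia(3) jb(3) pairing_gen[OF \<beta> g] pairing_gen[OF \<beta>' g] eq[OF ia(2) jb(2)] ..
qed

text \<open>The explicit model of the Kan extension for arbitrary free objects. It comes with its
  value on generators, so that other Kan extensions can be compared with it.\<close>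

lemma left_Kan_F1:
  fixes W W' :: "('g, 'u) fspace"
  assumes W: "free_on G W A e" and W': "free_on G W' B e'"
  obtains \<eta> where "left_Kan G W W' (F1_space G (smash A B)) \<eta>"
    "\<And>a b. a \<in> pts A \<Longrightarrow> b \<in> pts B \<Longrightarrow>
      mor (\<eta> 1 1) (smash_cls (fo W 1) (fo W' 1) (mor e a) (mor e' b)) = mor (F1_unit (smash A B)) (smash_cls A B a b)"
proof -
  note A = free_onD(3)[OF W] and B = free_onD(3)[OF W'] and Ws = free_onD(1)[OF W] free_onD(1)[OF W']
  note AB = based_g_space_smash[OF A B]
  note FAB = free_on_F1[OF AB]
  \<comment> \<open>The universal pairing is explicit only for \<open>F1\<close>; the comparison
    maps from \<open>W\<close> and \<open>W'\<close> pull it back to the given free objects.\<close>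
  obtain \<kappa> where \<kappa>: "\<kappa> \<in> fg_maps G W (F1_space G A)"
    "\<And>a. a \<in> pts A \<Longrightarrow> mor (mor \<kappa> 1) (mor e a) = mor (F1_unit A) a"
    using free_on_extend[OF W free_onD(1,2)[OF free_on_F1[OF A]]] by blast
  obtain \<kappa>' where \<kappa>': "\<kappa>' \<in> fg_maps G W' (F1_space G B)"
    "\<And>b. b \<in> pts B \<Longrightarrow> mor (mor \<kappa>' 1) (mor e' b) = mor (F1_unit B) b"
    using free_on_extend[OF W' free_onD(1,2)[OF free_on_F1[OF B]]] by blast
  define \<eta> where "\<eta> m n = gcomp G (F1_pair A B m n) (smash_map (mor \<kappa> m) (mor \<kappa>' n))" for m n
  have \<eta>: "pairing G W W' (F1_space G (smash A B)) \<eta>"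
    unfolding \<eta>_def by (rule pairing_precomp[OF pairing_F1[OF A B] free_onD(1)[OF FAB] \<kappa>(1) \<kappa>'(1)])
  have gen: "mor (\<eta> 1 1) (smash_cls (fo W 1) (fo W' 1) (mor e a) (mor e' b))
      = mor (F1_unit (smash A B)) (smash_cls A B a b)" if ab: "a \<in> pts A" "b \<in> pts B" for a b
    unfolding \<eta>_def mor_pairing_precomp[OF \<kappa>(1) \<kappa>'(1) free_onD(4)[OF W ab(1)] free_onD(4)[OF W' ab(2)]]
      \<kappa>(2)[OF ab(1)] \<kappa>'(2)[OF ab(2)] mor_F1_unit[OF ab(1)] mor_F1_unit[OF ab(2)] fo_F1
      mor_F1_pair[OF le_refl le_refl ab] mor_F1_unit[OF smash_cls_in[OF ab]] by simp
  have "left_Kan G W W' (F1_space G (smash A B)) \<eta>"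
    unfolding left_Kan_def Fcat_simps
  proof (intro conjI allI impI)
    show "fg_space (GTop G) (F1_space G (smash A B))" by (rule free_onD(1)[OF FAB])
    show "pairing G W W' (F1_space G (smash A B)) \<eta>" by (rule \<eta>)
    fix Z \<beta> assume "fg_space (GTop G) Z \<and> pairing G W W' Z \<beta>"
    then have Z: "fg_space (GTop G) Z" and \<beta>: "pairing G W W' Z \<beta>" by auto
    note e2 = smash_map_in[OF free_onD(2)[OF W] free_onD(2)[OF W']]
    \<comment> \<open>Restricted to generators, the component at (1, 1) is a based G-map from
      \<open>smash A B\<close> to \<open>Z(1)\<close>, which is the datum that freeness of the model
      turns into a map.\<close>
    have "\<beta> 1 1 \<in> based_g_maps G (smash (fo W 1) (fo W' 1)) (fo Z 1)" using pairing_in[OF \<beta>, of 1 1] by simp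
    from gcomp_in[OF e2 this]
    obtain \<theta> where \<theta>: "\<theta> \<in> fg_maps G (F1_space G (smash A B)) Z"
      "\<And>p. p \<in> pts (smash A B) \<Longrightarrow> mor (mor \<theta> 1) (mor (F1_unit (smash A B)) p)
        = mor (gcomp G (\<beta> 1 1) (smash_map e e')) p"
      using free_on_extend[OF FAB Z] by blast
    have gen_in: "smash_cls (fo W 1) (fo W' 1) (mor e a) (mor e' b) \<in> pts (smash (fo W 1) (fo W' 1))"
      if "a \<in> pts A" "b \<in> pts B" for a b
      using free_onD(4)[OF W that(1)] free_onD(4)[OF W' that(2)] by (rule smash_cls_in)
    have post: "mor (gcomp G (mor \<psi> (1 * 1)) (\<eta> 1 1)) (smash_cls (fo W 1) (fo W' 1) (mor e a) (mor e' b))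
        = mor (mor \<psi> 1) (mor (F1_unit (smash A B)) (smash_cls A B a b))"
      if ab: "a \<in> pts A" "b \<in> pts B" for \<psi> :: "('g, 'u) ftrans" and a b
      unfolding mor_gcomp[OF pairing_in[OF \<eta>] gen_in[OF ab]] gen[OF ab] by simp
    show "\<exists>!\<theta>. \<theta> \<in> fg_maps G (F1_space G (smash A B)) Z \<and> (\<forall>m n. gcomp G (mor \<theta> (m * n)) (\<eta> m n) = \<beta> m n)"
    proof (rule ex1I[of _ \<theta>])
      have "gcomp G (mor \<theta> (m * n)) (\<eta> m n) = \<beta> m n" for m n
      proof (rule pairing_eqI[OF W W' pairing_postcomp[OF \<eta> Ws \<theta>(1)] \<beta>])
        fix a b assume ab: "a \<in> pts A" "b \<in> pts B"
        show "mor (gcomp G (mor \<theta> (1 * 1)) (\<eta> 1 1)) (smash_cls (fo W 1) (fo W' 1) (mor e a) (mor e' b))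
            = mor (\<beta> 1 1) (smash_cls (fo W 1) (fo W' 1) (mor e a) (mor e' b))"
          unfolding post[OF ab] \<theta>(2)[OF smash_cls_in[OF ab]] mor_gcomp[OF e2 smash_cls_in[OF ab]]
            mor_smash_map[OF free_onD(2)[OF W] free_onD(2)[OF W'] ab] ..
      qed
      then show "\<theta> \<in> fg_maps G (F1_space G (smash A B)) Z \<and> (\<forall>m n. gcomp G (mor \<theta> (m * n)) (\<eta> m n) = \<beta> m n)"
        using \<theta>(1) by blast
      fix \<psi> assume \<psi>: "\<psi> \<in> fg_maps G (F1_space G (smash A B)) Z \<and> (\<forall>m n. gcomp G (mor \<psi> (m * n)) (\<eta> m n) = \<beta> m n)"
      show "\<psi> = \<theta>"
      proof (rule free_on_eqI[OF FAB])
        show "\<psi> \<in> fg_maps G (F1_space G (smash A B)) Z" "\<theta> \<in> fg_maps G (F1_space G (smash A B)) Z"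
          using \<psi> \<theta>(1) by auto
        fix p assume "p \<in> pts (smash A B)"
        then obtain a b where ab: "a \<in> pts A" "b \<in> pts B" "p = smash_cls A B a b" by (rule pts_smashE)
        have "gcomp G (mor \<psi> (1 * 1)) (\<eta> 1 1) = gcomp G (mor \<theta> (1 * 1)) (\<eta> 1 1)"
          using \<psi> \<open>\<And>m n. gcomp G (mor \<theta> (m * n)) (\<eta> m n) = \<beta> m n\<close> by metis
        then show "mor (mor \<psi> 1) (mor (F1_unit (smash A B)) p) = mor (mor \<theta> 1) (mor (F1_unit (smash A B)) p)"
          unfolding ab(3) using post[OF ab(1,2), of \<psi>] post[OF ab(1,2), of \<theta>] by simp
      qed
    qed
  qed
  then show ?thesis using that gen by blast
qed

lemma left_Kan_eqI:
  fixes X Y D Z :: "('g, 'u) fspace"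
  assumes D: "left_Kan G X Y D \<delta>" and X: "fg_space (GTop G) X" and Y: "fg_space (GTop G) Y"
    and \<theta>: "\<theta> \<in> fg_maps G D Z" and \<theta>': "\<theta>' \<in> fg_maps G D Z"
    and eq: "\<And>m n. gcomp G (mor \<theta> (m * n)) (\<delta> m n) = gcomp G (mor \<theta>' (m * n)) (\<delta> m n)"
  shows "\<theta> = \<theta>'"
  using left_KanD(3)[OF D fg_mapsD(4)[OF \<theta>] pairing_postcomp[OF left_KanD(2)[OF D] X Y \<theta>']] \<theta> \<theta>' eq
  by blast

text \<open>The universal property determines a Kan extension up to an isomorphism respecting the
  pairings, so freeness of the explicit model passes to every other one.\<close>

lemma left_Kan_free_on:
  fixes W W' :: "('g, 'u) fspace"
  assumes W: "free_on G W A e" and W': "free_on G W' B e'" and D: "left_Kan G W W' D \<delta>"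
  shows "free_on G D (smash A B) (gcomp G (\<delta> 1 1) (smash_map e e'))"
proof -
  note Ws = free_onD(1)[OF W] free_onD(1)[OF W']
  note e2 = smash_map_in[OF free_onD(2)[OF W] free_onD(2)[OF W']]
  obtain \<eta> where \<eta>: "left_Kan G W W' (F1_space G (smash A B)) \<eta>"
    and gen: "\<And>a b. a \<in> pts A \<Longrightarrow> b \<in> pts B \<Longrightarrow>
      mor (\<eta> 1 1) (smash_cls (fo W 1) (fo W' 1) (mor e a) (mor e' b)) = mor (F1_unit (smash A B)) (smash_cls A B a b)"
    using left_Kan_F1[OF W W'] by blast
  let ?F = "F1_space G (smash A B)"
  note \<eta>D = left_KanD[OF \<eta>] and \<delta>D = left_KanD[OF D]
  \<comment> \<open>The two universal properties give maps in both directions; they are mutually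
    inverse because their composites fix the universal pairings.\<close>
  obtain \<rho> where \<rho>: "\<rho> \<in> fg_maps G ?F D" "\<And>m n. gcomp G (mor \<rho> (m * n)) (\<eta> m n) = \<delta> m n"
    using \<eta>D(3)[OF \<delta>D(1,2)] by blast
  obtain \<sigma> where \<sigma>: "\<sigma> \<in> fg_maps G D ?F" "\<And>m n. gcomp G (mor \<sigma> (m * n)) (\<delta> m n) = \<eta> m n"
    using \<delta>D(3)[OF \<eta>D(1,2)] by blast
  have comp: "gcomp G (mor (fcomp G \<psi> \<theta>) k) f = gcomp G (mor \<psi> k) (gcomp G (mor \<theta> k) f)"
    if "\<theta> \<in> fg_maps G P Q" "\<psi> \<in> fg_maps G Q R" "f \<in> based_g_maps G S (fo P k)"
    for \<psi> \<theta> :: "('g, 'u) ftrans" and P Q R k f S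
    using gcomp_assoc[OF that(3) fg_mapsD(5)[OF that(1)] fg_mapsD(5)[OF that(2)]] by (simp add: FGTop_Comp)
  have ident: "gcomp G (mor (Ident (FGTop G) P) k) f = f"
    if "fg_space (GTop G) P" "f \<in> based_g_maps G S (fo P k)" for P :: "('g, 'u) fspace" and k f S
    using gcomp_ident(2)[OF that(2)] by (simp add: FGTop_Ident)
  have \<rho>\<sigma>: "fcomp G \<rho> \<sigma> = Ident (FGTop G) D"
    by (rule left_Kan_eqI[OF D Ws fcomp_in[OF \<sigma>(1) \<rho>(1)] fident_in[OF \<delta>D(1)]])
       (simp add: comp[OF \<sigma>(1) \<rho>(1) pairing_in[OF \<delta>D(2)]] ident[OF \<delta>D(1) pairing_in[OF \<delta>D(2)]] \<rho>(2) \<sigma>(2))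
  have \<sigma>\<rho>: "fcomp G \<sigma> \<rho> = Ident (FGTop G) ?F"
    by (rule left_Kan_eqI[OF \<eta> Ws fcomp_in[OF \<rho>(1) \<sigma>(1)] fident_in[OF \<eta>D(1)]])
       (simp add: comp[OF \<rho>(1) \<sigma>(1) pairing_in[OF \<eta>D(2)]] ident[OF \<eta>D(1) pairing_in[OF \<eta>D(2)]] \<rho>(2) \<sigma>(2))
  have \<delta>1: "\<delta> 1 1 \<in> based_g_maps G (smash (fo W 1) (fo W' 1)) (fo D 1)"
    using pairing_in[OF \<delta>D(2), of 1 1] by simp
  have \<eta>1: "\<eta> 1 1 \<in> based_g_maps G (smash (fo W 1) (fo W' 1)) (fo ?F 1)"
    using pairing_in[OF \<eta>D(2), of 1 1] by simp
  show ?thesis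
  proof (rule free_on_transport[OF free_on_F1 \<rho>(1) \<sigma>(1) \<rho>\<sigma> \<sigma>\<rho> gcomp_in[OF e2 \<delta>1]])
    show "based_g_space G (smash A B)" using free_onD(3)[OF W] free_onD(3)[OF W'] by simp
    fix p assume "p \<in> pts (smash A B)"
    then obtain a b where ab: "a \<in> pts A" "b \<in> pts B" "p = smash_cls A B a b" by (rule pts_smashE)
    have q: "smash_cls (fo W 1) (fo W' 1) (mor e a) (mor e' b) \<in> pts (smash (fo W 1) (fo W' 1))"
      using free_onD(4)[OF W ab(1)] free_onD(4)[OF W' ab(2)] by (rule smash_cls_in)
    have \<delta>\<eta>: "\<delta> 1 1 = gcomp G (mor \<rho> 1) (\<eta> 1 1)" using \<rho>(2)[of 1 1] by simp
    have "mor (gcomp G (\<delta> 1 1) (smash_map e e')) p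
        = mor (\<delta> 1 1) (smash_cls (fo W 1) (fo W' 1) (mor e a) (mor e' b))"
      unfolding ab(3) mor_gcomp[OF e2 smash_cls_in[OF ab(1,2)]]
        mor_smash_map[OF free_onD(2)[OF W] free_onD(2)[OF W'] ab(1,2)] ..
    also have "\<dots> = mor (mor \<rho> 1) (mor (F1_unit (smash A B)) p)"
      unfolding \<delta>\<eta> mor_gcomp[OF \<eta>1 q] gen[OF ab(1,2)] ab(3) ..
    finally show "mor (gcomp G (\<delta> 1 1) (smash_map e e')) p = mor (mor \<rho> 1) (mor (F1_unit (smash A B)) p)" .
  qed
qed

text \<open>Existence of one Kan extension is what makes the choice in \<open>day_pair\<close>
  meaningful. From here on the explicit model is replaced by the chosen one.\<close>

lemma left_Kan_day:
  fixes W W' :: "('g, 'u) fspace"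
  assumes W: "free_on G W A e" and W': "free_on G W' B e'"
  shows "left_Kan G W W' (day G W W') (dayin G W W')"
proof -
  obtain \<eta> where "left_Kan G W W' (F1_space G (smash A B)) \<eta>" by (rule left_Kan_F1[OF W W'])
  then have "\<exists>p. left_Kan G W W' (fst p) (snd p)" by (intro exI[of _ "(F1_space G (smash A B), \<eta>)"]) simp
  then show ?thesis unfolding day_def dayin_def day_pair_def by (rule someI_ex)
qed

lemma free_on_day:
  fixes W W' :: "('g, 'u) fspace"
  assumes "free_on G W A e" "free_on G W' B e'"
  shows "free_on G (day G W W') (smash A B) (day_gen G W W' e e')"
  unfolding day_gen_def by (rule left_Kan_free_on[OF assms left_Kan_day[OF assms]])

lemma pairing_day:
  fixes W W' :: "('g, 'u) fspace"
  assumes "free_on G W A e" "free_on G W' B e'"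
  shows "pairing G W W' (day G W W') (dayin G W W')"
  by (rule left_KanD(2)[OF left_Kan_day[OF assms]])

lemma mor_day_gen:
  fixes W W' :: "('g, 'u) fspace"
  assumes W: "free_on G W A e" and W': "free_on G W' B e'" and ab: "a \<in> pts A" "b \<in> pts B"
  shows "mor (day_gen G W W' e e') (smash_cls A B a b)
    = mor (dayin G W W' 1 1) (smash_cls (fo W 1) (fo W' 1) (mor e a) (mor e' b))"
  unfolding day_gen_def mor_gcomp[OF smash_map_in[OF free_onD(2)[OF W] free_onD(2)[OF W']] smash_cls_in[OF ab]]
    mor_smash_map[OF free_onD(2)[OF W] free_onD(2)[OF W'] ab] ..

end

section \<open>The structure maps of the Day convolution on generators\<close>

context gspaces
begin

text \<open>The defining condition is the universal property of the source applied to the pairing of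
  the target precomposed with \<open>\<theta>\<close> and \<open>\<psi>\<close>. The component at
  (1, 1) then gives the value on generators.\<close>

lemma day_map_free:
  fixes W W' V V' :: "('g, 'u) fspace"
  assumes W: "free_on G W A e" and W': "free_on G W' B e'"
    and V: "free_on G V A' d" and V': "free_on G V' B' d'"
    and \<theta>: "\<theta> \<in> fg_maps G W V" and \<psi>: "\<psi> \<in> fg_maps G W' V'"
  shows "day_map G \<theta> \<psi> \<in> fg_maps G (day G W W') (day G V V')"
    and "a \<in> pts A \<Longrightarrow> b \<in> pts B \<Longrightarrow>
      mor (mor (day_map G \<theta> \<psi>) 1) (mor (day_gen G W W' e e') (smash_cls A B a b))
        = mor (dayin G V V' 1 1) (smash_cls (fo V 1) (fo V' 1) (mor (mor \<theta> 1) (mor e a)) (mor (mor \<psi> 1) (mor e' b)))"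
proof -
  note D = left_Kan_day[OF W W'] and E = left_Kan_day[OF V V']
  let ?P = "\<lambda>\<tau>. \<tau> \<in> fg_maps G (day G W W') (day G V V') \<and>
      (\<forall>m n. gcomp G (mor \<tau> (m * n)) (dayin G W W' m n)
        = gcomp G (dayin G V V' m n) (smash_map (mor \<theta> m) (mor \<psi> n)))"
  have "\<exists>!\<tau>. ?P \<tau>"
    by (rule left_KanD(3)[OF D left_KanD(1)[OF E] pairing_precomp[OF left_KanD(2)[OF E] left_KanD(1)[OF E] \<theta> \<psi>]])
  then have P: "?P (THE \<tau>. ?P \<tau>)" by (rule theI')
  have eq: "day_map G \<theta> \<psi> = (THE \<tau>. ?P \<tau>)"
    unfolding day_map_def fg_mapsD(1,2)[OF \<theta>] fg_mapsD(1,2)[OF \<psi>] by simp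
  show in': "day_map G \<theta> \<psi> \<in> fg_maps G (day G W W') (day G V V')"
    using P unfolding eq by blast
  assume ab: "a \<in> pts A" "b \<in> pts B"
  note ea = free_onD(4)[OF W ab(1)] and eb = free_onD(4)[OF W' ab(2)]
  have "gcomp G (mor (day_map G \<theta> \<psi>) (1 * 1)) (dayin G W W' 1 1)
      = gcomp G (dayin G V V' 1 1) (smash_map (mor \<theta> 1) (mor \<psi> 1))"
    using P unfolding eq by blast
  then have "mor (gcomp G (mor (day_map G \<theta> \<psi>) (1 * 1)) (dayin G W W' 1 1)) (smash_cls (fo W 1) (fo W' 1) (mor e a) (mor e' b))
      = mor (gcomp G (dayin G V V' 1 1) (smash_map (mor \<theta> 1) (mor \<psi> 1))) (smash_cls (fo W 1) (fo W' 1) (mor e a) (mor e' b))"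
    by simp
  then show "mor (mor (day_map G \<theta> \<psi>) 1) (mor (day_gen G W W' e e') (smash_cls A B a b))
      = mor (dayin G V V' 1 1) (smash_cls (fo V 1) (fo V' 1) (mor (mor \<theta> 1) (mor e a)) (mor (mor \<psi> 1) (mor e' b)))"
    unfolding mor_gcomp[OF pairing_in[OF left_KanD(2)[OF D]] smash_cls_in[OF ea eb]]
      mor_pairing_precomp[OF \<theta> \<psi> ea eb] mor_day_gen[OF W W' ab] mult_1 .
qed

text \<open>\<open>iota 1 1\<close> is an identity, and smashing with 1 leaves lexicographic
  positions unchanged. These components occur in the defining equations of the unit
  constraints.\<close>

lemma pairing_gen1:
  fixes X Y Z :: "('g, 'u) fspace"
  assumes \<beta>: "pairing G X Y Z \<beta>" and X: "fg_space (GTop G) X" and Y: "fg_space (GTop G) Y"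
    and j: "j \<le> n" and x: "x \<in> pts (fo X 1)" and y: "y \<in> pts (fo Y 1)"
  shows "mor (\<beta> 1 n) (smash_cls (fo X 1) (fo Y n) x (mor (fa Y (iota n j)) y))
      = mor (fa Z (iota n j)) (mor (\<beta> 1 1) (smash_cls (fo X 1) (fo Y 1) x y))"
    "mor (\<beta> n 1) (smash_cls (fo X n) (fo Y 1) (mor (fa X (iota n j)) x) y)
      = mor (fa Z (iota n j)) (mor (\<beta> 1 1) (smash_cls (fo X 1) (fo Y 1) x y))"
proof -
  have "lexpos n 1 j = j" "lexpos 1 j 1 = j" using j by simp_all
  then show
    "mor (\<beta> 1 n) (smash_cls (fo X 1) (fo Y n) x (mor (fa Y (iota n j)) y))
      = mor (fa Z (iota n j)) (mor (\<beta> 1 1) (smash_cls (fo X 1) (fo Y 1) x y))"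
    "mor (\<beta> n 1) (smash_cls (fo X n) (fo Y 1) (mor (fa X (iota n j)) x) y)
      = mor (fa Z (iota n j)) (mor (\<beta> 1 1) (smash_cls (fo X 1) (fo Y 1) x y))"
    using pairing_gen[OF \<beta> X Y le_refl[of 1] j x y] pairing_gen[OF \<beta> X Y j le_refl[of 1] x y]
    unfolding mor_fa_iota_1[OF X x] mor_fa_iota_1[OF Y y] mult_1 mult_1_right by metis+
qed

text \<open>Both sides of the defining equation are determined by triples of generators with indices
  i, j, k. Comparing them there shows that the condition says exactly that \<open>\<tau>\<close>
  reassociates generators.\<close>

lemma day_assoc_free:
  fixes X Y Z :: "('g, 'u) fspace"
  assumes X: "free_on G X A e" and Y: "free_on G Y B e'" and Z: "free_on G Z C e''"
  shows "day_assoc G X Y Z \<in> fg_maps G (day G (day G X Y) Z) (day G X (day G Y Z))"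
    and "a \<in> pts A \<Longrightarrow> b \<in> pts B \<Longrightarrow> c \<in> pts C \<Longrightarrow>
      mor (mor (day_assoc G X Y Z) 1)
        (mor (day_gen G (day G X Y) Z (day_gen G X Y e e') e'') (smash_cls (smash A B) C (smash_cls A B a b) c))
      = mor (day_gen G X (day G Y Z) e (day_gen G Y Z e' e'')) (smash_cls A (smash B C) a (smash_cls B C b c))"
proof -
  note XY = free_on_day[OF X Y] and YZ = free_on_day[OF Y Z]
  note S = free_on_day[OF XY Z] and T = free_on_day[OF X YZ]
  let ?D = "day G (day G X Y) Z" and ?E = "day G X (day G Y Z)"
  let ?g = "day_gen G (day G X Y) Z (day_gen G X Y e e') e''"
  let ?h = "day_gen G X (day G Y Z) e (day_gen G Y Z e' e'')"
  let ?L = "\<lambda>\<tau> m n p. gcomp G (fa ?E (Assoc Fcat m n p)) (gcomp G (mor \<tau> (m * n * p))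
      (gcomp G (dayin G (day G X Y) Z (m * n) p) (smash_map (dayin G X Y m n) (Ident (GTop G) (fo Z p)))))"
  let ?R = "\<lambda>m n p. gcomp G (dayin G X (day G Y Z) m (n * p))
      (gcomp G (smash_map (Ident (GTop G) (fo X m)) (dayin G Y Z n p)) (Assoc (GTop G) (fo X m) (fo Y n) (fo Z p)))"
  \<comment> \<open>\<open>?f\<close> is the reassociation followed by the generating map of the
    target, so it prescribes the value of the constraint on each generator.\<close>
  let ?P = "\<lambda>\<tau>. \<forall>m n p. ?L \<tau> m n p = ?R m n p" and ?f = "gcomp G ?h (Assoc (GTop G) A B C)"
  note Xs = free_onD(1)[OF X] and Ys = free_onD(1)[OF Y] and Zs = free_onD(1)[OF Z]
  note Ss = free_onD(1)[OF S] and Ts = free_onD(1)[OF T] and XYs = free_onD(1)[OF XY] and YZs = free_onD(1)[OF YZ]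
  note pXY = pairing_day[OF X Y] and pYZ = pairing_day[OF Y Z] and pS = pairing_day[OF XY Z] and pT = pairing_day[OF X YZ]
  have idX: "Ident (GTop G) (fo X m) \<in> based_g_maps G (fo X m) (fo X m)" for m
    by (rule gident_in[OF fg_spaceD(1)[OF Xs]])
  have idZ: "Ident (GTop G) (fo Z m) \<in> based_g_maps G (fo Z m) (fo Z m)" for m
    by (rule gident_in[OF fg_spaceD(1)[OF Zs]])
  have L_in: "?L \<tau> m n p \<in> based_g_maps G (smash (smash (fo X m) (fo Y n)) (fo Z p)) (fo ?E (m * n * p))"
    if "\<tau> \<in> fg_maps G ?D ?E" for \<tau> m n p
    unfolding Assoc_Fcat
    by (rule gcomp_in[OF gcomp_in[OF gcomp_in[OF smash_map_in[OF pairing_in[OF pXY] idZ] pairing_in[OF pS]]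
            fg_mapsD(5)[OF that]] fg_spaceD(2)[OF Ts Fcat_Ident_in]])
  have R_in: "?R m n p \<in> based_g_maps G (smash (smash (fo X m) (fo Y n)) (fo Z p)) (fo ?E (m * n * p))" for m n p
    using gcomp_in[OF gcomp_in[OF Assoc_in[OF fg_spaceD(1)[OF Xs] fg_spaceD(1)[OF Ys] fg_spaceD(1)[OF Zs]]
          smash_map_in[OF idX pairing_in[OF pYZ]]] pairing_in[OF pT]] by (simp add: mult.assoc)
  have L_val: "mor (?L \<tau> m n p) (smash_cls (smash (fo X m) (fo Y n)) (fo Z p) (smash_cls (fo X m) (fo Y n) x y) z)
      = mor (mor \<tau> (m * n * p)) (mor (dayin G (day G X Y) Z (m * n) p)
          (smash_cls (fo (day G X Y) (m * n)) (fo Z p) (mor (dayin G X Y m n) (smash_cls (fo X m) (fo Y n) x y)) z))"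
    if \<tau>: "\<tau> \<in> fg_maps G ?D ?E" and x: "x \<in> pts (fo X m)" and y: "y \<in> pts (fo Y n)" and z: "z \<in> pts (fo Z p)"
    for \<tau> m n p x y z
  proof -
    note xy = smash_cls_in[OF x y]
    note xyz = smash_cls_in[OF xy z]
    note 1 = smash_map_in[OF pairing_in[OF pXY, of m n] idZ[of p]]
    note 2 = gcomp_in[OF 1 pairing_in[OF pS]]
    note 3 = gcomp_in[OF 2 fg_mapsD(5)[OF \<tau>]]
    have t: "mor (mor \<tau> (m * n * p)) (mor (dayin G (day G X Y) Z (m * n) p)
          (smash_cls (fo (day G X Y) (m * n)) (fo Z p) (mor (dayin G X Y m n) (smash_cls (fo X m) (fo Y n) x y)) z))
        \<in> pts (fo ?E (m * n * p))"
      by (intro mor_mor_in[OF \<tau>] based_g_mapsD(9)[OF pairing_in[OF pS]] smash_cls_in z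
          based_g_mapsD(9)[OF pairing_in[OF pXY]] x y)
    show ?thesis
      unfolding mor_gcomp[OF 3 xyz] mor_gcomp[OF 2 xyz] mor_gcomp[OF 1 xyz]
        mor_smash_map[OF pairing_in[OF pXY] idZ xy z] mor_gident[OF z] Assoc_Fcat
      by (rule mor_fa_Ident[OF Ts t])
  qed
  have R_val: "mor (?R m n p) (smash_cls (smash (fo X m) (fo Y n)) (fo Z p) (smash_cls (fo X m) (fo Y n) x y) z)
      = mor (dayin G X (day G Y Z) m (n * p)) (smash_cls (fo X m) (fo (day G Y Z) (n * p)) x
          (mor (dayin G Y Z n p) (smash_cls (fo Y n) (fo Z p) y z)))"
    if x: "x \<in> pts (fo X m)" and y: "y \<in> pts (fo Y n)" and z: "z \<in> pts (fo Z p)" for m n p x y z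
  proof -
    note xyz = smash_cls_in[OF smash_cls_in[OF x y] z] and yz = smash_cls_in[OF y z]
    note 1 = Assoc_in[OF fg_spaceD(1)[OF Xs, of m] fg_spaceD(1)[OF Ys, of n] fg_spaceD(1)[OF Zs, of p]]
    note 2 = gcomp_in[OF 1 smash_map_in[OF idX pairing_in[OF pYZ]]]
    show ?thesis
      unfolding mor_gcomp[OF 2 xyz] mor_gcomp[OF 1 xyz] mor_Assoc[OF x y z]
        mor_smash_map[OF idX pairing_in[OF pYZ] x yz] mor_gident[OF x] ..
  qed
  note assoc = Assoc_in[OF free_onD(3)[OF X] free_onD(3)[OF Y] free_onD(3)[OF Z]]
  have f_val: "mor ?f (smash_cls (smash A B) C (smash_cls A B a b) c) = mor ?h (smash_cls A (smash B C) a (smash_cls B C b c))"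
    if "a \<in> pts A" "b \<in> pts B" "c \<in> pts C" for a b c
    unfolding mor_gcomp[OF assoc smash_cls_in[OF smash_cls_in[OF that(1,2)] that(3)]] mor_Assoc[OF that] ..
  have ex: "?L \<tau> m n p = ?R m n p"
    if \<tau>: "\<tau> \<in> fg_maps G ?D ?E" "\<And>q. q \<in> pts (smash (smash A B) C) \<Longrightarrow> mor (mor \<tau> 1) (mor ?g q) = mor ?f q"
    for \<tau> m n p
  proof (rule based_g_maps_eqI[OF L_in[OF \<tau>(1)] R_in])
    fix q assume "q \<in> pts (smash (smash (fo X m) (fo Y n)) (fo Z p))"
    then obtain v z where v: "v \<in> pts (smash (fo X m) (fo Y n))" and z: "z \<in> pts (fo Z p)"
      and q: "q = smash_cls (smash (fo X m) (fo Y n)) (fo Z p) v z" by (rule pts_smashE)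
    obtain x y where x: "x \<in> pts (fo X m)" and y: "y \<in> pts (fo Y n)"
      and v': "v = smash_cls (fo X m) (fo Y n) x y" using v by (rule pts_smashE)
    obtain i a where ia: "i \<le> m" "a \<in> pts A" "x = mor (fa X (iota m i)) (mor e a)"
      by (rule free_on_gen[OF X x])
    obtain j b where jb: "j \<le> n" "b \<in> pts B" "y = mor (fa Y (iota n j)) (mor e' b)"
      by (rule free_on_gen[OF Y y])
    obtain k c where kc: "k \<le> p" "c \<in> pts C" "z = mor (fa Z (iota p k)) (mor e'' c)"
      by (rule free_on_gen[OF Z z])
    note ea = free_onD(4)[OF X ia(2)] and eb = free_onD(4)[OF Y jb(2)] and ec = free_onD(4)[OF Z kc(2)]
    note ab = smash_cls_in[OF ia(2) jb(2)] and bc = smash_cls_in[OF jb(2) kc(2)]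
    note abc = smash_cls_in[OF ab kc(2)]
    have "mor (?L \<tau> m n p) q = mor (mor \<tau> (m * n * p)) (mor (fa ?D (iota (m * n * p) (lexpos p (lexpos n i j) k)))
        (mor ?g (smash_cls (smash A B) C (smash_cls A B a b) c)))"
      unfolding q v' L_val[OF \<tau>(1) x y z]
      unfolding ia(3) jb(3) kc(3) pairing_gen[OF pXY Xs Ys ia(1) jb(1) ea eb]
        mor_day_gen[OF X Y ia(2) jb(2), symmetric]
        pairing_gen[OF pS XYs Zs lexpos_le[OF ia(1) jb(1)] kc(1) free_onD(4)[OF XY ab] ec]
        mor_day_gen[OF XY Z ab kc(2), symmetric] ..
    also have "\<dots> = mor (fa ?E (iota (m * n * p) (lexpos p (lexpos n i j) k)))
        (mor (mor \<tau> 1) (mor ?g (smash_cls (smash A B) C (smash_cls A B a b) c)))"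
      by (rule fg_maps_nat[OF \<tau>(1) iota_in[OF lexpos_le[OF lexpos_le[OF ia(1) jb(1)] kc(1)]] free_onD(4)[OF S abc]])
    \<comment> \<open>The two bracketings of the convolution index their copies by the two
      bracketings of \<open>lexpos\<close>, which agree.\<close>
    also have "\<dots> = mor (fa ?E (iota (m * (n * p)) (lexpos (n * p) i (lexpos p j k))))
        (mor ?h (smash_cls A (smash B C) a (smash_cls B C b c)))"
      unfolding \<tau>(2)[OF abc] f_val[OF ia(2) jb(2) kc(2)] lexpos_assoc mult.assoc ..
    also have "\<dots> = mor (?R m n p) q"
      unfolding q v' R_val[OF x y z]
      unfolding ia(3) jb(3) kc(3) pairing_gen[OF pYZ Ys Zs jb(1) kc(1) eb ec]
        mor_day_gen[OF Y Z jb(2) kc(2), symmetric]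
        pairing_gen[OF pT Xs YZs ia(1) lexpos_le[OF jb(1) kc(1)] ea free_onD(4)[OF YZ bc]]
        mor_day_gen[OF X YZ ia(2) bc, symmetric] ..
    finally show "mor (?L \<tau> m n p) q = mor (?R m n p) q" .
  qed
  \<comment> \<open>At m = n = p = 1 the defining equation evaluates on generators, because the
    associativity constraint of \<open>Fcat\<close> is an identity there.\<close>
  have uniq: "mor (mor \<tau> 1) (mor ?g q) = mor ?f q"
    if \<tau>: "\<tau> \<in> fg_maps G ?D ?E" and P: "?P \<tau>" and q: "q \<in> pts (smash (smash A B) C)" for \<tau> q
  proof -
    obtain v c where v: "v \<in> pts (smash A B)" and c: "c \<in> pts C" and q': "q = smash_cls (smash A B) C v c"
      using q by (rule pts_smashE)
    obtain a b where a: "a \<in> pts A" and b: "b \<in> pts B" and v': "v = smash_cls A B a b"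
      using v by (rule pts_smashE)
    have "?L \<tau> 1 1 1 = ?R 1 1 1" using P by blast
    then show ?thesis
      using L_val[OF \<tau> free_onD(4)[OF X a] free_onD(4)[OF Y b] free_onD(4)[OF Z c]]
        R_val[OF free_onD(4)[OF X a] free_onD(4)[OF Y b] free_onD(4)[OF Z c]]
      unfolding q' v' f_val[OF a b c] mor_day_gen[OF XY Z smash_cls_in[OF a b] c] mor_day_gen[OF X Y a b]
        mor_day_gen[OF X YZ a smash_cls_in[OF b c]] mor_day_gen[OF Y Z b c] mult_1 by simp
  qed
  have t: "day_assoc G X Y Z = (THE \<tau>. \<tau> \<in> fg_maps G ?D ?E \<and> ?P \<tau>)"
    unfolding day_assoc_def by simp
  note res = free_on_the[OF S Ts gcomp_in[OF assoc free_onD(2)[OF T]] _ _ t]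
  show "day_assoc G X Y Z \<in> fg_maps G ?D ?E" by (rule res(1)) (use ex uniq in blast)+
  assume abc: "a \<in> pts A" "b \<in> pts B" "c \<in> pts C"
  show "mor (mor (day_assoc G X Y Z) 1) (mor ?g (smash_cls (smash A B) C (smash_cls A B a b) c))
      = mor ?h (smash_cls A (smash B C) a (smash_cls B C b c))"
    unfolding f_val[OF abc, symmetric]
    by (rule res(2)[OF _ _ smash_cls_in[OF smash_cls_in[OF abc(1,2)] abc(3)]]) (use ex uniq in blast)+
qed

lemma mor_gident_dspace: "i \<le> n \<Longrightarrow> mor (Ident (GTop G) (dspace n :: ('g, 'u) bspace)) (unat i) = unat i"
  by (rule mor_gident) simp

text \<open>The defining equations involve only components at (1, n). They still determine the map,
  since \<open>day G IF X\<close> is free on the smash product of the two-point space with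
  \<open>A\<close>, whose generators appear at (1, 1).\<close>

lemma day_lunit_free:
  fixes X :: "('g, 'u) fspace"
  assumes X: "free_on G X A e"
  defines "g \<equiv> day_gen G IF X (Ident (GTop G) (dspace 1)) e"
  shows "day_lunit G X \<in> fg_maps G (day G IF X) X"
    and "s \<le> 1 \<Longrightarrow> a \<in> pts A \<Longrightarrow> mor (mor (day_lunit G X) 1) (mor g (wcls 1 A s a))
      = mor e (mor (LUnit (GTop G) A) (wcls 1 A s a))"
proof -
  note I = free_on_IF
  note IX = free_on_day[OF I X, folded g_def]
  let ?D = "day G IF X"
  let ?L = "\<lambda>\<tau> n. gcomp G (fa X (LUnit Fcat n)) (gcomp G (mor \<tau> (1 * n)) (dayin G IF X 1 n))"
  let ?P = "\<lambda>\<tau>. \<forall>n. ?L \<tau> n = LUnit (GTop G) (fo X n)" and ?f = "gcomp G e (LUnit (GTop G) A)"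
  note Xs = free_onD(1)[OF X] and Is = free_onD(1)[OF I] and A = free_onD(3)[OF X]
  note p = pairing_day[OF I X]
  have d_in: "dayin G IF X 1 n \<in> based_g_maps G (smash (dspace 1) (fo X n)) (fo ?D (1 * n))" for n
    using pairing_in[OF p, of 1 n] by simp
  have L_in: "?L \<tau> n \<in> based_g_maps G (smash (dspace 1) (fo X n)) (fo X n)" if "\<tau> \<in> fg_maps G ?D X" for \<tau> n
    using gcomp_in[OF gcomp_in[OF d_in fg_mapsD(5)[OF that]] fg_spaceD(2)[OF Xs Fcat_Ident_in]]
    by (simp add: LUnit_Fcat)
  have L_val: "mor (?L \<tau> n) z = mor (mor \<tau> n) (mor (dayin G IF X 1 n) z)"
    if \<tau>: "\<tau> \<in> fg_maps G ?D X" and z: "z \<in> pts (smash (dspace 1) (fo X n))" for \<tau> n z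
  proof -
    have "mor (mor \<tau> (1 * n)) (mor (dayin G IF X 1 n) z) \<in> pts (fo X (1 * n))"
      by (rule mor_mor_in[OF \<tau> based_g_mapsD(9)[OF d_in z]])
    from mor_fa_Ident[OF Xs this] show ?thesis
      unfolding mor_gcomp[OF gcomp_in[OF d_in fg_mapsD(5)[OF \<tau>]] z] mor_gcomp[OF d_in z]
      unfolding LUnit_Fcat mult_1 .
  qed
  have g: "mor g (wcls 1 A s a) = mor (dayin G IF X 1 1) (wcls 1 (fo X 1) s (mor e a))"
    if "s \<le> 1" "a \<in> pts A" for s a
    unfolding g_def using mor_day_gen[OF I X _ that(2), of "unat s"] that(1) mor_gident_dspace[OF that(1)]
    by simp
  note r = LUnit_in[OF A]
  have ex: "?L \<tau> n = LUnit (GTop G) (fo X n)"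
    if \<tau>: "\<tau> \<in> fg_maps G ?D X" "\<And>q. q \<in> pts (smash (dspace 1) A) \<Longrightarrow> mor (mor \<tau> 1) (mor g q) = mor ?f q" for \<tau> n
  proof (rule based_g_maps_eqI[OF L_in[OF \<tau>(1)] LUnit_in[OF fg_spaceD(1)[OF Xs]]])
    fix q assume q: "q \<in> pts (smash (dspace 1) (fo X n))"
    obtain s x where sx: "s \<le> 1" "x \<in> pts (fo X n)" "q = wcls 1 (fo X n) s x" using q by (rule pts_wedgeE)
    obtain i a where ia: "i \<le> n" "a \<in> pts A" "x = mor (fa X (iota n i)) (mor e a)"
      by (rule free_on_gen[OF X sx(2)])
    note ea = free_onD(4)[OF X ia(2)] and sa = wcls_in[OF sx(1) ia(2)]
    have us: "unat s \<in> pts (fo IF 1 :: ('g, 'u) bspace)" using sx(1) by simp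
    have "mor (?L \<tau> n) q = mor (mor \<tau> n) (mor (fa ?D (iota n i)) (mor g (wcls 1 A s a)))"
      unfolding L_val[OF \<tau>(1) q] unfolding sx(3) ia(3) g[OF sx(1) ia(2)]
      using pairing_gen1(1)[OF p Is Xs ia(1) us ea] by simp
    also have "\<dots> = mor (fa X (iota n i)) (mor (mor \<tau> 1) (mor g (wcls 1 A s a)))"
      by (rule fg_maps_nat[OF \<tau>(1) iota_in[OF ia(1)] free_onD(4)[OF IX sa]])
    also have "\<dots> = mor (LUnit (GTop G) (fo X n)) q"
      unfolding \<tau>(2)[OF sa] mor_gcomp[OF r sa] mor_LUnit[OF sx(1) ia(2)] sx(3) mor_LUnit[OF sx(1,2)]
      unfolding ia(3)
      using based_g_mapsD(7)[OF free_onD(2)[OF X]] based_g_mapsD(7)[OF fg_spaceD(2)[OF Xs iota_in[OF ia(1)]]]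
      by simp
    finally show "mor (?L \<tau> n) q = mor (LUnit (GTop G) (fo X n)) q" .
  qed
  have uniq: "mor (mor \<tau> 1) (mor g q) = mor ?f q"
    if \<tau>: "\<tau> \<in> fg_maps G ?D X" and P: "?P \<tau>" and q: "q \<in> pts (smash (dspace 1) A)" for \<tau> q
  proof -
    obtain s a where sa: "s \<le> 1" "a \<in> pts A" "q = wcls 1 A s a" using q by (rule pts_wedgeE)
    note ea = free_onD(4)[OF X sa(2)]
    have eq: "?L \<tau> 1 = LUnit (GTop G) (fo X 1)" using P by blast
    show ?thesis
      unfolding mor_gcomp[OF r q]
      unfolding sa(3) g[OF sa(1,2)] L_val[OF \<tau> wcls_in[OF sa(1) ea], symmetric] eq mor_LUnit[OF sa(1) ea] mor_LUnit[OF sa(1,2)]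
      using based_g_mapsD(7)[OF free_onD(2)[OF X]] by simp
  qed
  have t: "day_lunit G X = (THE \<tau>. \<tau> \<in> fg_maps G ?D X \<and> ?P \<tau>)"
    unfolding day_lunit_def by simp
  note res = free_on_the[OF IX Xs gcomp_in[OF r free_onD(2)[OF X]] _ _ t]
  show "day_lunit G X \<in> fg_maps G ?D X" by (rule res(1)) (use ex uniq in blast)+
  assume s: "s \<le> 1" and a: "a \<in> pts A"
  note q = wcls_in[OF s a]
  show "mor (mor (day_lunit G X) 1) (mor g (wcls 1 A s a)) = mor e (mor (LUnit (GTop G) A) (wcls 1 A s a))"
    unfolding mor_gcomp[OF r q, symmetric] by (rule res(2)[OF _ _ q]) (use ex uniq in blast)+
qed

lemma pts_smash_dspaceE:
  fixes X :: "('g, 'u) bspace"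
  assumes "z \<in> pts (smash X (dspace n))"
  obtains i x where "i \<le> n" "x \<in> pts X" "z = smash_cls X (dspace n) x (unat i)"
proof -
  obtain x y where "x \<in> pts X" "y \<in> pts (dspace n :: ('g, 'u) bspace)" "z = smash_cls X (dspace n) x y"
    using assms by (rule pts_smashE)
  then show ?thesis using that by auto
qed

lemma day_runit_free:
  fixes X :: "('g, 'u) fspace"
  assumes X: "free_on G X A e"
  defines "g \<equiv> day_gen G X IF e (Ident (GTop G) (dspace 1))"
  shows "day_runit G X \<in> fg_maps G (day G X IF) X"
    and "s \<le> 1 \<Longrightarrow> a \<in> pts A \<Longrightarrow> mor (mor (day_runit G X) 1) (mor g (smash_cls A (dspace 1) a (unat s)))
      = mor e (mor (RUnit (GTop G) A) (smash_cls A (dspace 1) a (unat s)))"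
proof -
  note I = free_on_IF
  note XI = free_on_day[OF X I, folded g_def]
  let ?D = "day G X IF"
  let ?L = "\<lambda>\<tau> n. gcomp G (fa X (RUnit Fcat n)) (gcomp G (mor \<tau> (n * 1)) (dayin G X IF n 1))"
  let ?P = "\<lambda>\<tau>. \<forall>n. ?L \<tau> n = RUnit (GTop G) (fo X n)" and ?f = "gcomp G e (RUnit (GTop G) A)"
  note Xs = free_onD(1)[OF X] and Is = free_onD(1)[OF I] and A = free_onD(3)[OF X]
  note p = pairing_day[OF X I]
  have d_in: "dayin G X IF n 1 \<in> based_g_maps G (smash (fo X n) (dspace 1)) (fo ?D (n * 1))" for n
    using pairing_in[OF p, of n 1] by simp
  have L_in: "?L \<tau> n \<in> based_g_maps G (smash (fo X n) (dspace 1)) (fo X n)" if "\<tau> \<in> fg_maps G ?D X" for \<tau> n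
    using gcomp_in[OF gcomp_in[OF d_in fg_mapsD(5)[OF that]] fg_spaceD(2)[OF Xs Fcat_Ident_in]]
    by (simp add: RUnit_Fcat)
  have L_val: "mor (?L \<tau> n) z = mor (mor \<tau> n) (mor (dayin G X IF n 1) z)"
    if \<tau>: "\<tau> \<in> fg_maps G ?D X" and z: "z \<in> pts (smash (fo X n) (dspace 1))" for \<tau> n z
  proof -
    have "mor (mor \<tau> (n * 1)) (mor (dayin G X IF n 1) z) \<in> pts (fo X (n * 1))"
      by (rule mor_mor_in[OF \<tau> based_g_mapsD(9)[OF d_in z]])
    from mor_fa_Ident[OF Xs this] show ?thesis
      unfolding mor_gcomp[OF gcomp_in[OF d_in fg_mapsD(5)[OF \<tau>]] z] mor_gcomp[OF d_in z]
      unfolding RUnit_Fcat mult_1_right .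
  qed
  have us: "unat s \<in> pts (dspace 1 :: ('g, 'u) bspace)" if "s \<le> 1" for s using that by simp
  have g: "mor g (smash_cls A (dspace 1) a (unat s)) = mor (dayin G X IF 1 1) (smash_cls (fo X 1) (dspace 1) (mor e a) (unat s))"
    if "s \<le> 1" "a \<in> pts A" for s a
    unfolding g_def using mor_day_gen[OF X I that(2), of "unat s"] that(1) mor_gident_dspace[OF that(1)]
    by simp
  note r = RUnit_in[OF A]
  have ex: "?L \<tau> n = RUnit (GTop G) (fo X n)"
    if \<tau>: "\<tau> \<in> fg_maps G ?D X" "\<And>q. q \<in> pts (smash A (dspace 1)) \<Longrightarrow> mor (mor \<tau> 1) (mor g q) = mor ?f q" for \<tau> n
  proof (rule based_g_maps_eqI[OF L_in[OF \<tau>(1)] RUnit_in[OF fg_spaceD(1)[OF Xs]]])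
    fix q assume q: "q \<in> pts (smash (fo X n) (dspace 1))"
    obtain s x where sx: "s \<le> 1" "x \<in> pts (fo X n)" "q = smash_cls (fo X n) (dspace 1) x (unat s)"
      using q by (rule pts_smash_dspaceE)
    obtain i a where ia: "i \<le> n" "a \<in> pts A" "x = mor (fa X (iota n i)) (mor e a)"
      by (rule free_on_gen[OF X sx(2)])
    note ea = free_onD(4)[OF X ia(2)] and sa = smash_cls_in[OF ia(2) us[OF sx(1)]]
    have us': "unat s \<in> pts (fo IF 1 :: ('g, 'u) bspace)" using sx(1) by simp
    have "mor (?L \<tau> n) q = mor (mor \<tau> n) (mor (fa ?D (iota n i)) (mor g (smash_cls A (dspace 1) a (unat s))))"
      unfolding L_val[OF \<tau>(1) q] unfolding sx(3) ia(3) g[OF sx(1) ia(2)]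
      using pairing_gen1(2)[OF p Xs Is ia(1) ea us'] by simp
    also have "\<dots> = mor (fa X (iota n i)) (mor (mor \<tau> 1) (mor g (smash_cls A (dspace 1) a (unat s))))"
      by (rule fg_maps_nat[OF \<tau>(1) iota_in[OF ia(1)] free_onD(4)[OF XI sa]])
    also have "\<dots> = mor (RUnit (GTop G) (fo X n)) q"
      unfolding \<tau>(2)[OF sa] mor_gcomp[OF r sa] mor_RUnit[OF sx(1) ia(2)] sx(3) mor_RUnit[OF sx(1,2)]
      unfolding ia(3)
      using based_g_mapsD(7)[OF free_onD(2)[OF X]] based_g_mapsD(7)[OF fg_spaceD(2)[OF Xs iota_in[OF ia(1)]]]
      by simp
    finally show "mor (?L \<tau> n) q = mor (RUnit (GTop G) (fo X n)) q" .
  qed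
  have uniq: "mor (mor \<tau> 1) (mor g q) = mor ?f q"
    if \<tau>: "\<tau> \<in> fg_maps G ?D X" and P: "?P \<tau>" and q: "q \<in> pts (smash A (dspace 1))" for \<tau> q
  proof -
    obtain s a where sa: "s \<le> 1" "a \<in> pts A" "q = smash_cls A (dspace 1) a (unat s)" using q by (rule pts_smash_dspaceE)
    note ea = free_onD(4)[OF X sa(2)]
    have eq: "?L \<tau> 1 = RUnit (GTop G) (fo X 1)" using P by blast
    show ?thesis
      unfolding mor_gcomp[OF r q]
      unfolding sa(3) g[OF sa(1,2)] L_val[OF \<tau> smash_cls_in[OF ea us[OF sa(1)]], symmetric] eq mor_RUnit[OF sa(1) ea] mor_RUnit[OF sa(1,2)]
      using based_g_mapsD(7)[OF free_onD(2)[OF X]] by simp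
  qed
  have t: "day_runit G X = (THE \<tau>. \<tau> \<in> fg_maps G ?D X \<and> ?P \<tau>)"
    unfolding day_runit_def by simp
  note res = free_on_the[OF XI Xs gcomp_in[OF r free_onD(2)[OF X]] _ _ t]
  show "day_runit G X \<in> fg_maps G ?D X" by (rule res(1)) (use ex uniq in blast)+
  assume s: "s \<le> 1" and a: "a \<in> pts A"
  note q = smash_cls_in[OF a us[OF s]]
  show "mor (mor (day_runit G X) 1) (mor g (smash_cls A (dspace 1) a (unat s))) = mor e (mor (RUnit (GTop G) A) (smash_cls A (dspace 1) a (unat s)))"
    unfolding mor_gcomp[OF r q, symmetric] by (rule res(2)[OF _ _ q]) (use ex uniq in blast)+
qed

lemma Braid_Fcat_1: "Braid Fcat 1 1 = Ident Fcat 1"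
  unfolding Fcat_Braid Fcat_Ident by (auto simp: fmap_def lexl_def lexr_def)

text \<open>In addition to exchanging the two generators, the defining equation permutes the index.
  At (1, 1) this permutation is the identity, so the prescribed value on generators is simply the
  exchanged generator.\<close>

lemma day_braid_free:
  fixes X Y :: "('g, 'u) fspace"
  assumes X: "free_on G X A e" and Y: "free_on G Y B e'"
  shows "day_braid G X Y \<in> fg_maps G (day G X Y) (day G Y X)"
    and "a \<in> pts A \<Longrightarrow> b \<in> pts B \<Longrightarrow>
      mor (mor (day_braid G X Y) 1) (mor (day_gen G X Y e e') (smash_cls A B a b))
        = mor (day_gen G Y X e' e) (smash_cls B A b a)"
proof -
  note XY = free_on_day[OF X Y] and YX = free_on_day[OF Y X]
  let ?D = "day G X Y" and ?E = "day G Y X"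
  let ?g = "day_gen G X Y e e'" and ?h = "day_gen G Y X e' e"
  let ?L = "\<lambda>\<tau> m n. gcomp G (fa ?E (Braid Fcat m n)) (gcomp G (mor \<tau> (m * n)) (dayin G X Y m n))"
  let ?R = "\<lambda>m n. gcomp G (dayin G Y X n m) (Braid (GTop G) (fo X m) (fo Y n))"
  let ?P = "\<lambda>\<tau>. \<forall>m n. ?L \<tau> m n = ?R m n" and ?f = "gcomp G ?h (Braid (GTop G) A B)"
  note Xs = free_onD(1)[OF X] and Ys = free_onD(1)[OF Y] and YXs = free_onD(1)[OF YX]
  note p = pairing_day[OF X Y] and p' = pairing_day[OF Y X]
  have br: "Braid (GTop G) (fo X m) (fo Y n) \<in> based_g_maps G (smash (fo X m) (fo Y n)) (smash (fo Y n) (fo X m))" for m n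
    by (rule Braid_in[OF fg_spaceD(1)[OF Xs] fg_spaceD(1)[OF Ys]])
  have L_val: "mor (?L \<tau> m n) z = mor (fa ?E (Braid Fcat m n)) (mor (mor \<tau> (m * n)) (mor (dayin G X Y m n) z))"
    if \<tau>: "\<tau> \<in> fg_maps G ?D ?E" and z: "z \<in> pts (smash (fo X m) (fo Y n))" for \<tau> m n z
    unfolding mor_gcomp[OF gcomp_in[OF pairing_in[OF p] fg_mapsD(5)[OF \<tau>]] z] mor_gcomp[OF pairing_in[OF p] z] ..
  have R_val: "mor (?R m n) (smash_cls (fo X m) (fo Y n) x y) = mor (dayin G Y X n m) (smash_cls (fo Y n) (fo X m) y x)"
    if "x \<in> pts (fo X m)" "y \<in> pts (fo Y n)" for m n x y
    unfolding mor_gcomp[OF br smash_cls_in[OF that]] mor_Braid[OF that] ..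
  note brA = Braid_in[OF free_onD(3)[OF X] free_onD(3)[OF Y]]
  have f_val: "mor ?f (smash_cls A B a b) = mor ?h (smash_cls B A b a)" if "a \<in> pts A" "b \<in> pts B" for a b
    unfolding mor_gcomp[OF brA smash_cls_in[OF that]] mor_Braid[OF that] ..
  have ex: "?L \<tau> m n = ?R m n"
    if \<tau>: "\<tau> \<in> fg_maps G ?D ?E" "\<And>q. q \<in> pts (smash A B) \<Longrightarrow> mor (mor \<tau> 1) (mor ?g q) = mor ?f q"
    for \<tau> m n
  proof (rule based_g_maps_eqI[OF gcomp_in[OF gcomp_in[OF pairing_in[OF p] fg_mapsD(5)[OF \<tau>(1)]]
          fg_spaceD(2)[OF YXs Braid_Fcat_in]] gcomp_in[OF br pairing_in[OF p']]])
    fix q assume q: "q \<in> pts (smash (fo X m) (fo Y n))"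
    obtain x y where x: "x \<in> pts (fo X m)" and y: "y \<in> pts (fo Y n)" and q': "q = smash_cls (fo X m) (fo Y n) x y"
      using q by (rule pts_smashE)
    obtain i a where ia: "i \<le> m" "a \<in> pts A" "x = mor (fa X (iota m i)) (mor e a)"
      by (rule free_on_gen[OF X x])
    obtain j b where jb: "j \<le> n" "b \<in> pts B" "y = mor (fa Y (iota n j)) (mor e' b)"
      by (rule free_on_gen[OF Y y])
    note ea = free_onD(4)[OF X ia(2)] and eb = free_onD(4)[OF Y jb(2)]
    note ab = smash_cls_in[OF ia(2) jb(2)] and ba = smash_cls_in[OF jb(2) ia(2)]
    have "mor (?L \<tau> m n) q = mor (fa ?E (Braid Fcat m n)) (mor (mor \<tau> (m * n)) (mor (fa ?D (iota (m * n) (lexpos n i j)))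
        (mor ?g (smash_cls A B a b))))"
      unfolding L_val[OF \<tau>(1) q] unfolding q' ia(3) jb(3) pairing_gen[OF p Xs Ys ia(1) jb(1) ea eb]
        mor_day_gen[OF X Y ia(2) jb(2), symmetric] ..
    also have "\<dots> = mor (fa ?E (Braid Fcat m n)) (mor (fa ?E (iota (m * n) (lexpos n i j))) (mor ?h (smash_cls B A b a)))"
      unfolding fg_maps_nat[OF \<tau>(1) iota_in[OF lexpos_le[OF ia(1) jb(1)]] free_onD(4)[OF XY ab]]
        \<tau>(2)[OF ab] f_val[OF ia(2) jb(2)] ..
    \<comment> \<open>The braiding of \<open>Fcat\<close> exchanges the two lexicographic orders and
      thereby turns the index of (i, j) into that of (j, i).\<close>
    also have "\<dots> = mor (fa ?E (iota (n * m) (lexpos m j i))) (mor ?h (smash_cls B A b a))"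
      unfolding mor_fa_iota[OF YXs Braid_Fcat_in lexpos_le[OF ia(1) jb(1)] free_onD(4)[OF YX ba]]
        mor_Braid_Fcat[OF ia(1) jb(1)] ..
    also have "\<dots> = mor (?R m n) q"
      unfolding q' R_val[OF x y]
      unfolding ia(3) jb(3) pairing_gen[OF p' Ys Xs jb(1) ia(1) eb ea]
        mor_day_gen[OF Y X jb(2) ia(2), symmetric] ..
    finally show "mor (?L \<tau> m n) q = mor (?R m n) q" .
  qed
  have uniq: "mor (mor \<tau> 1) (mor ?g q) = mor ?f q"
    if \<tau>: "\<tau> \<in> fg_maps G ?D ?E" and P: "?P \<tau>" and q: "q \<in> pts (smash A B)" for \<tau> q
  proof -
    obtain a b where a: "a \<in> pts A" and b: "b \<in> pts B" and q': "q = smash_cls A B a b"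
      using q by (rule pts_smashE)
    have eq: "?L \<tau> 1 1 = ?R 1 1" using P by blast
    note ea = free_onD(4)[OF X a] and eb = free_onD(4)[OF Y b]
    have t: "mor (mor \<tau> 1) (mor ?g (smash_cls A B a b)) \<in> pts (fo ?E 1)"
      by (rule mor_mor_in[OF \<tau> free_onD(4)[OF XY smash_cls_in[OF a b]]])
    have "mor (?L \<tau> 1 1) (smash_cls (fo X 1) (fo Y 1) (mor e a) (mor e' b))
        = mor (mor \<tau> 1) (mor ?g (smash_cls A B a b))"
      unfolding L_val[OF \<tau> smash_cls_in[OF ea eb]]
      unfolding Braid_Fcat_1 mor_day_gen[OF X Y a b, symmetric] mult_1
      by (rule mor_fa_Ident[OF YXs t])
    then show ?thesis unfolding q' f_val[OF a b] eq R_val[OF ea eb] mor_day_gen[OF Y X b a] by (rule sym)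
  qed
  have t: "day_braid G X Y = (THE \<tau>. \<tau> \<in> fg_maps G ?D ?E \<and> ?P \<tau>)"
    unfolding day_braid_def by simp
  note res = free_on_the[OF XY YXs gcomp_in[OF brA free_onD(2)[OF YX]] _ _ t]
  show "day_braid G X Y \<in> fg_maps G ?D ?E" by (rule res(1)) (use ex uniq in blast)+
  assume ab: "a \<in> pts A" "b \<in> pts B"
  show "mor (mor (day_braid G X Y) 1) (mor ?g (smash_cls A B a b)) = mor ?h (smash_cls B A b a)"
    unfolding f_val[OF ab, symmetric] by (rule res(2)[OF _ _ smash_cls_in[OF ab]]) (use ex uniq in blast)+
qed

end

section \<open>The functor \<open>F1\<close>\<close>

context gspaces
begin

lemma fo_F1_fun [simp]: "fo (F1 G) X = F1_space G X"
  by (simp add: F1_def)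

lemma fa_F1_fun: "fa (F1 G) h = \<lparr>src = F1_space G (src h), tgt = F1_space G (tgt h),
    mor = (\<lambda>n. smash_map (Ident (GTop G) (dspace n)) h)\<rparr>"
  by (simp add: F1_def)

lemma mor_fa_F1_fun:
  fixes X Y :: "('g, 'u) bspace"
  assumes h: "h \<in> based_g_maps G X Y" and ix: "i \<le> n" "x \<in> pts X"
  shows "mor (mor (fa (F1 G) h) n) (wcls n X i x) = wcls n Y i (mor h x)"
  using mor_smash_map[OF gident_in[OF based_g_space_dspace] h _ ix(2), of "unat i" n] ix(1)
  by (simp add: fa_F1_fun mor_gident_dspace)

lemma fa_F1_fun_in:
  fixes X Y :: "('g, 'u) bspace"
  assumes h: "h \<in> based_g_maps G X Y"
  shows "fa (F1 G) h \<in> fg_maps G (F1_space G X) (F1_space G Y)"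
proof (rule fg_mapsI)
  note X = based_g_mapsD(3)[OF h] and Y = based_g_mapsD(4)[OF h]
  show "fg_space (GTop G) (F1_space G X)" "fg_space (GTop G) (F1_space G Y)"
    using X Y by (simp_all add: fg_space_F1)
  show "src (fa (F1 G) h) = F1_space G X" "tgt (fa (F1 G) h) = F1_space G Y"
    using based_g_mapsD(1,2)[OF h] by (simp_all add: fa_F1_fun)
  show "mor (fa (F1 G) h) n \<in> based_g_maps G (fo (F1_space G X) n) (fo (F1_space G Y) n)" for n
    using smash_map_in[OF gident_in[OF based_g_space_dspace] h] by (simp add: fa_F1_fun)
  fix m n f v assume f: "f \<in> Hom Fcat m n" and "v \<in> pts (fo (F1_space G X) m)"
  then obtain i x where ix: "i \<le> m" "x \<in> pts X" "v = wcls m X i x"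
    unfolding fo_F1 by (elim pts_wedgeE)
  show "mor (mor (fa (F1 G) h) n) (mor (fa (F1_space G X) f) v)
      = mor (fa (F1_space G Y) f) (mor (mor (fa (F1 G) h) m) v)"
    unfolding ix(3) mor_fa_F1[OF X f ix(1,2)] mor_fa_F1_fun[OF h ix(1,2)]
      mor_fa_F1_fun[OF h Fcat_HomD(4)[OF f ix(1)] ix(2)]
      mor_fa_F1[OF Y f ix(1) based_g_mapsD(9)[OF h ix(2)]] ..
qed

text \<open>Naturality of the adjunction unit: this is how values of \<open>F1\<close> on maps enter
  computations on generators.\<close>

lemma F1_fun_unit:
  fixes X Y :: "('g, 'u) bspace"
  assumes h: "h \<in> based_g_maps G X Y" and x: "x \<in> pts X"
  shows "mor (mor (fa (F1 G) h) 1) (mor (F1_unit X) x) = mor (F1_unit Y) (mor h x)"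
  unfolding mor_F1_unit[OF x] mor_F1_unit[OF based_g_mapsD(9)[OF h x]] by (rule mor_fa_F1_fun[OF h le_refl x])

lemma functor_F1: "is_functor (GT G) (FG G) (F1 G :: (('g, 'u) bspace, ('g, 'u) bmap, ('g, 'u) fspace, ('g, 'u) ftrans) fdata)"
  unfolding is_functor_def GT_simps FG_simps fo_F1_fun
proof (intro conjI ballI)
  fix X :: "('g, 'u) bspace" assume "X \<in> {X. based_g_space G X \<and> nondegenerate G X}"
  then have X: "based_g_space G X" and nd: "nondegenerate G X" by auto
  \<comment> \<open>The point where nondegeneracy of \<open>X\<close> is passed on to every level of
    \<open>F1_space G X\<close>.\<close>
  show "F1_space G X \<in> {X. fg_space (GT G) X}"
    using fg_space_F1[OF X] nondegenerate_wedge[OF X nd] by (simp add: fg_space_GT)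
  note i = gident_in[OF X]
  show "fa (F1 G) (Ident (GTop G) X) = Ident (FGTop G) (F1_space G X)"
  proof (rule free_on_eqI[OF free_on_F1[OF X] fa_F1_fun_in[OF i] fident_in[OF fg_space_F1[OF X]]])
    fix x assume x: "x \<in> pts X"
    show "mor (mor (fa (F1 G) (Ident (GTop G) X)) 1) (mor (F1_unit X) x)
        = mor (mor (Ident (FGTop G) (F1_space G X)) 1) (mor (F1_unit X) x)"
      unfolding F1_fun_unit[OF i x] mor_gident[OF x] mor_fident[OF free_onD(4)[OF free_on_F1[OF X] x]] ..
  qed
next
  fix X Y :: "('g, 'u) bspace" and f assume "f \<in> based_g_maps G X Y"
  then show "fa (F1 G) f \<in> fg_maps G (F1_space G X) (F1_space G Y)" by (rule fa_F1_fun_in)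
next
  fix X Y Z :: "('g, 'u) bspace" and f g
  assume f: "f \<in> based_g_maps G X Y" and g: "g \<in> based_g_maps G Y Z"
  note X = based_g_mapsD(3)[OF f]
  show "fa (F1 G) (gcomp G g f) = fcomp G (fa (F1 G) g) (fa (F1 G) f)"
  proof (rule free_on_eqI[OF free_on_F1[OF X] fa_F1_fun_in[OF gcomp_in[OF f g]]
        fcomp_in[OF fa_F1_fun_in[OF f] fa_F1_fun_in[OF g]]])
    fix x assume x: "x \<in> pts X"
    show "mor (mor (fa (F1 G) (gcomp G g f)) 1) (mor (F1_unit X) x)
        = mor (mor (fcomp G (fa (F1 G) g) (fa (F1 G) f)) 1) (mor (F1_unit X) x)"
      unfolding F1_fun_unit[OF gcomp_in[OF f g] x] mor_gcomp[OF f x]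
        mor_fcomp[OF fa_F1_fun_in[OF f] free_onD(4)[OF free_on_F1[OF X] x]] F1_fun_unit[OF f x]
        F1_fun_unit[OF g based_g_mapsD(9)[OF f x]] ..
  qed
qed

abbreviation F1_day_gen :: "('g, 'u) bspace \<Rightarrow> ('g, 'u) bspace \<Rightarrow> ('g, 'u) bmap" where
  "F1_day_gen X Y \<equiv> day_gen G (F1_space G X) (F1_space G Y) (F1_unit X) (F1_unit Y)"

text \<open>The multiplication matches generators over \<open>smash X Y\<close>. It is phrased as an
  existence statement so that one function of \<open>X\<close> and \<open>Y\<close> can be chosen
  afterwards.\<close>

lemma F1_multiplication:
  fixes X Y :: "('g, 'u) bspace"
  assumes X: "based_g_space G X" and Y: "based_g_space G Y"
  shows "\<exists>\<phi>. \<phi> \<in> fg_maps G (day G (F1_space G X) (F1_space G Y)) (F1_space G (smash X Y)) \<and>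
    (\<forall>x\<in>pts X. \<forall>y\<in>pts Y. mor (mor \<phi> 1) (mor (F1_day_gen X Y) (smash_cls X Y x y))
      = mor (F1_unit (smash X Y)) (smash_cls X Y x y))"
proof -
  note XY = free_on_F1[OF based_g_space_smash[OF X Y]]
  note D = free_on_day[OF free_on_F1[OF X] free_on_F1[OF Y]]
  obtain \<phi> where \<phi>: "\<phi> \<in> fg_maps G (day G (F1_space G X) (F1_space G Y)) (F1_space G (smash X Y))"
    "\<And>p. p \<in> pts (smash X Y) \<Longrightarrow> mor (mor \<phi> 1) (mor (F1_day_gen X Y) p) = mor (F1_unit (smash X Y)) p"
    using free_on_extend[OF D free_onD(1,2)[OF XY]] by blast
  then show ?thesis by (intro exI[of _ \<phi>] conjI ballI \<phi>(1) \<phi>(2)[OF smash_cls_in])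
qed

lemma strong_symmetric_monoidal_F1:
  "strong_symmetric_monoidal (GT G :: (('g, 'u) bspace, ('g, 'u) bmap) moncat) (FG G) (F1 G)"
proof -
  let ?F = "F1_space G" and ?u = "F1_unit" and ?S = "dspace 1 :: ('g, 'u) bspace"
  define \<phi> where "\<phi> X Y = (SOME \<phi>. \<phi> \<in> fg_maps G (day G (?F X) (?F Y)) (?F (smash X Y)) \<and>
    (\<forall>x\<in>pts X. \<forall>y\<in>pts Y. mor (mor \<phi> 1) (mor (F1_day_gen X Y) (smash_cls X Y x y))
      = mor (?u (smash X Y)) (smash_cls X Y x y)))" for X Y :: "('g, 'u) bspace"
  have \<phi>_in: "\<phi> X Y \<in> fg_maps G (day G (?F X) (?F Y)) (?F (smash X Y))"
    and \<phi>_gen: "\<And>x y. x \<in> pts X \<Longrightarrow> y \<in> pts Y \<Longrightarrow>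
      mor (mor (\<phi> X Y) 1) (mor (F1_day_gen X Y) (smash_cls X Y x y)) = mor (?u (smash X Y)) (smash_cls X Y x y)"
    if "based_g_space G X" "based_g_space G Y" for X Y :: "('g, 'u) bspace"
    using someI_ex[OF F1_multiplication[OF that]] unfolding \<phi>_def by blast+
  have free: "free_on G (?F X) X (?u X)" if "based_g_space G X" for X :: "('g, 'u) bspace"
    by (rule free_on_F1[OF that])
  \<comment> \<open>By freeness of the unit, \<open>\<epsilon>\<close> is prescribed by the
    generator of \<open>F1\<close> of the two-point space.\<close>
  obtain \<epsilon> where \<epsilon>: "\<epsilon> \<in> fg_maps G IF (?F ?S)"
    "\<And>s. s \<in> pts ?S \<Longrightarrow> mor (mor \<epsilon> 1) (mor (Ident (GTop G) ?S) s) = mor (?u ?S) s"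
    using free_on_extend[OF free_on_IF free_onD(1,2)[OF free[OF based_g_space_dspace]]] by blast
  note S = based_g_space_dspace[of 1]
  show ?thesis
    unfolding strong_symmetric_monoidal_def GT_simps FG_simps fo_F1_fun
  proof (intro conjI exI[of _ \<epsilon>] exI[of _ \<phi>] ballI)
    show "category (GT G :: (('g, 'u) bspace, ('g, 'u) bmap) moncat)"
      by (rule category_GT)
    show "category (FG G :: (('g, 'u) fspace, ('g, 'u) ftrans) moncat)" by (rule category_FG)
    show "is_functor (GT G) (FG G) (F1 G :: (('g, 'u) bspace, ('g, 'u) bmap, ('g, 'u) fspace, ('g, 'u) ftrans) fdata)"
      by (rule functor_F1)
    show "is_iso (FG G) IF (?F ?S) \<epsilon>"
      by (rule free_on_iso[OF free_on_IF free[OF S] \<epsilon>])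
  next
    fix X Y :: "('g, 'u) bspace"
    assume "X \<in> {X. based_g_space G X \<and> nondegenerate G X}" "Y \<in> {X. based_g_space G X \<and> nondegenerate G X}"
    then have X: "based_g_space G X" and Y: "based_g_space G Y" by auto
    note XY = based_g_space_smash[OF X Y] and YX = based_g_space_smash[OF Y X]
    note D = free_on_day[OF free[OF X] free[OF Y]]
    show "is_iso (FG G) (day G (?F X) (?F Y)) (?F (smash X Y)) (\<phi> X Y)"
    proof (rule free_on_iso[OF D free[OF XY] \<phi>_in[OF X Y]])
      fix p assume "p \<in> pts (smash X Y)"
      then obtain x y where "x \<in> pts X" "y \<in> pts Y" "p = smash_cls X Y x y" by (rule pts_smashE)
      then show "mor (mor (\<phi> X Y) 1) (mor (F1_day_gen X Y) p) = mor (?u (smash X Y)) p"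
        using \<phi>_gen[OF X Y] by simp
    qed
    note br = Braid_in[OF X Y] and db = day_braid_free[OF free[OF X] free[OF Y]]
    let ?L = "fcomp G (fa (F1 G) (Braid (GTop G) X Y)) (\<phi> X Y)" and ?R = "fcomp G (\<phi> Y X) (day_braid G (?F X) (?F Y))"
    show "?L = ?R"
    proof (rule free_on_eqI[OF D fcomp_in[OF \<phi>_in[OF X Y] fa_F1_fun_in[OF br]] fcomp_in[OF db(1) \<phi>_in[OF Y X]]])
      fix p assume p: "p \<in> pts (smash X Y)"
      then obtain x y where xy: "x \<in> pts X" "y \<in> pts Y" "p = smash_cls X Y x y" by (rule pts_smashE)
      note pin = free_onD(4)[OF D p]
      have "mor (mor (?L) 1) (mor (F1_day_gen X Y) p)
          = mor (?u (smash Y X)) (smash_cls Y X y x)"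
        unfolding mor_fcomp[OF \<phi>_in[OF X Y] pin]
        unfolding xy(3) \<phi>_gen[OF X Y xy(1,2)] F1_fun_unit[OF br smash_cls_in[OF xy(1,2)]] mor_Braid[OF xy(1,2)] ..
      moreover have "mor (mor (?R) 1) (mor (F1_day_gen X Y) p)
          = mor (?u (smash Y X)) (smash_cls Y X y x)"
        unfolding mor_fcomp[OF db(1) pin]
        unfolding xy(3) db(2)[OF xy(1,2)] \<phi>_gen[OF Y X xy(2,1)] ..
      ultimately show "mor (mor (?L) 1) (mor (F1_day_gen X Y) p)
          = mor (mor (?R) 1) (mor (F1_day_gen X Y) p)" by simp
    qed
  next
    fix X X' Y Y' :: "('g, 'u) bspace" and f g
    assume f: "f \<in> based_g_maps G X X'" and g: "g \<in> based_g_maps G Y Y'"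
    note X = based_g_mapsD(3)[OF f] and X' = based_g_mapsD(4)[OF f]
      and Y = based_g_mapsD(3)[OF g] and Y' = based_g_mapsD(4)[OF g]
    note D = free_on_day[OF free[OF X] free[OF Y]]
    note m = day_map_free[OF free[OF X] free[OF Y] free[OF X'] free[OF Y'] fa_F1_fun_in[OF f] fa_F1_fun_in[OF g]]
    note fg = smash_map_in[OF f g]
    let ?L = "fcomp G (\<phi> X' Y') (day_map G (fa (F1 G) f) (fa (F1 G) g))" and ?R = "fcomp G (fa (F1 G) (smash_map f g)) (\<phi> X Y)"
    show "?L = ?R"
    proof (rule free_on_eqI[OF D fcomp_in[OF m(1) \<phi>_in[OF X' Y']] fcomp_in[OF \<phi>_in[OF X Y] fa_F1_fun_in[OF fg]]])
      fix p assume p: "p \<in> pts (smash X Y)"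
      then obtain x y where xy: "x \<in> pts X" "y \<in> pts Y" "p = smash_cls X Y x y" by (rule pts_smashE)
      note pin = free_onD(4)[OF D p]
      note fx = based_g_mapsD(9)[OF f xy(1)] and gy = based_g_mapsD(9)[OF g xy(2)]
      \<comment> \<open>\<open>day_map_free\<close> leaves a component of \<open>dayin\<close>
        applied to generators; folding it back into \<open>day_gen\<close> makes
        \<open>\<phi>_gen\<close> applicable.\<close>
      have "mor (mor (?L) 1) (mor (F1_day_gen X Y) p)
          = mor (?u (smash X' Y')) (smash_cls X' Y' (mor f x) (mor g y))"
        unfolding mor_fcomp[OF m(1) pin]
        unfolding xy(3) m(2)[OF xy(1,2)] F1_fun_unit[OF f xy(1)] F1_fun_unit[OF g xy(2)]
          mor_day_gen[OF free[OF X'] free[OF Y'] fx gy, symmetric] \<phi>_gen[OF X' Y' fx gy] ..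
      moreover have "mor (mor (?R) 1) (mor (F1_day_gen X Y) p)
          = mor (?u (smash X' Y')) (smash_cls X' Y' (mor f x) (mor g y))"
        unfolding mor_fcomp[OF \<phi>_in[OF X Y] pin]
        unfolding xy(3) \<phi>_gen[OF X Y xy(1,2)] F1_fun_unit[OF fg smash_cls_in[OF xy(1,2)]] mor_smash_map[OF f g xy(1,2)] ..
      ultimately show "mor (mor (?L) 1) (mor (F1_day_gen X Y) p)
          = mor (mor (?R) 1) (mor (F1_day_gen X Y) p)" by simp
    qed
  next
    fix X Y Z :: "('g, 'u) bspace"
    assume "X \<in> {X. based_g_space G X \<and> nondegenerate G X}" "Y \<in> {X. based_g_space G X \<and> nondegenerate G X}"
      "Z \<in> {X. based_g_space G X \<and> nondegenerate G X}"
    then have X: "based_g_space G X" and Y: "based_g_space G Y" and Z: "based_g_space G Z" by auto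
    note XY = based_g_space_smash[OF X Y] and YZ = based_g_space_smash[OF Y Z]
    note dXY = free_on_day[OF free[OF X] free[OF Y]] and dYZ = free_on_day[OF free[OF Y] free[OF Z]]
    note D = free_on_day[OF dXY free[OF Z]]
    let ?g = "day_gen G (day G (?F X) (?F Y)) (?F Z) (F1_day_gen X Y) (?u Z)"
    note iX = fident_in[OF free_onD(1)[OF free[OF X]]] and iZ = fident_in[OF free_onD(1)[OF free[OF Z]]]
    note l = day_map_free[OF dXY free[OF Z] free[OF XY] free[OF Z] \<phi>_in[OF X Y] iZ]
    note r = day_map_free[OF free[OF X] dYZ free[OF X] free[OF YZ] iX \<phi>_in[OF Y Z]]
    note as = Assoc_in[OF X Y Z] and da = day_assoc_free[OF free[OF X] free[OF Y] free[OF Z]]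
    let ?L = "fcomp G (fa (F1 G) (Assoc (GTop G) X Y Z)) (fcomp G (\<phi> (smash X Y) Z) (day_map G (\<phi> X Y) (Ident (FGTop G) (?F Z))))"
    let ?R = "fcomp G (\<phi> X (smash Y Z)) (fcomp G (day_map G (Ident (FGTop G) (?F X)) (\<phi> Y Z)) (day_assoc G (?F X) (?F Y) (?F Z)))"
    note L1 = fcomp_in[OF l(1) \<phi>_in[OF XY Z]] and R1 = fcomp_in[OF da(1) r(1)]
    show "?L = ?R"
    \<comment> \<open>Here the source is an iterated convolution. Its generators are built with
      \<open>day_gen\<close> twice, and both composites send the one over ((x, y), z) to the
      generator over (x, (y, z)).\<close>
    proof (rule free_on_eqI[OF D fcomp_in[OF L1 fa_F1_fun_in[OF as]] fcomp_in[OF R1 \<phi>_in[OF X YZ]]])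
      fix q assume q: "q \<in> pts (smash (smash X Y) Z)"
      then obtain p z where pz: "p \<in> pts (smash X Y)" "z \<in> pts Z" "q = smash_cls (smash X Y) Z p z" by (rule pts_smashE)
      obtain x y where xy: "x \<in> pts X" "y \<in> pts Y" "p = smash_cls X Y x y" using pz(1) by (rule pts_smashE)
      note qin = free_onD(4)[OF D q]
      note x_y = smash_cls_in[OF xy(1,2)] and y_z = smash_cls_in[OF xy(2) pz(2)]
      note uz = free_onD(4)[OF free[OF Z] pz(2)] and ux = free_onD(4)[OF free[OF X] xy(1)]
      have "mor (mor ?L 1) (mor ?g q) = mor (?u (smash X (smash Y Z))) (smash_cls X (smash Y Z) x (smash_cls Y Z y z))"
        unfolding mor_fcomp[OF L1 qin] mor_fcomp[OF l(1) qin]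
        unfolding pz(3) l(2)[OF pz(1,2)] mor_fident[OF uz]
        unfolding xy(3) \<phi>_gen[OF X Y xy(1,2)] mor_day_gen[OF free[OF XY] free[OF Z] x_y pz(2), symmetric]
          \<phi>_gen[OF XY Z x_y pz(2)] F1_fun_unit[OF as smash_cls_in[OF x_y pz(2)]] mor_Assoc[OF xy(1,2) pz(2)] ..
      moreover have "mor (mor ?R 1) (mor ?g q) = mor (?u (smash X (smash Y Z))) (smash_cls X (smash Y Z) x (smash_cls Y Z y z))"
        unfolding mor_fcomp[OF R1 qin] mor_fcomp[OF da(1) qin]
        unfolding pz(3) xy(3) da(2)[OF xy(1,2) pz(2)] r(2)[OF xy(1) y_z] mor_fident[OF ux]
          \<phi>_gen[OF Y Z xy(2) pz(2)] mor_day_gen[OF free[OF X] free[OF YZ] xy(1) y_z, symmetric]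
          \<phi>_gen[OF X YZ xy(1) y_z] ..
      ultimately show "mor (mor ?L 1) (mor ?g q) = mor (mor ?R 1) (mor ?g q)" by simp
    qed
  next
    fix X :: "('g, 'u) bspace"
    assume "X \<in> {X. based_g_space G X \<and> nondegenerate G X}"
    then have X: "based_g_space G X" by auto
    note iX = fident_in[OF free_onD(1)[OF free[OF X]]]
    note l = day_map_free[OF free_on_IF free[OF X] free[OF S] free[OF X] \<epsilon>(1) iX]
    note r = day_map_free[OF free[OF X] free_on_IF free[OF X] free[OF S] iX \<epsilon>(1)]
    note dl = day_lunit_free[OF free[OF X]] and dr = day_runit_free[OF free[OF X]]
    note DL = free_on_day[OF free_on_IF free[OF X]] and DR = free_on_day[OF free[OF X] free_on_IF]
    let ?L = "fcomp G (fa (F1 G) (LUnit (GTop G) X)) (fcomp G (\<phi> ?S X) (day_map G \<epsilon> (Ident (FGTop G) (?F X))))"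
    let ?R = "fcomp G (fa (F1 G) (RUnit (GTop G) X)) (fcomp G (\<phi> X ?S) (day_map G (Ident (FGTop G) (?F X)) \<epsilon>))"
    note L1 = fcomp_in[OF l(1) \<phi>_in[OF S X]] and R1 = fcomp_in[OF r(1) \<phi>_in[OF X S]]
    note lu = LUnit_in[OF X] and ru = RUnit_in[OF X]
    show "?L = day_lunit G (?F X)"
    proof (rule free_on_eqI[OF DL fcomp_in[OF L1 fa_F1_fun_in[OF lu]] dl(1)])
      let ?g = "day_gen G IF (?F X) (Ident (GTop G) ?S) (?u X)"
      fix q assume q: "q \<in> pts (smash ?S X)"
      then obtain s x where sx: "s \<le> 1" "x \<in> pts X" "q = wcls 1 X s x" by (rule pts_wedgeE)
      note qin = free_onD(4)[OF DL q] and ux = free_onD(4)[OF free[OF X] sx(2)]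
      have s: "unat s \<in> pts ?S" using sx(1) by simp
      have "mor (mor ?L 1) (mor ?g q) = mor (?u X) (mor (LUnit (GTop G) X) q)"
        unfolding mor_fcomp[OF L1 qin] mor_fcomp[OF l(1) qin]
        unfolding sx(3) l(2)[OF s sx(2)] \<epsilon>(2)[OF s] mor_fident[OF ux]
          mor_day_gen[OF free[OF S] free[OF X] s sx(2), symmetric] \<phi>_gen[OF S X s sx(2)]
          F1_fun_unit[OF lu smash_cls_in[OF s sx(2)]] ..
      then show "mor (mor ?L 1) (mor ?g q) = mor (mor (day_lunit G (?F X)) 1) (mor ?g q)"
        unfolding sx(3) dl(2)[OF sx(1,2)] .
    qed
    show "?R = day_runit G (?F X)"
    proof (rule free_on_eqI[OF DR fcomp_in[OF R1 fa_F1_fun_in[OF ru]] dr(1)])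
      let ?g = "day_gen G (?F X) IF (?u X) (Ident (GTop G) ?S)"
      fix q assume q: "q \<in> pts (smash X ?S)"
      then obtain s x where sx: "s \<le> 1" "x \<in> pts X" "q = smash_cls X ?S x (unat s)" by (rule pts_smash_dspaceE)
      note qin = free_onD(4)[OF DR q] and ux = free_onD(4)[OF free[OF X] sx(2)]
      have s: "unat s \<in> pts ?S" using sx(1) by simp
      have "mor (mor ?R 1) (mor ?g q) = mor (?u X) (mor (RUnit (GTop G) X) q)"
        unfolding mor_fcomp[OF R1 qin] mor_fcomp[OF r(1) qin]
        unfolding sx(3) r(2)[OF sx(2) s] \<epsilon>(2)[OF s] mor_fident[OF ux]
          mor_day_gen[OF free[OF X] free[OF S] sx(2) s, symmetric] \<phi>_gen[OF X S sx(2) s]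
          F1_fun_unit[OF ru smash_cls_in[OF sx(2) s]] ..
      then show "mor (mor ?R 1) (mor ?g q) = mor (mor (day_runit G (?F X)) 1) (mor ?g q)"
        unfolding sx(3) dr(2)[OF sx(1,2)] .
    qed
  qed
qed

end

theorem lemma6p6:
  fixes G :: "('g, 'r) monoid_scheme"
  assumes "group G" and "finite (carrier G)" and "infinite (UNIV :: 'u set)"
  shows "strong_symmetric_monoidal
           (GT G :: (('g, 'u) bspace, ('g, 'u) bmap) moncat)
           (FG G :: (('g, 'u) fspace, ('g, 'u) ftrans) moncat)
           (F1 G)"
proof -
  interpret gspaces G "TYPE('u)"
    using assms(1,3) by (simp add: gspaces_def gspaces_axioms_def)
  show ?thesis by (rule strong_symmetric_monoidal_F1)
qed

end
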